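(* Let $x,y,z\subseteq\omega$ with $x$ and $y$ mutually ITRM-c-random. If $z\le_{\mathrm{ITRM}}x$ and $z\le_{\mathrm{ITRM}}y$, then $z$ is ITRM-computable.
   Context: Reals are subsets of $\omega$. An infinite time register machine (ITRM) has finitely many registers, each holding a natural number, and runs a finite register-machine program in transfinite ordinal time; with an oracle $x\subseteq\omega$ it may test whether the content of a register belongs to $x$. At successor times it acts as an ordinary register machine; at limit times the active program line is the $\liminf$ of the earlier program lines, and each register holds the $\liminf$ of its earlier contents if that is finite, and $0$ otherwise. $P^x\downarrow=i$ means program $P$ with oracle $x$ halts with output $i$. $x\le_{\mathrm{ITRM}}y$ iff there is a program $P$ such that for every $i\in\omega$, $P^y(i)$ halts with output $1$ if $i\in x$ and $0$ otherwise; ITRM-computable means $\le_{\mathrm{ITRM}}\emptyset$. $a\oplus b=\{2i:i\in a\}\cup\{2j+1:j\in b\}$. A set $X$ of reals is ITRM-decidable in the oracle $y$ iff there is a program $P$ with $P^{w\oplus y}\downarrow=1$ for $w\in X$ and $P^{w\oplus y}\downarrow=0$ for $w\notin X$. A real $x$ is ITRM-c-random relative to $y$ iff $x$ lies in no meager set of reals ITRM-decidable in the oracle $y$. $x$ and $y$ are mutually ITRM-c-random iff $x$ is ITRM-c-random relative to $y$ and $y$ is ITRM-c-random relative to $x$. *)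

theory Defs
  imports "HOL-Analysis.Analysis"
begin

text \<open>Instructions: zero a register, increment a register, copy register m to n,
  jump to line q if registers m and n are equal, and the oracle instruction
  jump to line q if the content of register n belongs to the oracle.
  A program is a list of instructions; lines are numbered from 0, and the
  machine halts as soon as the active line is not a line of the program.
  Registers are indexed by nat, but a program mentions only finitely many.\<close>

datatype instr =
    Zero nat
  | Inc nat
  | Copy nat nat
  | JumpEq nat nat nat
  | OracleJump nat nat

type_synonym program = "instr list"

type_synonym config = "nat \<times> (nat \<Rightarrow> nat)"

definition halted :: "program \<Rightarrow> config \<Rightarrow> bool" where
  "halted P c \<longleftrightarrow> fst c \<ge> length P"

fun exec :: "instr \<Rightarrow> nat set \<Rightarrow> config \<Rightarrow> config" where
  "exec (Zero n) x (l, R) = (Suc l, R(n := 0))"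
| "exec (Inc n) x (l, R) = (Suc l, R(n := Suc (R n)))"
| "exec (Copy m n) x (l, R) = (Suc l, R(n := R m))"
| "exec (JumpEq m n q) x (l, R) = (if R m = R n then q else Suc l, R)"
| "exec (OracleJump n q) x (l, R) = (if R n \<in> x then q else Suc l, R)"

text \<open>Successor step of the machine with oracle x (only used on non-halted configurations).\<close>
definition step :: "program \<Rightarrow> nat set \<Rightarrow> config \<Rightarrow> config" where
  "step P x c = exec (P ! fst c) x c"

definition strict_below :: "'a rel \<Rightarrow> 'a \<Rightarrow> 'a \<Rightarrow> bool" where
  "strict_below r b a \<longleftrightarrow> (b, a) \<in> r \<and> b \<noteq> a"

definition is_min_of :: "'a rel \<Rightarrow> 'a \<Rightarrow> bool" where
  "is_min_of r a \<longleftrightarrow> a \<in> Field r \<and> (\<forall>b\<in>Field r. (a, b) \<in> r)"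

definition is_max_of :: "'a rel \<Rightarrow> 'a \<Rightarrow> bool" where
  "is_max_of r a \<longleftrightarrow> a \<in> Field r \<and> (\<forall>b\<in>Field r. (b, a) \<in> r)"

definition imm_pred :: "'a rel \<Rightarrow> 'a \<Rightarrow> 'a \<Rightarrow> bool" where
  "imm_pred r b a \<longleftrightarrow> strict_below r b a \<and> \<not> (\<exists>d. strict_below r b d \<and> strict_below r d a)"

text \<open>Liminf of a nat-valued function f along the times strictly below the limit time a:
  if it is finite, it is the least n such that values \<le> n occur cofinally below a;
  if it is infinite (no such n), the register is reset to 0.\<close>
definition liminf_below :: "'a rel \<Rightarrow> 'a \<Rightarrow> ('a \<Rightarrow> nat) \<Rightarrow> nat" where
  "liminf_below r a f =
     (if \<exists>n. \<forall>b. strict_below r b a \<longrightarrow> (\<exists>d. (b, d) \<in> r \<and> strict_below r d a \<and> f d \<le> n)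
      then (LEAST n. \<forall>b. strict_below r b a \<longrightarrow> (\<exists>d. (b, d) \<in> r \<and> strict_below r d a \<and> f d \<le> n))
      else 0)"

definition halting_run ::
  "program \<Rightarrow> nat set \<Rightarrow> (nat \<Rightarrow> nat) \<Rightarrow> 'a rel \<Rightarrow> ('a \<Rightarrow> config) \<Rightarrow> bool" where
  "halting_run P x init r c \<longleftrightarrow>
     Well_order r \<and>
     (\<exists>m. is_max_of r m) \<and>
     (\<forall>a. is_min_of r a \<longrightarrow> c a = (0, init)) \<and>
     (\<forall>a b. imm_pred r b a \<longrightarrow> c a = step P x (c b)) \<and>
     (\<forall>a. a \<in> Field r \<and> \<not> is_min_of r a \<and> \<not> (\<exists>b. imm_pred r b a) \<longrightarrow>
         c a = (liminf_below r a (\<lambda>d. fst (c d)), \<lambda>k. liminf_below r a (\<lambda>d. snd (c d) k))) \<and>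
     (\<forall>a\<in>Field r. halted P (c a) \<longleftrightarrow> is_max_of r a)"

text \<open>P with oracle x on input i (placed in register 0, all other registers 0) halts
  with output j (the content of register 0 at the halting time).  Time points are
  taken from the type nat set; every halting ITRM computation halts at a countable
  ordinal, so this loses nothing.\<close>
definition halts_with :: "program \<Rightarrow> nat set \<Rightarrow> nat \<Rightarrow> nat \<Rightarrow> bool" where
  "halts_with P x i j \<longleftrightarrow>
     (\<exists>(r :: nat set rel) c m. halting_run P x (\<lambda>k. if k = 0 then i else 0) r c \<and>
        is_max_of r m \<and> snd (c m) 0 = j)"

definition itrm_reducible :: "nat set \<Rightarrow> nat set \<Rightarrow> bool" (infix "\<le>\<^sub>I\<^sub>T\<^sub>R\<^sub>M" 50) where
  "x \<le>\<^sub>I\<^sub>T\<^sub>R\<^sub>M y \<longleftrightarrow>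
     (\<exists>P. \<forall>i. (i \<in> x \<longrightarrow> halts_with P y i 1) \<and> (i \<notin> x \<longrightarrow> halts_with P y i 0))"

definition itrm_computable :: "nat set \<Rightarrow> bool" where
  "itrm_computable x \<longleftrightarrow> x \<le>\<^sub>I\<^sub>T\<^sub>R\<^sub>M {}"

definition join :: "nat set \<Rightarrow> nat set \<Rightarrow> nat set" (infixl "\<oplus>\<^sub>r" 65) where
  "a \<oplus>\<^sub>r b = {2 * i | i. i \<in> a} \<union> {2 * j + 1 | j. j \<in> b}"

definition itrm_decidable_in :: "nat set set \<Rightarrow> nat set \<Rightarrow> bool" where
  "itrm_decidable_in X y \<longleftrightarrow>
     (\<exists>P. \<forall>w. (w \<in> X \<longrightarrow> halts_with P (w \<oplus>\<^sub>r y) 0 1) \<and> (w \<notin> X \<longrightarrow> halts_with P (w \<oplus>\<^sub>r y) 0 0))"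

text \<open>Reals are identified with points of Cantor space nat \<Rightarrow> bool (product topology)
  via their characteristic functions.\<close>
definition nowhere_dense :: "'a::topological_space set \<Rightarrow> bool" where
  "nowhere_dense A \<longleftrightarrow> interior (closure A) = {}"

definition meager :: "'a::topological_space set \<Rightarrow> bool" where
  "meager A \<longleftrightarrow> (\<exists>F. countable F \<and> (\<forall>N\<in>F. nowhere_dense N) \<and> A \<subseteq> \<Union>F)"

definition meager_reals :: "nat set set \<Rightarrow> bool" where
  "meager_reals X \<longleftrightarrow> meager ((\<lambda>w n. n \<in> w) ` X :: (nat \<Rightarrow> bool) set)"

definition itrm_c_random_rel :: "nat set \<Rightarrow> nat set \<Rightarrow> bool" where
  "itrm_c_random_rel x y \<longleftrightarrow>
     (\<forall>X. meager_reals X \<and> itrm_decidable_in X y \<longrightarrow> x \<notin> X)"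

definition mutually_itrm_c_random :: "nat set \<Rightarrow> nat set \<Rightarrow> bool" where
  "mutually_itrm_c_random x y \<longleftrightarrow> itrm_c_random_rel x y \<and> itrm_c_random_rel y x"

end

theory Submission
  imports Defs "HOL-Library.Nat_Bijection"
begin

text \<open>
  A run of a program is governed by its wild limits, the limit times at which some component of the
  configuration (the line or a register) diverges. Call a wild limit of level \<open>k + 1\<close> if wild limits of
  level \<open>k\<close> are cofinal below it. A component diverging at such a limit is positive just before it,
  whereas components diverging at a wild limit are reset to \<open>0\<close> there; so nested wild limits have
  disjoint sets of diverging components, and a program with \<open>n\<close> components has none of level \<open>n + 1\<close>.
  Between two wild limits of the same level every limit is tame or of lower level, and a tame limit
  can be recognised by an \<open>\<omega>\<close>-rule: if for every \<open>j\<close> the run returns \<open>j\<close> times to the bound \<open>v\<close>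
  without ever falling below it, then it reaches the configuration \<open>v\<close>. Hence a halting run is
  described by a finite iteration of least fixed points over the naturals, without ordinals and
  uniformly in the oracle.

  Such fixed points are won positions of open games. Losing strategies are infinite branches of a
  decidable tree, so a depth-first search, whose stack overflows exactly along an infinite branch,
  decides them on an ITRM. Replacing positions by pairs of a Cohen condition and a position gives
  an oracle-free game whose won positions are the forcing relation, and for the truth lemma it is
  enough that the oracle meets every dense set of conditions that is ITRM-decidable.

  A real that is ITRM-c-random relative to \<open>y\<close> meets all these dense sets. If \<open>z\<close> is computed from
  \<open>x\<close> and from \<open>y\<close>, then the conditions forcing a wrong bit of \<open>z\<close> form a set decidable in \<open>y\<close>, which
  \<open>x\<close> does not meet; so by randomness some initial part \<open>p\<close> of \<open>x\<close> has no extension in it.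
  Below \<open>p\<close> the forcing relation computes \<open>z\<close>.
\<close>


section \<open>Transfinite runs from composable path fragments\<close>

text \<open>The length of a run depends on the oracle and is not a number that a condition could
  decide, so runs cannot be forced step by step. The number of components of a configuration does
  not depend on the oracle, which is why one definition can serve all oracles. The \<omega>-rule
  must stop at tame limits: the value 0 that a diverging component takes is announced by no return
  of the run. Wild limits are therefore read off from a completed fixed point of the level below,
  with universal statements about all that is reachable in it. Thus fixed points enter later fixed
  points under negations, and it would not do to enumerate won positions: they have to be decided.
  This also shapes the forcing part. It treats a class of predicates closed under negation and fixed
  points, and the forcing relation has to be decidable without an oracle at each step of the
  induction, since it supplies the dense sets of the next step. For fixed points even the ranks of
  positions need a decidable comparison.\<close>

definition liminf_seq :: "(nat \<Rightarrow> nat set) \<Rightarrow> nat" where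
  "liminf_seq A = (if \<exists>m. \<exists>\<^sub>\<infinity>n. \<exists>a\<in>A n. a \<le> m then LEAST m. \<exists>\<^sub>\<infinity>n. \<exists>a\<in>A n. a \<le> m else 0)"

text \<open>\<open>V\<close> collects the configurations from \<open>c\<close> inclusive to
  \<open>d\<close> exclusive. Pieces then compose by union, and the limit rule needs no times: the
  liminf along \<omega> many pieces depends only on the sets visited in them. Nonempty pieces make
  the end a genuine limit.\<close>

inductive config_path :: "program \<Rightarrow> nat set \<Rightarrow> config \<Rightarrow> config set \<Rightarrow> config \<Rightarrow> bool"
  for P w where
  refl: "config_path P w c {} c"
| step: "\<not> halted P c \<Longrightarrow> config_path P w c {c} (step P w c)"
| trans: "config_path P w c V d \<Longrightarrow> config_path P w d V' e \<Longrightarrow> config_path P w c (V \<union> V') e"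
| lim: "(\<And>n. config_path P w (f n) (V n) (f (Suc n))) \<Longrightarrow> (\<And>n. V n \<noteq> {}) \<Longrightarrow>
     config_path P w (f 0) (\<Union>n. V n) (liminf_seq (\<lambda>n. fst ` V n), \<lambda>k. liminf_seq (\<lambda>n. (\<lambda>c. snd c k) ` V n))"

lemma config_path_empty: "config_path P w c V d \<Longrightarrow> V = {} \<Longrightarrow> c = d"
  by (induction rule: config_path.induct) auto

lemma config_path_start: "config_path P w c V d \<Longrightarrow> V \<noteq> {} \<Longrightarrow> c \<in> V"
proof (induction rule: config_path.induct)
  case (trans c V d V' e)
  then show ?case using config_path_empty by (cases "V = {}") blast+
next
  case (lim f V)
  then show ?case by blast
qed auto

section \<open>Runs timed by well-ordered sets of rationals\<close>

definition liminf_on :: "rat set \<Rightarrow> (rat \<Rightarrow> nat) \<Rightarrow> nat" where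
  "liminf_on A f = (if \<exists>n. \<forall>b\<in>A. \<exists>d\<in>A. b \<le> d \<and> f d \<le> n
     then LEAST n. \<forall>b\<in>A. \<exists>d\<in>A. b \<le> d \<and> f d \<le> n else 0)"

text \<open>The configuration due when exactly the times in \<open>A\<close> have passed. First,
  successor and limit times are told apart by whether \<open>A\<close> is empty or has a maximum.
  Speaking of a set instead of a point also covers the end of a run, which is not one of its
  times.\<close>

definition next_config :: "program \<Rightarrow> nat set \<Rightarrow> config \<Rightarrow> rat set \<Rightarrow> (rat \<Rightarrow> config) \<Rightarrow> config \<Rightarrow> bool" where
  "next_config P w c A g d \<longleftrightarrow>
     (A = {} \<longrightarrow> d = c) \<and>
     (\<forall>m\<in>A. (\<forall>a\<in>A. a \<le> m) \<longrightarrow> d = step P w (g m)) \<and>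
     (A \<noteq> {} \<longrightarrow> \<not> (\<exists>m\<in>A. \<forall>a\<in>A. a \<le> m) \<longrightarrow>
        d = (liminf_on A (\<lambda>a. fst (g a)), \<lambda>k. liminf_on A (\<lambda>a. snd (g a) k)))"

definition well_ordered_set :: "rat set \<Rightarrow> bool" where
  "well_ordered_set A \<longleftrightarrow> (\<forall>B\<subseteq>A. B \<noteq> {} \<longrightarrow> (\<exists>m\<in>B. \<forall>b\<in>B. m \<le> b))"

text \<open>Every countable ordinal embeds into the rationals of \<open>[0, 1)\<close>, so runs indexed by well-ordered sets
  of such rationals can be rescaled and put one after the other without ordinal arithmetic.\<close>

definition half_open_run where
  "half_open_run P w c A g d \<longleftrightarrow> well_ordered_set A \<and> A \<subseteq> {0..<1} \<and>
     (\<forall>a\<in>A. next_config P w c {b\<in>A. b < a} g (g a) \<and> \<not> halted P (g a)) \<and> next_config P w c A g d"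

lemma liminf_on_tail:
  assumes "B \<noteq> {}" "\<And>a b. a \<in> A \<Longrightarrow> b \<in> B \<Longrightarrow> a < b"
  shows "liminf_on (A \<union> B) f = liminf_on B f"
proof -
  have "(\<forall>b\<in>A \<union> B. \<exists>d\<in>A \<union> B. b \<le> d \<and> f d \<le> n) \<longleftrightarrow> (\<forall>b\<in>B. \<exists>d\<in>B. b \<le> d \<and> f d \<le> n)" for n
  proof
    assume *: "\<forall>b\<in>A \<union> B. \<exists>d\<in>A \<union> B. b \<le> d \<and> f d \<le> n"
    show "\<forall>b\<in>B. \<exists>d\<in>B. b \<le> d \<and> f d \<le> n"
    proof
      fix b assume "b \<in> B"
      then obtain d where "d \<in> A \<union> B" "b \<le> d" "f d \<le> n" using * by blast
      moreover have "d \<notin> A" using assms(2)[of d b] \<open>b \<in> B\<close> \<open>b \<le> d\<close> by auto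
      ultimately show "\<exists>d\<in>B. b \<le> d \<and> f d \<le> n" by blast
    qed
  next
    assume *: "\<forall>b\<in>B. \<exists>d\<in>B. b \<le> d \<and> f d \<le> n"
    obtain b0 where b0: "b0 \<in> B" using assms(1) by blast
    then obtain d0 where d0: "d0 \<in> B" "f d0 \<le> n" using * by blast
    show "\<forall>b\<in>A \<union> B. \<exists>d\<in>A \<union> B. b \<le> d \<and> f d \<le> n"
    proof
      fix b assume "b \<in> A \<union> B"
      then show "\<exists>d\<in>A \<union> B. b \<le> d \<and> f d \<le> n"
      proof
        assume "b \<in> A" then show ?thesis using assms(2)[of b d0] d0 by (auto intro!: bexI[of _ d0])
      next
        assume "b \<in> B" then show ?thesis using * by blast
      qed
    qed
  qed
  then show ?thesis unfolding liminf_on_def by (simp only:)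
qed

lemma next_config_tail:
  assumes "B \<noteq> {}" "\<And>a b. a \<in> A \<Longrightarrow> b \<in> B \<Longrightarrow> a < b" "next_config P w c' B g d"
  shows "next_config P w c (A \<union> B) g d"
proof -
  obtain b0 where b0: "b0 \<in> B" using assms(1) by blast
  have mx: "m \<in> B \<and> (\<forall>a\<in>B. a \<le> m)" if "m \<in> A \<union> B" "\<forall>a\<in>A \<union> B. a \<le> m" for m
    using that assms(2)[of m b0] b0 by force
  have mx': "m \<in> A \<union> B \<and> (\<forall>a\<in>A \<union> B. a \<le> m)" if "m \<in> B" "\<forall>a\<in>B. a \<le> m" for m
    using that assms(2)[of _ m] by force
  have rt: "liminf_on (A \<union> B) f = liminf_on B f" for f using liminf_on_tail[OF assms(1,2)] by blast
  show ?thesis unfolding next_config_def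
  proof (intro conjI ballI impI)
    show "A \<union> B = {} \<Longrightarrow> d = c" using assms(1) by blast
    show "d = step P w (g m)" if "m \<in> A \<union> B" "\<forall>a\<in>A \<union> B. a \<le> m" for m
      using mx[OF that] assms(3) unfolding next_config_def by blast
    assume "\<not> (\<exists>m\<in>A \<union> B. \<forall>a\<in>A \<union> B. a \<le> m)"
    then have "\<not> (\<exists>m\<in>B. \<forall>a\<in>B. a \<le> m)" using mx' by meson
    then show "d = (liminf_on (A \<union> B) (\<lambda>a. fst (g a)), \<lambda>k. liminf_on (A \<union> B) (\<lambda>a. snd (g a) k))"
      using assms(1,3) unfolding next_config_def rt by blast
  qed
qed

lemma liminf_on_img:
  assumes "strict_mono_on B e"
  shows "liminf_on (e ` B) f = liminf_on B (\<lambda>b. f (e b))"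
proof -
  have le: "e a \<le> e b \<longleftrightarrow> a \<le> b" if "a \<in> B" "b \<in> B" for a b
    using assms that strict_mono_on_less_eq by blast
  have "(\<forall>b\<in>e ` B. \<exists>d\<in>e ` B. b \<le> d \<and> f d \<le> n) \<longleftrightarrow> (\<forall>b\<in>B. \<exists>d\<in>B. b \<le> d \<and> f (e d) \<le> n)" for n
    using le by (auto simp: image_def) metis+
  then show ?thesis unfolding liminf_on_def by (simp only:)
qed

lemma next_config_img:
  assumes "strict_mono_on B e" "next_config P w c B h d" "\<And>b. b \<in> B \<Longrightarrow> g (e b) = h b"
  shows "next_config P w c (e ` B) g d"
proof -
  have le: "e a \<le> e b \<longleftrightarrow> a \<le> b" if "a \<in> B" "b \<in> B" for a b
    using assms(1) that strict_mono_on_less_eq by blast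
  have r: "liminf_on B (\<lambda>b. f (g (e b))) = liminf_on B (\<lambda>b. f (h b))" for f :: "config \<Rightarrow> nat"
  proof -
    have "(\<forall>b\<in>B. \<exists>d\<in>B. b \<le> d \<and> f (g (e d)) \<le> n) \<longleftrightarrow> (\<forall>b\<in>B. \<exists>d\<in>B. b \<le> d \<and> f (h d) \<le> n)" for n
      using assms(3) by auto
    then show ?thesis unfolding liminf_on_def by (simp only:)
  qed
  show ?thesis unfolding next_config_def
  proof (intro conjI ballI impI)
    show "e ` B = {} \<Longrightarrow> d = c" using assms(2) by (simp add: next_config_def)
    show "d = step P w (g m)" if m: "m \<in> e ` B" "\<forall>a\<in>e ` B. a \<le> m" for m
    proof -
      obtain x where x: "x \<in> B" "m = e x" using m(1) by blast
      then have "\<forall>a\<in>B. a \<le> x" using m(2) le by blast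
      then show ?thesis using x assms(2,3) unfolding next_config_def by metis
    qed
    assume "e ` B \<noteq> {}" and "\<not> (\<exists>m\<in>e ` B. \<forall>a\<in>e ` B. a \<le> m)"
    then have "B \<noteq> {}" "\<not> (\<exists>m\<in>B. \<forall>a\<in>B. a \<le> m)" using le by blast+
    then have "d = (liminf_on B (\<lambda>a. fst (h a)), \<lambda>k. liminf_on B (\<lambda>a. snd (h a) k))"
      using assms(2) unfolding next_config_def by blast
    then show "d = (liminf_on (e ` B) (\<lambda>a. fst (g a)), \<lambda>k. liminf_on (e ` B) (\<lambda>a. snd (g a) k))"
      unfolding liminf_on_img[OF assms(1)] using r[of fst] r[of "\<lambda>c. snd c _"] by simp
  qed
qed

text \<open>The map \<open>t / (1 + t)\<close> at \<open>t = n + x\<close>: it lays \<omega> copies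
  of the unit interval one after the other inside \<open>[0, 1)\<close>, preserving order, and floor
  and fractional part undo it.\<close>

definition squash :: "nat \<Rightarrow> rat \<Rightarrow> rat" where "squash n x = (of_nat n + x) / (1 + of_nat n + x)"

lemma squash_less:
  assumes "x \<in> {0..<1}" "y \<in> {0..<1}"
  shows "squash n x < squash m y \<longleftrightarrow> n < m \<or> n = m \<and> x < y"
proof -
  have "squash n x < squash m y \<longleftrightarrow> of_nat n + x < of_nat m + y"
  proof -
    have p: "1 + of_nat n + x > 0" "1 + of_nat m + y > 0" using assms by (simp_all add: add_pos_nonneg)
    have "squash n x = 1 - 1 / (1 + of_nat n + x)" "squash m y = 1 - 1 / (1 + of_nat m + y)"
      using p unfolding squash_def by (simp_all add: field_simps)
    moreover have "1 - 1 / (1 + of_nat n + x) < 1 - 1 / (1 + of_nat m + y) \<longleftrightarrow> of_nat n + x < of_nat m + y"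
    proof -
      have "1 - 1 / (1 + of_nat n + x) < 1 - 1 / (1 + of_nat m + y) \<longleftrightarrow> 1 / (1 + of_nat m + y) < 1 / (1 + of_nat n + x)" by linarith
      also have "\<dots> \<longleftrightarrow> 1 + of_nat n + x < 1 + of_nat m + y"
        using p by (simp add: frac_less_eq divide_simps)
      finally show ?thesis by simp
    qed
    ultimately show ?thesis by simp
  qed
  also have "\<dots> \<longleftrightarrow> n < m \<or> n = m \<and> x < y"
  proof (cases n m rule: linorder_cases)
    case less then have "of_nat n + 1 \<le> (of_nat m :: rat)"
      by (metis Suc_leI of_nat_Suc of_nat_le_iff add.commute)
    then show ?thesis using less assms by auto
  next
    case greater then have "of_nat m + 1 \<le> (of_nat n :: rat)"
      by (metis Suc_leI of_nat_Suc of_nat_le_iff add.commute)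
    then show ?thesis using greater assms by auto
  qed auto
  finally show ?thesis .
qed

lemma squash_range: "x \<in> {0..<1} \<Longrightarrow> squash n x \<in> {0..<1}"
  unfolding squash_def by (simp add: divide_simps add_pos_nonneg)

definition unsquash :: "rat \<Rightarrow> nat \<times> rat" where
  "unsquash y = (let s = y / (1 - y) in (nat \<lfloor>s\<rfloor>, frac s))"

lemma unsquash_squash: assumes "x \<in> {0..<1}" shows "unsquash (squash n x) = (n, x)"
proof -
  have pos: "1 + of_nat n + x > 0" using assms by (simp add: add_pos_nonneg)
  have "1 - squash n x = 1 / (1 + of_nat n + x)"
    using pos unfolding squash_def by (simp add: divide_simps)
  then have "squash n x / (1 - squash n x) = of_nat n + x"
    using pos unfolding squash_def by (simp add: divide_simps)
  moreover have "\<lfloor>of_nat n + x\<rfloor> = int n" using assms by (simp add: floor_eq_iff)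
  ultimately show ?thesis unfolding unsquash_def Let_def frac_def by simp
qed

text \<open>Step and liminf depend only on a final segment of the past, so inside a block the clause
  of that block's own run carries over. At the first time of a block no part of it has passed; there
  the fourth conclusion, on finite sums, supplies the configuration \<open>c n\<close>. Blocks may
  be empty.\<close>

lemma half_open_run_sum:
  assumes runs: "\<And>n. half_open_run P w (c n) (A n) (g n) (c (Suc n))"
  defines "G \<equiv> \<lambda>y. g (fst (unsquash y)) (snd (unsquash y))"
  defines "S \<equiv> \<lambda>N. \<Union>n\<in>N. squash n ` A n"
  shows "well_ordered_set (S N)" "S N \<subseteq> {0..<1}"
    "\<And>a. a \<in> S UNIV \<Longrightarrow> next_config P w (c 0) {b\<in>S UNIV. b < a} G (G a) \<and> \<not> halted P (G a)"
    "next_config P w (c 0) (S {..<n}) G (c n)"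
    "G ` S N = (\<Union>n\<in>N. g n ` A n)"
proof -
  have sub: "A n \<subseteq> {0..<1}" and well_ordered_set: "well_ordered_set (A n)" for n using runs by (auto simp: half_open_run_def)
  have in01: "x \<in> {0..<1}" if "x \<in> A n" for x n using sub that by blast
  have less: "squash n x < squash m y \<longleftrightarrow> n < m \<or> n = m \<and> x < y" if "x \<in> A n" "y \<in> A m" for n m x y
    using squash_less in01 that by blast
  have le: "squash n x \<le> squash m y" if "x \<in> A n" "y \<in> A m" "n < m \<or> n = m \<and> x \<le> y" for n m x y
    using less[OF that(2,1)] that(3) by (meson leD linorder_not_less not_less_iff_gr_or_eq)
  have mono: "strict_mono_on B (squash n)" if "B \<subseteq> A n" for n B
    by (rule strict_mono_onI) (use that less in blast)
  have Gsq: "G (squash n x) = g n x" if "x \<in> A n" for n x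
    using unsquash_squash in01 that unfolding G_def by simp
  show "S N \<subseteq> {0..<1}" unfolding S_def using squash_range in01 by blast
  show "well_ordered_set (S N)" unfolding well_ordered_set_def
  proof (intro allI impI)
    fix B assume B: "B \<subseteq> S N" "B \<noteq> {}"
    then have "\<exists>n. \<exists>x\<in>A n. squash n x \<in> B" unfolding S_def by blast
    define n where "n = (LEAST n. \<exists>x\<in>A n. squash n x \<in> B)"
    have n: "\<exists>x\<in>A n. squash n x \<in> B" and nl: "\<And>m. \<exists>x\<in>A m. squash m x \<in> B \<Longrightarrow> n \<le> m"
      unfolding n_def using \<open>\<exists>n. _\<close> by (auto intro: LeastI_ex[where P="\<lambda>n. \<exists>x\<in>A n. squash n x \<in> B"] Least_le)
    then obtain m where m: "m \<in> A n" "squash n m \<in> B" "\<And>x. x \<in> A n \<Longrightarrow> squash n x \<in> B \<Longrightarrow> m \<le> x"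
      using well_ordered_set[of n, unfolded well_ordered_set_def, rule_format, of "{x\<in>A n. squash n x \<in> B}"] by auto
    show "\<exists>m\<in>B. \<forall>b\<in>B. m \<le> b"
    proof (rule bexI[OF _ m(2)], rule ballI)
      fix b assume b: "b \<in> B"
      then obtain k x where k: "x \<in> A k" "b = squash k x" using B unfolding S_def by blast
      then have "n \<le> k" using nl b by blast
      moreover have "n = k \<Longrightarrow> m \<le> x" using m(3) k b by blast
      ultimately show "squash n m \<le> b" using le[OF m(1) k(1)] k(2) by (metis nat_less_le)
    qed
  qed
  have S_Suc: "S {..<Suc n} = S {..<n} \<union> squash n ` A n" for n
    unfolding S_def by (simp add: lessThan_Suc Un_commute)
  have before: "a < b" if "a \<in> S {..<n}" "b \<in> squash n ` A n" for a b n
    using that less unfolding S_def by auto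
  show claim: "next_config P w (c 0) (S {..<n}) G (c n)" for n
  proof (induction n)
    case 0 show ?case by (simp add: S_def next_config_def)
  next
    case (Suc n)
    have nx: "next_config P w (c n) (A n) (g n) (c (Suc n))" using runs by (simp add: half_open_run_def)
    show ?case
    proof (cases "A n = {}")
      case True
      then have "c (Suc n) = c n" using nx by (simp add: next_config_def)
      then show ?thesis using Suc True S_Suc by simp
    next
      case False
      have "next_config P w (c n) (squash n ` A n) G (c (Suc n))"
        by (rule next_config_img[OF mono nx]) (use Gsq in auto)
      then show ?thesis unfolding S_Suc using False before by (intro next_config_tail) auto
    qed
  qed
  fix a assume "a \<in> S UNIV"
  then obtain n x where a: "a = squash n x" "x \<in> A n" unfolding S_def by blast
  have pre: "{b\<in>S UNIV. b < a} = S {..<n} \<union> squash n ` {b\<in>A n. b < x}"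
  proof -
    have "squash m y < a \<longleftrightarrow> m < n \<or> m = n \<and> y < x" if "y \<in> A m" for m y using a less that by blast
    then show ?thesis unfolding S_def by (auto; blast)
  qed
  have nx: "next_config P w (c n) {b\<in>A n. b < x} (g n) (g n x)" "\<not> halted P (g n x)"
    using runs a by (auto simp: half_open_run_def)
  have Ga: "G a = g n x" using a Gsq by simp
  show "next_config P w (c 0) {b\<in>S UNIV. b < a} G (G a) \<and> \<not> halted P (G a)"
  proof (cases "{b\<in>A n. b < x} = {}")
    case True
    then have "g n x = c n" using nx by (simp add: next_config_def)
    then show ?thesis using claim[of n] nx unfolding pre Ga True by simp
  next
    case False
    have "next_config P w (c n) (squash n ` {b\<in>A n. b < x}) G (g n x)"
      by (rule next_config_img[OF mono nx(1)]) (use Gsq in auto)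
    then show ?thesis unfolding pre Ga using False nx(2) before by (auto intro!: next_config_tail)
  qed
next
  have "A n \<subseteq> {0..<1}" for n using runs[of n] by (simp add: half_open_run_def)
  then have "x \<in> A n \<Longrightarrow> x \<in> {0..<1}" for n x by blast
  then have Gsq: "G (squash n x) = g n x" if "x \<in> A n" for n x
    using unsquash_squash that unfolding G_def by simp
  show "G ` S N = (\<Union>n\<in>N. g n ` A n)"
    unfolding S_def image_UN image_image using Gsq by auto
qed

lemma config_path_half_open_run: "config_path P w c V d \<Longrightarrow> \<exists>A g. half_open_run P w c A g d \<and> g ` A = V"
proof (induction rule: config_path.induct)
  case (refl c)
  have "half_open_run P w c {} (\<lambda>_. c) c" by (simp add: half_open_run_def well_ordered_set_def next_config_def)
  then show ?case by blast
next
  case (step c)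
  have e: "{b::rat. b = 0 \<and> b < 0} = {}" by auto
  have "half_open_run P w c {0} (\<lambda>_. c) (step P w c)"
    using step e by (auto simp: half_open_run_def well_ordered_set_def next_config_def)
  moreover have "(\<lambda>_. c) ` {0::rat} = {c}" by simp
  ultimately show ?case by blast
next
  case (trans c V d V' e)
  then obtain A1 g1 A2 g2 where 1: "half_open_run P w c A1 g1 d" "g1 ` A1 = V"
    and 2: "half_open_run P w d A2 g2 e" "g2 ` A2 = V'" by blast
  \<comment> \<open>Two pieces are an \<omega>-sum whose blocks are empty from the third on; empty
    blocks leave the configuration at \<open>e\<close>.\<close>
  define cc where "cc n = (if n = 0 then c else if n = 1 then d else e)" for n :: nat
  define A where "A n = (if n = 0 then A1 else if n = 1 then A2 else {})" for n :: nat
  define g where "g n = (if n = 0 then g1 else g2)" for n :: nat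
  have r: "half_open_run P w (cc n) (A n) (g n) (cc (Suc n))" for n
    using 1 2 by (auto simp: cc_def A_def g_def half_open_run_def well_ordered_set_def next_config_def)
  define S where "S N = (\<Union>n\<in>N. squash n ` A n)" for N
  have S2: "S UNIV = S {..<2}" by (auto simp: S_def A_def split: if_splits) force+
  note s = half_open_run_sum[of P w cc A g, OF r, folded S_def]
  have "half_open_run P w c (S UNIV) (\<lambda>y. g (fst (unsquash y)) (snd (unsquash y))) e"
    unfolding half_open_run_def using s(1,2)[of UNIV] s(3) s(4)[of 2] S2 by (auto simp: cc_def)
  moreover have "(\<lambda>y. g (fst (unsquash y)) (snd (unsquash y))) ` S UNIV = V \<union> V'"
    unfolding S2 s(5) using 1 2 by (auto simp: A_def g_def lessThan_nat_numeral lessThan_Suc numeral_2_eq_2)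
  ultimately show ?case by blast
next
  case (lim f V)
  then have "\<forall>n. \<exists>A g. half_open_run P w (f n) A g (f (Suc n)) \<and> g ` A = V n" by blast
  then obtain A g where Ag: "\<And>n. half_open_run P w (f n) (A n) (g n) (f (Suc n))" "\<And>n. g n ` A n = V n"
    by metis
  define S where "S N = (\<Union>n\<in>N. squash n ` A n)" for N
  define G where "G y = g (fst (unsquash y)) (snd (unsquash y))" for y
  note s = half_open_run_sum[of P w f A g, OF Ag(1), folded S_def, folded G_def]
  have "A n \<subseteq> {0..<1}" for n using Ag(1)[of n] by (simp add: half_open_run_def)
  then have in01: "x \<in> A n \<Longrightarrow> x \<in> {0..<1}" for n x by blast
  have less: "squash n x < squash m y \<longleftrightarrow> n < m \<or> n = m \<and> x < y" if "x \<in> A n" "y \<in> A m" for n m x y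
    using squash_less in01 that by blast
  have Gsq: "G (squash n x) = g n x" if "x \<in> A n" for n x
    using unsquash_squash in01 that unfolding G_def by simp
  have ne: "A n \<noteq> {}" for n using Ag(2)[of n] lim(2)[of n] by auto
  have nomax: "\<not> (\<exists>m\<in>S UNIV. \<forall>a\<in>S UNIV. a \<le> m)"
  proof
    assume "\<exists>m\<in>S UNIV. \<forall>a\<in>S UNIV. a \<le> m"
    then obtain n x where "x \<in> A n" and *: "\<And>a. a \<in> S UNIV \<Longrightarrow> a \<le> squash n x" unfolding S_def by blast
    obtain y where y: "y \<in> A (Suc n)" using ne by blast
    then have "squash n x < squash (Suc n) y" using less \<open>x \<in> A n\<close> by simp
    then show False using *[of "squash (Suc n) y"] y by (auto simp: S_def)
  qed
  \<comment> \<open>For each threshold \<open>k\<close>, values at most \<open>k\<close> recur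
    cofinally among the rationals iff they recur in infinitely many blocks, because every block is
    nonempty and lies below the next.\<close>
  have lims: "liminf_on (S UNIV) (\<lambda>a. h (G a)) = liminf_seq (\<lambda>n. h ` V n)" for h :: "config \<Rightarrow> nat"
  proof -
    have "(\<forall>b\<in>S UNIV. \<exists>d\<in>S UNIV. b \<le> d \<and> h (G d) \<le> k) \<longleftrightarrow> (\<exists>\<^sub>\<infinity>n. \<exists>a\<in>h ` V n. a \<le> k)" for k
    proof
      assume *: "\<forall>b\<in>S UNIV. \<exists>d\<in>S UNIV. b \<le> d \<and> h (G d) \<le> k"
      show "\<exists>\<^sub>\<infinity>n. \<exists>a\<in>h ` V n. a \<le> k" unfolding INFM_nat_le
      proof
        fix m obtain y where y: "y \<in> A m" using ne by blast
        then have "squash m y \<in> S UNIV" by (auto simp: S_def)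
        then obtain n x where x: "x \<in> A n" "squash m y \<le> squash n x" "h (G (squash n x)) \<le> k"
          using * unfolding S_def by blast
        then have "m \<le> n" using less[OF x(1) y] by (meson leD linorder_not_less)
        moreover have "g n x \<in> V n" using x Ag(2) by blast
        ultimately show "\<exists>n\<ge>m. \<exists>a\<in>h ` V n. a \<le> k" using x Gsq by auto
      qed
    next
      assume *: "\<exists>\<^sub>\<infinity>n. \<exists>a\<in>h ` V n. a \<le> k"
      show "\<forall>b\<in>S UNIV. \<exists>d\<in>S UNIV. b \<le> d \<and> h (G d) \<le> k"
      proof
        fix b assume "b \<in> S UNIV"
        then obtain m y where b: "b = squash m y" "y \<in> A m" unfolding S_def by blast
        obtain n where n: "n \<ge> Suc m" "\<exists>a\<in>h ` V n. a \<le> k" using * unfolding INFM_nat_le by blast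
        then obtain x where x: "x \<in> A n" "h (g n x) \<le> k" unfolding Ag(2)[symmetric] by auto
        then have "b \<le> squash n x" "squash n x \<in> S UNIV" using less[OF b(2) x(1)] n b by (auto simp: S_def)
        then show "\<exists>d\<in>S UNIV. b \<le> d \<and> h (G d) \<le> k" using x Gsq by auto
      qed
    qed
    then show ?thesis unfolding liminf_on_def liminf_seq_def by (simp only:)
  qed
  have "S UNIV \<noteq> {}" using ne by (auto simp: S_def)
  then have "next_config P w (f 0) (S UNIV) G (liminf_seq (\<lambda>n. fst ` V n), \<lambda>k. liminf_seq (\<lambda>n. (\<lambda>c. snd c k) ` V n))"
    unfolding next_config_def using nomax lims[of fst] lims[of "\<lambda>c. snd c _"] by auto
  then have "half_open_run P w (f 0) (S UNIV) G (liminf_seq (\<lambda>n. fst ` V n), \<lambda>k. liminf_seq (\<lambda>n. (\<lambda>c. snd c k) ` V n))"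
    unfolding half_open_run_def using s(1,2)[of UNIV] s(3) by auto
  moreover have "G ` S UNIV = (\<Union>n. V n)" using s(5)[of UNIV] Ag(2) by simp
  ultimately show ?case by blast
qed

text \<open>The halting configuration needs a time of its own, the maximum of the order; the
  rational 2 lies above all times in \<open>[0, 1)\<close>. The singletons \<open>{to_nat q}\<close>
  move the times into the type demanded by \<open>halts_with\<close>.\<close>

lemma config_path_halts:
  assumes "config_path P w (0, \<lambda>k. if k = 0 then i else 0) V d" "halted P d" "snd d 0 = j"
  shows "halts_with P w i j"
proof -
  obtain A g where "half_open_run P w (0, \<lambda>k. if k = 0 then i else 0) A g d"
    using config_path_half_open_run[OF assms(1)] by blast
  then have A: "well_ordered_set A" "A \<subseteq> {0..<1}" and nx: "\<And>a. a \<in> A \<Longrightarrow> next_config P w (0, \<lambda>k. if k = 0 then i else 0) {b\<in>A. b < a} g (g a)"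
    and nh: "\<And>a. a \<in> A \<Longrightarrow> \<not> halted P (g a)" and nA: "next_config P w (0, \<lambda>k. if k = 0 then i else 0) A g d"
    unfolding half_open_run_def by auto
  define B where "B = insert 2 A"
  define \<phi> where "\<phi> q = {to_nat q}" for q :: rat
  define h where "h = g(2 := d)"
  define r where "r = {(\<phi> a, \<phi> b) | a b. a \<in> B \<and> b \<in> B \<and> a \<le> b}"
  define c where "c s = h (from_nat (the_elem s))" for s
  have inj: "\<phi> a = \<phi> b \<longleftrightarrow> a = b" for a b unfolding \<phi>_def by simp
  have c\<phi>: "c (\<phi> a) = h a" for a unfolding c_def \<phi>_def by simp
  have r_iff: "(\<phi> a, \<phi> b) \<in> r \<longleftrightarrow> a \<in> B \<and> b \<in> B \<and> a \<le> b" for a b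
    unfolding r_def using inj by auto
  have F: "Field r = \<phi> ` B" unfolding r_def Field_def by auto
  have A2: "a < 2" if "a \<in> A" for a using A that by force
  have sb: "strict_below r (\<phi> a) (\<phi> b) \<longleftrightarrow> a \<in> B \<and> b \<in> B \<and> a < b" for a b
    unfolding strict_below_def r_iff inj by auto
  have sbE: "\<exists>a\<in>B. s = \<phi> a" if "strict_below r s t \<or> strict_below r t s \<or> s \<in> Field r" for s t
    using that unfolding strict_below_def r_def Field_def by auto
  have mn: "is_min_of r (\<phi> a) \<longleftrightarrow> a \<in> B \<and> (\<forall>b\<in>B. a \<le> b)" for a
    unfolding is_min_of_def F using r_iff inj by (auto simp: image_iff)
  have mx: "is_max_of r s \<longleftrightarrow> s = \<phi> 2" for s
  proof
    assume "is_max_of r s"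
    then obtain a where a: "s = \<phi> a" "a \<in> B" "\<forall>b\<in>B. b \<le> a"
      unfolding is_max_of_def F using r_iff by auto
    then have "2 \<le> a" by (auto simp: B_def)
    then show "s = \<phi> 2" using a A2 by (force simp: B_def)
  next
    assume "s = \<phi> 2" then show "is_max_of r s"
      unfolding is_max_of_def F using r_iff A2 by (auto simp: B_def intro: less_imp_le)
  qed
  have im: "imm_pred r (\<phi> b) (\<phi> a) \<longleftrightarrow> b \<in> B \<and> a \<in> B \<and> b < a \<and> (\<forall>x\<in>B. x < a \<longrightarrow> x \<le> b)" for a b
  proof -
    have "(\<exists>s. strict_below r (\<phi> b) s \<and> strict_below r s (\<phi> a)) \<longleftrightarrow> (\<exists>x\<in>B. b < x \<and> x < a) \<and> a \<in> B \<and> b \<in> B"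
      using sb sbE by metis
    then show ?thesis unfolding imm_pred_def sb by force
  qed
  have nB: "next_config P w (0, \<lambda>k. if k = 0 then i else 0) {b\<in>B. b < a} h (h a)" if "a \<in> B" for a
  proof (cases "a = 2")
    case True
    have "{b\<in>B. b < 2} = A" using A2 by (auto simp: B_def)
    moreover have "next_config P w (0, \<lambda>k. if k = 0 then i else 0) (id ` A) h d"
      by (rule next_config_img[OF _ nA]) (use A2 in \<open>auto simp: strict_mono_on_def h_def\<close>)
    ultimately show ?thesis using True by (simp add: h_def)
  next
    case False
    then have aA: "a \<in> A" using that by (auto simp: B_def)
    have "{b\<in>B. b < a} = {b\<in>A. b < a}" using A2[OF aA] by (auto simp: B_def)
    moreover have "next_config P w (0, \<lambda>k. if k = 0 then i else 0) (id ` {b\<in>A. b < a}) h (g a)"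
      by (rule next_config_img[OF _ nx[OF aA]]) (use A2 in \<open>auto simp: strict_mono_on_def h_def\<close>)
    ultimately show ?thesis using False by (simp add: h_def)
  qed
  have wosB: "\<exists>m\<in>C. \<forall>b\<in>C. m \<le> b" if "C \<subseteq> B" "C \<noteq> {}" for C
  proof (cases "C \<inter> A = {}")
    case True then have "C = {2}" using that by (auto simp: B_def) then show ?thesis by simp
  next
    case False
    then obtain m where m: "m \<in> C \<inter> A" "\<forall>b\<in>C \<inter> A. m \<le> b"
      using A(1) unfolding well_ordered_set_def by (meson Int_lower2)
    then show ?thesis using that A2[of m] by (intro bexI[of _ m]) (auto simp: B_def less_imp_le)
  qed
  have "Well_order r"
  proof -
    have "Linear_order r"
      unfolding linear_order_on_def partial_order_on_def preorder_on_def refl_on_def trans_def antisym_def total_on_def F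
      using r_iff inj unfolding r_def by auto
    moreover have "wf (r - Id)"
    proof (rule wfI_min)
      fix x and Q :: "nat set set" assume x: "x \<in> Q"
      show "\<exists>z\<in>Q. \<forall>y. (y, z) \<in> r - Id \<longrightarrow> y \<notin> Q"
      proof (cases "\<exists>a\<in>B. \<phi> a \<in> Q")
        case False
        \<comment> \<open>Sets that code no time have no predecessors, so any such member of
          \<open>Q\<close> is minimal.\<close>
        then show ?thesis using x unfolding r_def by blast
      next
        case True
        then obtain m where "m \<in> B" "\<phi> m \<in> Q" "\<And>a. a \<in> B \<Longrightarrow> \<phi> a \<in> Q \<Longrightarrow> m \<le> a"
          using wosB[of "{a\<in>B. \<phi> a \<in> Q}"] by auto
        then show ?thesis using inj unfolding r_def by (intro bexI[of _ "\<phi> m"]) force+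
      qed
    qed
    ultimately show ?thesis unfolding well_order_on_def by simp
  qed
  moreover have "\<forall>s. is_min_of r s \<longrightarrow> c s = (0, \<lambda>k. if k = 0 then i else 0)"
  proof (intro allI impI)
    fix s assume s: "is_min_of r s"
    then obtain a where a: "s = \<phi> a" "a \<in> B" using F unfolding is_min_of_def by auto
    then have "{b\<in>B. b < a} = {}" using s mn by force
    then show "c s = (0, \<lambda>k. if k = 0 then i else 0)" using nB[OF a(2)] a c\<phi> unfolding next_config_def by simp
  qed
  moreover have "\<forall>s t. imm_pred r t s \<longrightarrow> c s = step P w (c t)"
  proof (intro allI impI)
    fix s t assume st: "imm_pred r t s"
    then obtain a b where ab: "s = \<phi> a" "t = \<phi> b" using sbE unfolding imm_pred_def by metis
    then have *: "b \<in> B" "a \<in> B" "b < a" "\<And>x. x \<in> B \<Longrightarrow> x < a \<Longrightarrow> x \<le> b" using st im by auto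
    then show "c s = step P w (c t)" using nB[OF *(2)] ab c\<phi> unfolding next_config_def by simp
  qed
  moreover have "\<forall>s. s \<in> Field r \<and> \<not> is_min_of r s \<and> \<not> (\<exists>t. imm_pred r t s) \<longrightarrow>
     c s = (liminf_below r s (\<lambda>d. fst (c d)), \<lambda>k. liminf_below r s (\<lambda>d. snd (c d) k))"
  proof (intro allI impI)
    fix s assume s: "s \<in> Field r \<and> \<not> is_min_of r s \<and> \<not> (\<exists>t. imm_pred r t s)"
    then obtain a where a: "s = \<phi> a" "a \<in> B" using F by auto
    have ne: "{b\<in>B. b < a} \<noteq> {}" using s a mn by force
    have nm: "\<not> (\<exists>m\<in>{b\<in>B. b < a}. \<forall>x\<in>{b\<in>B. b < a}. x \<le> m)" using s a im by blast
    have L: "liminf_below r s (\<lambda>d. f (c d)) = liminf_on {b\<in>B. b < a} (\<lambda>b. f (h b))" for f :: "config \<Rightarrow> nat"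
    proof -
      have "(\<forall>b. strict_below r b s \<longrightarrow> (\<exists>d. (b, d) \<in> r \<and> strict_below r d s \<and> f (c d) \<le> n)) \<longleftrightarrow>
        (\<forall>b\<in>{b\<in>B. b < a}. \<exists>d\<in>{b\<in>B. b < a}. b \<le> d \<and> f (h d) \<le> n)" (is "?L \<longleftrightarrow> ?R") for n
      proof
        assume l: ?L
        show ?R
        proof
          fix b assume b: "b \<in> {b\<in>B. b < a}"
          then obtain d where d: "(\<phi> b, d) \<in> r" "strict_below r d s" "f (c d) \<le> n" using l sb a by blast
          then obtain x where "d = \<phi> x" using sbE by blast
          then show "\<exists>d\<in>{b\<in>B. b < a}. b \<le> d \<and> f (h d) \<le> n" using d r_iff sb a c\<phi> by auto
        qed
      next
        assume R: ?R
        show ?L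
        proof (intro allI impI)
          fix b assume b: "strict_below r b s"
          then obtain y where y: "b = \<phi> y" using sbE by blast
          then obtain x where x: "x \<in> B" "x < a" "y \<le> x" "f (h x) \<le> n" using R b sb a by blast
          then show "\<exists>d. (b, d) \<in> r \<and> strict_below r d s \<and> f (c d) \<le> n"
            using b y sb a c\<phi> r_iff by (intro exI[of _ "\<phi> x"]) auto
        qed
      qed
      then show ?thesis unfolding liminf_below_def liminf_on_def by (simp only:)
    qed
    show "c s = (liminf_below r s (\<lambda>d. fst (c d)), \<lambda>k. liminf_below r s (\<lambda>d. snd (c d) k))"
      using nB[OF a(2)] ne nm L[of fst] L[of "\<lambda>c. snd c _"] a c\<phi> unfolding next_config_def by auto
  qed
  moreover have "\<forall>s\<in>Field r. halted P (c s) \<longleftrightarrow> is_max_of r s"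
  proof
    fix s assume "s \<in> Field r"
    then obtain a where a: "s = \<phi> a" "a \<in> B" using F by auto
    then show "halted P (c s) \<longleftrightarrow> is_max_of r s"
      using mx nh c\<phi> inj assms(2) A2[of a] by (auto simp: h_def B_def)
  qed
  ultimately have "halting_run P w (\<lambda>k. if k = 0 then i else 0) r c"
    unfolding halting_run_def using mx by blast
  moreover have "snd (c (\<phi> 2)) 0 = j" using c\<phi> assms(3) by (simp add: h_def)
  ultimately show ?thesis unfolding halts_with_def using mx by blast
qed

section \<open>Program fragments\<close>

definition code_at :: "program \<Rightarrow> nat \<Rightarrow> instr list \<Rightarrow> bool" where
  "code_at P p C \<longleftrightarrow> (\<forall>i<length C. p + i < length P \<and> P ! (p + i) = C ! i)"

lemma code_at_Nil [simp]: "code_at P p []"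
  by (simp add: code_at_def)

lemma code_at_Cons [simp]:
  "code_at P p (i # C) \<longleftrightarrow> p < length P \<and> P ! p = i \<and> code_at P (Suc p) C"
  unfolding code_at_def by (auto simp: less_Suc_eq_0_disj)

lemma code_at_append [simp]:
  "code_at P p (C @ C') \<longleftrightarrow> code_at P p C \<and> code_at P (p + length C) C'"
  by (induction C arbitrary: p) auto

type_synonym regs = "nat \<Rightarrow> nat"
text \<open>Jump targets are absolute lines, so a fragment is a function of the line at which it is
  placed.\<close>

type_synonym frag = "nat \<Rightarrow> instr list"

text \<open>Total correctness at any place in any program. The intermediate configurations are
  constrained too: lines stay inside the fragment and registers satisfy \<open>I\<close> at all
  times, because an enclosing loop takes its liminf over all of them and not only over the starts of
  its rounds.\<close>

definition executes :: "nat set \<Rightarrow> frag \<Rightarrow> regs \<Rightarrow> (regs \<Rightarrow> bool) \<Rightarrow> (regs \<Rightarrow> bool) \<Rightarrow> bool" where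
  "executes w C X Q I \<longleftrightarrow> (\<forall>P p. code_at P p (C p) \<longrightarrow>
     (\<exists>Y V. config_path P w (p, X) V (p + length (C p), Y) \<and> Q Y \<and> I Y \<and>
        (\<forall>l S. (l, S) \<in> V \<longrightarrow> p \<le> l \<and> l < p + length (C p) \<and> I S)))"

definition seq_frag :: "frag \<Rightarrow> frag \<Rightarrow> frag" (infixr ";;" 60) where
  "(C ;; C') p = C p @ C' (p + length (C p))"

definition frag_of :: "instr \<Rightarrow> frag" where "frag_of i p = [i]"

definition if_equal :: "nat \<Rightarrow> nat \<Rightarrow> frag \<Rightarrow> frag \<Rightarrow> frag" where
  "if_equal m n C C' p = (let B = C' (Suc p); q = p + 2 + length B; A = C q in
     JumpEq m n q # B @ JumpEq 0 0 (q + length A) # A)"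

text \<open>The head is the smallest line of the loop and is passed in every round, so at a limit of
  rounds the liminf of the lines is the head again and the loop simply goes on.\<close>

definition loop_until :: "nat \<Rightarrow> nat \<Rightarrow> frag \<Rightarrow> frag" where
  "loop_until m n C p = (let B = C (Suc p) in JumpEq m n (p + 2 + length B) # B @ [JumpEq 0 0 p])"

lemma config_path_single:
  "p < length P \<Longrightarrow> P ! p = i \<Longrightarrow> exec i w (p, X) = d \<Longrightarrow> config_path P w (p, X) {(p, X)} d"
  using config_path.step[of P "(p, X)" w] by (simp add: halted_def step_def)

lemma executes_conseq:
  assumes "executes w C X Q I" "\<And>Y. Q Y \<Longrightarrow> I Y \<Longrightarrow> Q' Y" "\<And>S. I S \<Longrightarrow> I' S"
  shows "executes w C X Q' I'"
  using assms unfolding executes_def by meson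

lemma executes_seq:
  assumes "executes w C X (\<lambda>Y. executes w C' Y Q I) I"
  shows "executes w (C ;; C') X Q I"
  unfolding executes_def
proof (intro allI impI)
  fix P p assume "code_at P p ((C ;; C') p)"
  then have 1: "code_at P p (C p)" and 2: "code_at P (p + length (C p)) (C' (p + length (C p)))"
    by (auto simp: seq_frag_def)
  obtain Y V where Y: "config_path P w (p, X) V (p + length (C p), Y)" "executes w C' Y Q I"
    "\<And>l S. (l, S) \<in> V \<Longrightarrow> p \<le> l \<and> l < p + length (C p) \<and> I S"
    using assms 1 unfolding executes_def by metis
  obtain Z V' where Z: "config_path P w (p + length (C p), Y) V' (p + length (C p) + length (C' (p + length (C p))), Z)"
    "Q Z" "I Z" "\<And>l S. (l, S) \<in> V' \<Longrightarrow> p + length (C p) \<le> l \<and> l < p + length (C p) + length (C' (p + length (C p))) \<and> I S"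
    using Y(2) 2 unfolding executes_def by metis
  have "config_path P w (p, X) (V \<union> V') (p + length ((C ;; C') p), Z)"
    using config_path.trans[OF Y(1) Z(1)] by (simp add: seq_frag_def add.assoc)
  moreover have "p \<le> l \<and> l < p + length ((C ;; C') p) \<and> I S" if "(l, S) \<in> V \<union> V'" for l S
    using that Y(3) Z(4) by (fastforce simp: seq_frag_def)
  ultimately show "\<exists>Y V. config_path P w (p, X) V (p + length ((C ;; C') p), Y) \<and> Q Y \<and> I Y \<and>
        (\<forall>l S. (l, S) \<in> V \<longrightarrow> p \<le> l \<and> l < p + length ((C ;; C') p) \<and> I S)"
    using Z by blast
qed

lemma executes_frag_of:
  assumes "\<And>p. exec i w (p, X) = (Suc p, Y)" "I X" "I Y" "Q Y"
  shows "executes w (frag_of i) X Q I"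
  unfolding executes_def frag_of_def
proof (intro allI impI)
  fix P p assume "code_at P p [i]"
  then have "config_path P w (p, X) {(p, X)} (p + length [i], Y)" using assms(1) by (intro config_path_single) auto
  then show "\<exists>Y V. config_path P w (p, X) V (p + length [i], Y) \<and> Q Y \<and> I Y \<and>
          (\<forall>l S. (l, S) \<in> V \<longrightarrow> p \<le> l \<and> l < p + length [i] \<and> I S)"
    using assms by (intro exI[of _ Y] exI[of _ "{(p, X)}"]) auto
qed

lemma executes_Zero: "I X \<Longrightarrow> I (X(n := 0)) \<Longrightarrow> Q (X(n := 0)) \<Longrightarrow> executes w (frag_of (Zero n)) X Q I"
  by (rule executes_frag_of) auto

lemma executes_Inc: "I X \<Longrightarrow> I (X(n := Suc (X n))) \<Longrightarrow> Q (X(n := Suc (X n))) \<Longrightarrow> executes w (frag_of (Inc n)) X Q I"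
  by (rule executes_frag_of) auto

lemma executes_Copy: "I X \<Longrightarrow> I (X(n := X m)) \<Longrightarrow> Q (X(n := X m)) \<Longrightarrow> executes w (frag_of (Copy m n)) X Q I"
  by (rule executes_frag_of) auto

text \<open>\<open>i q\<close> is a conditional jump with its target left open, so one layout serves
  both tests. The branch for a failed test comes first and leaves by \<open>JumpEq 0 0\<close>, an
  unconditional jump.\<close>

lemma executes_branch:
  assumes C: "X' = X"
    and jump: "\<And>p q. exec (i q) w (p, X) = (if b then q else Suc p, X)"
    and I: "I X"
    and t: "b \<Longrightarrow> executes w C X Q I" and e: "\<not> b \<Longrightarrow> executes w C' X Q I"
  shows "executes w (\<lambda>p. let B = C' (Suc p); q = p + 2 + length B; A = C q in
     i q # B @ JumpEq 0 0 (q + length A) # A) X Q I"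
  unfolding executes_def
proof (intro allI impI, goal_cases)
  case (1 P p)
  define B where "B = C' (Suc p)"
  define q where "q = p + 2 + length B"
  define A where "A = C q"
  have at: "code_at P p (i q # B @ JumpEq 0 0 (q + length A) # A)"
    using 1 unfolding B_def q_def A_def Let_def .
  have at': "p < length P" "P ! p = i q" "code_at P (Suc p) B" "Suc p + length B < length P"
    "P ! (Suc p + length B) = JumpEq 0 0 (q + length A)" "code_at P q A"
    using at by (auto simp: q_def)
  have e1: "config_path P w (p, X) {(p, X)} (if b then q else Suc p, X)"
    using at' jump by (intro config_path_single) auto
  define N where "N = 2 + length B + length A"
  have N: "N = length (i q # B @ JumpEq 0 0 (q + length A) # A)" by (simp add: N_def)
  have "\<exists>Y V. config_path P w (p, X) V (p + N, Y) \<and> Q Y \<and> I Y \<and>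
        (\<forall>l S. (l, S) \<in> V \<longrightarrow> p \<le> l \<and> l < p + N \<and> I S)"
  proof (cases b)
    case True
    obtain Y V where Y: "config_path P w (q, X) V (q + length A, Y)" "Q Y" "I Y"
      "\<And>l S. (l, S) \<in> V \<Longrightarrow> q \<le> l \<and> l < q + length A \<and> I S"
      using t[OF True] at'(6) unfolding executes_def A_def by metis
    have "config_path P w (p, X) ({(p, X)} \<union> V) (p + N, Y)"
      using config_path.trans[OF e1, of V] Y(1) True by (simp add: N_def q_def add_ac)
    moreover have "p \<le> l \<and> l < p + N \<and> I S" if "(l, S) \<in> {(p, X)} \<union> V" for l S
      using that Y(4)[of l S] I by (auto simp: q_def N_def)
    ultimately show ?thesis using Y by blast
  next
    case False
    obtain Y V where Y: "config_path P w (Suc p, X) V (Suc p + length B, Y)" "Q Y" "I Y"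
      "\<And>l S. (l, S) \<in> V \<Longrightarrow> Suc p \<le> l \<and> l < Suc p + length B \<and> I S"
      using e[OF False] at'(3) unfolding executes_def B_def by metis
    have e2: "config_path P w (Suc p + length B, Y) {(Suc p + length B, Y)} (q + length A, Y)"
      using at' by (intro config_path_single) auto
    have "config_path P w (p, X) ({(p, X)} \<union> (V \<union> {(Suc p + length B, Y)})) (p + N, Y)"
      using config_path.trans[OF e1, of "V \<union> {(Suc p + length B, Y)}"] config_path.trans[OF Y(1) e2] False
      by (simp add: N_def q_def add_ac)
    moreover have "p \<le> l \<and> l < p + N \<and> I S" if "(l, S) \<in> {(p, X)} \<union> (V \<union> {(Suc p + length B, Y)})" for l S
      using that Y(3) Y(4)[of l S] I by (auto simp: N_def)
    ultimately show ?thesis using Y by blast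
  qed
  then show ?case unfolding N B_def q_def A_def Let_def .
qed

lemma executes_if:
  assumes "I X" "X m = X n \<Longrightarrow> executes w C X Q I" "X m \<noteq> X n \<Longrightarrow> executes w C' X Q I"
  shows "executes w (if_equal m n C C') X Q I"
proof -
  have "if_equal m n C C' = (\<lambda>p. let B = C' (Suc p); q = p + 2 + length B; A = C q in
     JumpEq m n q # B @ JumpEq 0 0 (q + length A) # A)" by (simp add: if_equal_def fun_eq_iff)
  then show ?thesis
    using executes_branch[where i="\<lambda>q. JumpEq m n q" and b="X m = X n" and X=X and X'=X, OF HOL.refl _ assms] by simp
qed

definition if_oracle :: "nat \<Rightarrow> frag \<Rightarrow> frag \<Rightarrow> frag" where
  "if_oracle m C C' p = (let B = C' (Suc p); q = p + 2 + length B; A = C q in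
     OracleJump m q # B @ JumpEq 0 0 (q + length A) # A)"

lemma executes_if_oracle:
  assumes "I X" "X m \<in> w \<Longrightarrow> executes w C X Q I" "X m \<notin> w \<Longrightarrow> executes w C' X Q I"
  shows "executes w (if_oracle m C C') X Q I"
proof -
  have "if_oracle m C C' = (\<lambda>p. let B = C' (Suc p); q = p + 2 + length B; A = C q in
     OracleJump m q # B @ JumpEq 0 0 (q + length A) # A)" by (simp add: if_oracle_def fun_eq_iff)
  then show ?thesis
    using executes_branch[where i="\<lambda>q. OracleJump m q" and b="X m \<in> w" and X=X and X'=X, OF HOL.refl _ assms] by simp
qed

text \<open>A loop sets the register \<open>F\<close> to \<open>1\<close> at the end of its body and resets it inside; as \<open>F\<close> is
  \<open>0\<close> at some time of every round, it is \<open>0\<close> at a limit of rounds, which lets the body detect limits.\<close>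

definition loop_path where
  "loop_path P w p N F X Y I \<longleftrightarrow> (\<exists>V. config_path P w (p, X) V (p, Y) \<and> V \<noteq> {} \<and>
     (\<forall>l S. (l, S) \<in> V \<longrightarrow> p \<le> l \<and> l < p + N \<and> I S) \<and> (\<exists>l S. (l, S) \<in> V \<and> S F = 0))"

lemma loop_path_trans: "loop_path P w p N F X Y I \<Longrightarrow> loop_path P w p N F Y Z I \<Longrightarrow> loop_path P w p N F X Z I"
  unfolding loop_path_def by (blast intro: config_path.trans)

lemma loop_path_mono: "loop_path P w p N F X Y I \<Longrightarrow> (\<And>S. I S \<Longrightarrow> I' S) \<Longrightarrow> loop_path P w p N F X Y I'"
  unfolding loop_path_def by meson

lemma executes_loop_until:
  assumes "\<And>P p. code_at P p (loop_until m n C p) \<Longrightarrow>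
    \<exists>Y. (Y = X \<or> loop_path P w p (length (loop_until m n C p)) F X Y I) \<and> Y m = Y n \<and> Q Y \<and> I Y"
  shows "executes w (loop_until m n C) X Q I"
  unfolding executes_def
proof (intro allI impI)
  fix P p assume at: "code_at P p (loop_until m n C p)"
  define N where "N = length (loop_until m n C p)"
  have at': "p < length P" "P ! p = JumpEq m n (p + N)" "N > 0"
    using at by (auto simp: N_def loop_until_def Let_def)
  obtain Y where Y: "Y = X \<or> loop_path P w p N F X Y I" "Y m = Y n" "Q Y" "I Y"
    using assms[OF at] unfolding N_def by blast
  then have "\<exists>V. config_path P w (p, X) V (p, Y) \<and> (\<forall>l S. (l, S) \<in> V \<longrightarrow> p \<le> l \<and> l < p + N \<and> I S)"
    unfolding loop_path_def by (auto intro: config_path.refl)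
  then obtain V where V: "config_path P w (p, X) V (p, Y)" "\<And>l S. (l, S) \<in> V \<Longrightarrow> p \<le> l \<and> l < p + N \<and> I S"
    by blast
  have "config_path P w (p, Y) {(p, Y)} (p + N, Y)" using at' Y(2) by (intro config_path_single) auto
  then have "config_path P w (p, X) (V \<union> {(p, Y)}) (p + N, Y)" using V(1) by (rule config_path.trans[rotated])
  moreover have "p \<le> l \<and> l < p + N \<and> I S" if "(l, S) \<in> V \<union> {(p, Y)}" for l S
    using that V(2) Y(4) at'(3) by auto
  ultimately show "\<exists>Y V. config_path P w (p, X) V (p + length (loop_until m n C p), Y) \<and> Q Y \<and> I Y \<and>
      (\<forall>l S. (l, S) \<in> V \<longrightarrow> p \<le> l \<and> l < p + length (loop_until m n C p) \<and> I S)"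
    unfolding N_def[symmetric] using Y(3,4) by blast
qed

lemma loop_path_step:
  assumes at: "code_at P p (loop_until m n (A ;; frag_of (Inc F)) p)" and "X m \<noteq> X n" and I: "I X"
    and A: "executes w A X (\<lambda>Y. Y F = 0 \<and> Q (Y(F := 1)) \<and> I (Y(F := 1))) I"
  shows "\<exists>Y. Q Y \<and> loop_path P w p (length (loop_until m n (A ;; frag_of (Inc F)) p)) F X Y I"
proof -
  define N where "N = length (loop_until m n (A ;; frag_of (Inc F)) p)"
  define q where "q = Suc p + length (A (Suc p))"
  have N: "p + N = q + 2" by (simp add: N_def loop_until_def Let_def seq_frag_def frag_of_def q_def)
  have at': "p < length P" "P ! p = JumpEq m n (p + N)" "code_at P (Suc p) (A (Suc p))"
     "q < length P" "P ! q = Inc F" "Suc q < length P" "P ! (Suc q) = JumpEq 0 0 p"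
    using at by (auto simp: N_def loop_until_def Let_def seq_frag_def frag_of_def q_def)
  obtain Y V where Y: "config_path P w (Suc p, X) V (q, Y)" "Y F = 0" "Q (Y(F := 1))" "I (Y(F := 1))" "I Y"
    "\<And>l S. (l, S) \<in> V \<Longrightarrow> Suc p \<le> l \<and> l < q \<and> I S"
    using A at'(3) unfolding executes_def q_def by metis
  have 1: "config_path P w (p, X) {(p, X)} (Suc p, X)" using at' assms(2) by (intro config_path_single) auto
  have 2: "config_path P w (q, Y) {(q, Y)} (Suc q, Y(F := 1))" using at' Y(2) by (intro config_path_single) auto
  have 3: "config_path P w (Suc q, Y(F := 1)) {(Suc q, Y(F := 1))} (p, Y(F := 1))" using at' by (intro config_path_single) auto
  let ?V = "{(p, X)} \<union> (V \<union> ({(q, Y)} \<union> {(Suc q, Y(F := 1))}))"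
  have "config_path P w (p, X) ?V (p, Y(F := 1))"
    by (rule config_path.trans[OF 1 config_path.trans[OF Y(1) config_path.trans[OF 2 3]]])
  moreover have "p \<le> l \<and> l < p + N \<and> I S" if "(l, S) \<in> ?V" for l S
    using that Y(4,5) Y(6)[of l S] I unfolding N by (auto simp: q_def)
  ultimately have "loop_path P w p N F X (Y(F := 1)) I"
    unfolding loop_path_def using Y(2) by (intro exI[of _ ?V]) blast
  then show ?thesis using Y(3) unfolding N_def by blast
qed

lemma liminf_seq_eqI: "(\<And>n a. a \<in> A n \<Longrightarrow> m \<le> a) \<Longrightarrow> \<exists>\<^sub>\<infinity>n. m \<in> A n \<Longrightarrow> liminf_seq A = m"
proof -
  assume lb: "\<And>n a. a \<in> A n \<Longrightarrow> m \<le> a" and hit: "\<exists>\<^sub>\<infinity>n. m \<in> A n"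
  have h: "\<exists>\<^sub>\<infinity>n. \<exists>a\<in>A n. a \<le> m" by (rule INFM_mono[OF hit]) auto
  have "m \<le> k" if "\<exists>\<^sub>\<infinity>n. \<exists>a\<in>A n. a \<le> k" for k
    using INFM_EX[OF that] lb by fastforce
  then have "(LEAST k. \<exists>\<^sub>\<infinity>n. \<exists>a\<in>A n. a \<le> k) = m" using h by (intro Least_equality)
  moreover have "\<exists>k. \<exists>\<^sub>\<infinity>n. \<exists>a\<in>A n. a \<le> k" using h by blast
  ultimately show "liminf_seq A = m" unfolding liminf_seq_def by (simp only: if_True)
qed

lemma liminf_seq_0I: "(\<And>m. \<exists>n0. \<forall>n\<ge>n0. \<forall>a\<in>A n. m \<le> a) \<Longrightarrow> liminf_seq A = 0"
proof -
  assume *: "\<And>m. \<exists>n0. \<forall>n\<ge>n0. \<forall>a\<in>A n. m \<le> a"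
  have "\<not> (\<exists>\<^sub>\<infinity>n. \<exists>a\<in>A n. a \<le> m)" for m
    using *[of "Suc m"] unfolding INFM_nat_le by (meson Suc_n_not_le_n le_trans)
  then show ?thesis unfolding liminf_seq_def by (simp only: if_False simp_thms)
qed

text \<open>The invariant may change with the round. A register is known at the limit either from a
  lower bound that is valid throughout and attained at infinitely many round starts, or, when the
  lower bounds of the rounds grow without end, from the reset to 0.\<close>

lemma loop_path_lim:
  assumes "T 0 X" "\<forall>n Y. T n Y \<longrightarrow> (\<exists>Z. T (Suc n) Z \<and> loop_path P w p N F Y Z (I n))"
  shows "\<exists>f Y. (\<forall>n. T n (f n)) \<and> (\<forall>n. I n (f n)) \<and> loop_path P w p N F X Y (\<lambda>S. \<exists>n. I n S) \<and> Y F = 0 \<and>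
    (\<forall>r m. (\<forall>n S. I n S \<longrightarrow> m \<le> S r) \<longrightarrow> (\<exists>\<^sub>\<infinity>n. f n r = m) \<longrightarrow> Y r = m) \<and>
    (\<forall>r. (\<forall>m. \<exists>n0. \<forall>n\<ge>n0. \<forall>S. I n S \<longrightarrow> m \<le> S r) \<longrightarrow> Y r = 0)"
proof -
  have "\<exists>f. f 0 = X \<and> (\<forall>n. T n (f n) \<and> loop_path P w p N F (f n) (f (Suc n)) (I n))"
  proof -
    obtain f where f: "\<And>n. T n (f n) \<and> (n = 0 \<longrightarrow> f n = X)"
        "\<And>n. loop_path P w p N F (f n) (f (Suc n)) (I n)"
      using dependent_nat_choice[of "\<lambda>n Y. T n Y \<and> (n = 0 \<longrightarrow> Y = X)" "\<lambda>n Y Z. loop_path P w p N F Y Z (I n)"]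
        assms(1) assms(2)[rule_format] by auto
    then show ?thesis by blast
  qed
  then obtain f where f0: "f 0 = X" and T: "\<And>n. T n (f n)" and L: "\<And>n. loop_path P w p N F (f n) (f (Suc n)) (I n)"
    by blast
  have "\<forall>n. \<exists>V. config_path P w (p, f n) V (p, f (Suc n)) \<and> V \<noteq> {} \<and>
     (\<forall>l S. (l, S) \<in> V \<longrightarrow> p \<le> l \<and> l < p + N \<and> I n S) \<and> (\<exists>l S. (l, S) \<in> V \<and> S F = 0)"
    using L unfolding loop_path_def by blast
  then obtain V where V: "\<And>n. config_path P w (p, f n) (V n) (p, f (Suc n))" "\<And>n. V n \<noteq> {}"
    "\<And>n l S. (l, S) \<in> V n \<Longrightarrow> p \<le> l \<and> l < p + N \<and> I n S" "\<And>n. \<exists>l S. (l, S) \<in> V n \<and> S F = 0"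
    by metis
  have st: "(p, f n) \<in> V n" for n using config_path_start[OF V(1) V(2)] .
  define Y where "Y k = liminf_seq (\<lambda>n. (\<lambda>c. snd c k) ` V n)" for k
  have "liminf_seq (\<lambda>n. fst ` V n) = p"
  proof (rule liminf_seq_eqI)
    show "p \<le> a" if "a \<in> fst ` V n" for n a using that V(3) by force
    show "\<exists>\<^sub>\<infinity>n. p \<in> fst ` V n" 
    proof -
      have "p \<in> fst ` V n" for n using st[of n] by force
      then show ?thesis unfolding INFM_nat_le by blast
    qed
  qed
  then have path: "config_path P w (p, X) (\<Union>n. V n) (p, Y)"
    using config_path.lim[of P w "\<lambda>n. (p, f n)" V] V(1,2) f0 unfolding Y_def by simp
  have A2: "loop_path P w p N F X Y (\<lambda>S. \<exists>n. I n S)"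
    unfolding loop_path_def
  proof (intro exI[of _ "\<Union>n. V n"] conjI allI impI)
    show "\<Union> (range V) \<noteq> {}" using V(2)[of 0] by blast
    show "\<exists>l S. (l, S) \<in> \<Union> (range V) \<and> S F = 0" using V(4)[of 0] by blast
  qed (use path V(3) in auto)
  have A3: "Y F = 0" unfolding Y_def
  proof (rule liminf_seq_eqI)
    show "\<exists>\<^sub>\<infinity>n. 0 \<in> (\<lambda>c. snd c F) ` V n"
    proof -
      have "0 \<in> (\<lambda>c. snd c F) ` V n" for n using V(4)[of n] by force
      then show ?thesis unfolding INFM_nat_le by blast
    qed
  qed simp
  have A4: "Y r = m" if "\<And>n S. I n S \<Longrightarrow> m \<le> S r" "\<exists>\<^sub>\<infinity>n. f n r = m" for r m
    unfolding Y_def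
  proof (rule liminf_seq_eqI)
    show "m \<le> a" if a: "a \<in> (\<lambda>c. snd c r) ` V n" for n a
    proof -
      obtain l S where "(l, S) \<in> V n" "a = S r" using a by auto
      then show ?thesis using V(3) \<open>\<And>n S. I n S \<Longrightarrow> m \<le> S r\<close> by blast
    qed
    have "m \<in> (\<lambda>c. snd c r) ` V n" if "f n r = m" for n using st[of n] that by force
    then show "\<exists>\<^sub>\<infinity>n. m \<in> (\<lambda>c. snd c r) ` V n"
      by (rule INFM_mono[OF \<open>\<exists>\<^sub>\<infinity>n. f n r = m\<close>])
  qed
  have A5: "Y r = 0" if n0: "\<And>m. \<exists>n0. \<forall>n\<ge>n0. \<forall>S. I n S \<longrightarrow> m \<le> S r" for r
    unfolding Y_def
  proof (rule liminf_seq_0I)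
    fix m obtain n0 where "\<forall>n\<ge>n0. \<forall>S. I n S \<longrightarrow> m \<le> S r" using n0 by blast
    then have "m \<le> S r" if "n0 \<le> n" "(l, S) \<in> V n" for n l S using V(3) that by blast
    then show "\<exists>n0. \<forall>n\<ge>n0. \<forall>a\<in>(\<lambda>c. snd c r) ` V n. m \<le> a" by (intro exI[of _ n0]) auto
  qed
  have A1: "I n (f n)" for n using V(3)[OF st] by simp
  show ?thesis
    apply (intro exI[of _ f] exI[of _ Y] conjI allI impI)
         apply (rule T)
        apply (rule A1)
       apply (rule A2)
      apply (rule A3)
     apply (rule A4, blast, assumption)
    apply (rule A5, blast)
    done
qed

section \<open>Relations decided by fragments\<close>

definition agree :: "nat \<Rightarrow> regs \<Rightarrow> regs \<Rightarrow> bool" where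
  "agree k X S \<longleftrightarrow> (\<forall>j<k. S j = X j)"

lemma agree_refl [simp]: "agree k X X" by (simp add: agree_def)

lemma agree_upd [simp]: "k \<le> n \<Longrightarrow> agree k X (S(n := v)) = agree k X S"
  by (auto simp: agree_def)

lemma agree_trans: "agree k X Y \<Longrightarrow> agree k Y Z \<Longrightarrow> agree k X Z" by (auto simp: agree_def)

lemma agree_map: "agree k X S \<Longrightarrow> \<forall>i\<in>set rs. i < k \<Longrightarrow> map S rs = map X rs" by (auto simp: agree_def)

text \<open>The fragment is chosen before oracle and register contents. \<open>agree k X\<close>
  holds at all times, so a test performed inside a loop does not disturb the liminf of the registers
  below \<open>k\<close>; from \<open>k\<close> on there is scratch space.\<close>

definition frag_decidable :: "nat \<Rightarrow> (nat set \<Rightarrow> nat list \<Rightarrow> bool) \<Rightarrow> bool" where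
  "frag_decidable n \<phi> \<longleftrightarrow> (\<forall>rs k. length rs = n \<longrightarrow> (\<forall>i\<in>set rs. i < k) \<longrightarrow>
     (\<exists>C. \<forall>w X. executes w C X (\<lambda>Y. Y k = (if \<phi> w (map X rs) then 1 else 0)) (agree k X)))"

lemma frag_decidable_E:
  assumes "frag_decidable n \<phi>" "length rs = n" "\<forall>i\<in>set rs. i < k"
  obtains C where "\<And>w X. executes w C X (\<lambda>Y. Y k = (if \<phi> w (map X rs) then 1 else 0)) (agree k X)"
proof -
  have "\<exists>C. \<forall>w X. executes w C X (\<lambda>Y. Y k = (if \<phi> w (map X rs) then 1 else 0)) (agree k X)"
    by (rule assms(1)[unfolded frag_decidable_def, THEN spec, THEN spec, THEN mp, THEN mp, OF assms(2,3)])
  then show ?thesis by (elim exE) (rule that, elim allE)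
qed

lemma frag_decidable_cong:
  assumes "frag_decidable n \<phi>" "\<And>w xs. length xs = n \<Longrightarrow> \<phi> w xs = \<psi> w xs"
  shows "frag_decidable n \<psi>"
  unfolding frag_decidable_def
proof (intro allI impI)
  fix rs :: "nat list" and k :: nat assume rs: "length rs = n" "\<forall>i\<in>set rs. i < k"
  obtain C where C: "\<And>w X. executes w C X (\<lambda>Y. Y k = (if \<phi> w (map X rs) then 1 else 0)) (agree k X)"
    using frag_decidable_E[OF assms(1) rs] by blast
  have exe1: "executes w C X (\<lambda>Y. Y k = (if \<psi> w (map X rs) then 1 else 0)) (agree k X)" for w X
    using C[of w X] assms(2)[of "map X rs" w] rs by simp
  show "\<exists>C. \<forall>w X. executes w C X (\<lambda>Y. Y k = (if \<psi> w (map X rs) then 1 else 0)) (agree k X)"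
    by (intro exI allI) (rule exe1)
qed

lemma frag_decidable_not: assumes "frag_decidable n \<phi>" shows "frag_decidable n (\<lambda>w xs. \<not> \<phi> w xs)"
  unfolding frag_decidable_def
proof (intro allI impI)
  fix rs :: "nat list" and k :: nat assume rs: "length rs = n" "\<forall>i\<in>set rs. i < k"
  obtain C where C: "\<And>w X. executes w C X (\<lambda>Y. Y k = (if \<phi> w (map X rs) then 1 else 0)) (agree k X)"
    using frag_decidable_E[OF assms rs] by blast
  have exe1: "executes w (C ;; frag_of (Zero (Suc k)) ;; if_equal k (Suc k) (frag_of (Inc k)) (frag_of (Zero k))) X
      (\<lambda>Y. Y k = (if \<not> \<phi> w (map X rs) then 1 else 0)) (agree k X)" for w X
    by (intro executes_seq executes_conseq[OF C] executes_Zero executes_Inc executes_if) (auto split: if_splits)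
  show "\<exists>C. \<forall>w X. executes w C X (\<lambda>Y. Y k = (if \<not> \<phi> w (map X rs) then 1 else 0)) (agree k X)" by (intro exI allI) (rule exe1)
qed

lemma frag_decidable_and: assumes "frag_decidable n \<phi>" "frag_decidable n \<psi>" shows "frag_decidable n (\<lambda>w xs. \<phi> w xs \<and> \<psi> w xs)"
  unfolding frag_decidable_def
proof (intro allI impI)
  fix rs :: "nat list" and k :: nat assume rs: "length rs = n" "\<forall>i\<in>set rs. i < k"
  obtain C where C: "\<And>w X. executes w C X (\<lambda>Y. Y k = (if \<phi> w (map X rs) then 1 else 0)) (agree k X)"
    using frag_decidable_E[OF assms(1) rs] by blast
  obtain C' where C': "\<And>w X. executes w C' X (\<lambda>Y. Y k = (if \<psi> w (map X rs) then 1 else 0)) (agree k X)"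
    using frag_decidable_E[OF assms(2) rs] by blast
  have exe1: "executes w (C ;; frag_of (Zero (Suc k)) ;; if_equal k (Suc k) (frag_of (Zero k)) C') X
      (\<lambda>Y. Y k = (if \<phi> w (map X rs) \<and> \<psi> w (map X rs) then 1 else 0)) (agree k X)" for w X
  proof (intro executes_seq executes_conseq[OF C] executes_Zero executes_if)
    fix Y assume Y: "Y k = (if \<phi> w (map X rs) then 1 else 0)" "agree k X Y"
      and ne: "(Y(Suc k := 0)) k \<noteq> (Y(Suc k := 0)) (Suc k)"
    have a: "agree k X (Y(Suc k := 0))" using Y by simp
    show "executes w C' (Y(Suc k := 0)) (\<lambda>Y. Y k = (if \<phi> w (map X rs) \<and> \<psi> w (map X rs) then 1 else 0)) (agree k X)"
      by (rule executes_conseq[OF C']) (use agree_map[OF a rs(2)] agree_trans[OF a] Y ne in \<open>auto split: if_splits\<close>)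
  qed (auto split: if_splits)
  show "\<exists>C. \<forall>w X. executes w C X (\<lambda>Y. Y k = (if \<phi> w (map X rs) \<and> \<psi> w (map X rs) then 1 else 0)) (agree k X)" by (intro exI allI) (rule exe1)
qed

text \<open>The positions \<open>js\<close> permute, repeat or drop arguments. Together with
  \<open>frag_decidable_ex\<close> this replaces named variables when formulas are
  assembled.\<close>

lemma frag_decidable_subst:
  assumes "frag_decidable n \<phi>" "length js = n" "\<forall>j\<in>set js. j < m"
  shows "frag_decidable m (\<lambda>w xs. \<phi> w (map ((!) xs) js))"
  unfolding frag_decidable_def
proof (intro allI impI)
  fix rs :: "nat list" and k :: nat assume rs: "length rs = m" "\<forall>i\<in>set rs. i < k"
  define ks where "ks = map ((!) rs) js"
  have ks: "length ks = n" "\<forall>i\<in>set ks. i < k" using assms rs by (auto simp: ks_def)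
  have eq: "map X ks = map ((!) (map X rs)) js" for X :: regs using assms rs by (auto simp: ks_def)
  obtain C where C: "\<And>w X. executes w C X (\<lambda>Y. Y k = (if \<phi> w (map X ks) then 1 else 0)) (agree k X)"
    using frag_decidable_E[OF assms(1) ks] by blast
  show "\<exists>C. \<forall>w X. executes w C X (\<lambda>Y. Y k = (if \<phi> w (map ((!) (map X rs)) js) then 1 else 0)) (agree k X)"
    by (intro exI allI) (rule C[unfolded eq])
qed

lemma frag_decidable_eq: "frag_decidable 2 (\<lambda>w xs. xs ! 0 = xs ! 1)"
  unfolding frag_decidable_def
proof (intro allI impI)
  fix rs :: "nat list" and k :: nat assume rs: "length rs = 2" "\<forall>i\<in>set rs. i < k"
  then have "rs ! 0 < k" "rs ! 1 < k" by (auto simp: all_set_conv_all_nth)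
  then have l: "rs ! 0 \<noteq> k" "rs ! 1 \<noteq> k" "rs ! 0 \<noteq> Suc k" "rs ! 1 \<noteq> Suc k" by auto
  have exe1: "executes w (frag_of (Zero k) ;; if_equal (rs ! 0) (rs ! 1) (frag_of (Inc k)) (frag_of (Zero k))) X
      (\<lambda>Y. Y k = (if map X rs ! 0 = map X rs ! 1 then 1 else 0)) (agree k X)" for w X
    by (intro executes_seq executes_Zero executes_Inc executes_if) (use l rs(1) in auto)
  show "\<exists>C. \<forall>w X. executes w C X (\<lambda>Y. Y k = (if map X rs ! 0 = map X rs ! 1 then 1 else 0)) (agree k X)" by (intro exI allI) (rule exe1)
qed

lemma frag_decidable_Suc: "frag_decidable 2 (\<lambda>w xs. xs ! 1 = Suc (xs ! 0))"
  unfolding frag_decidable_def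
proof (intro allI impI)
  fix rs :: "nat list" and k :: nat assume rs: "length rs = 2" "\<forall>i\<in>set rs. i < k"
  then have "rs ! 0 < k" "rs ! 1 < k" by (auto simp: all_set_conv_all_nth)
  then have l: "rs ! 0 \<noteq> k" "rs ! 1 \<noteq> k" "rs ! 0 \<noteq> Suc k" "rs ! 1 \<noteq> Suc k" by auto
  have exe1: "executes w (frag_of (Copy (rs ! 0) (Suc k)) ;; frag_of (Inc (Suc k)) ;; frag_of (Zero k) ;;
       if_equal (rs ! 1) (Suc k) (frag_of (Inc k)) (frag_of (Zero k))) X
      (\<lambda>Y. Y k = (if map X rs ! 1 = Suc (map X rs ! 0) then 1 else 0)) (agree k X)" for w X
    by (intro executes_seq executes_Zero executes_Inc executes_Copy executes_if) (use l rs(1) in auto)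
  show "\<exists>C. \<forall>w X. executes w C X (\<lambda>Y. Y k = (if map X rs ! 1 = Suc (map X rs ! 0) then 1 else 0)) (agree k X)" by (intro exI allI) (rule exe1)
qed

lemma frag_decidable_zero: "frag_decidable 1 (\<lambda>w xs. xs ! 0 = 0)"
  unfolding frag_decidable_def
proof (intro allI impI)
  fix rs :: "nat list" and k :: nat assume rs: "length rs = 1" "\<forall>i\<in>set rs. i < k"
  then have l: "rs ! 0 \<noteq> k" by (auto simp: all_set_conv_all_nth)
  have exe1: "executes w (frag_of (Zero k) ;; if_equal (rs ! 0) k (frag_of (Inc k)) (frag_of (Zero k))) X
      (\<lambda>Y. Y k = (if map X rs ! 0 = 0 then 1 else 0)) (agree k X)" for w X
    by (intro executes_seq executes_Zero executes_Inc executes_if) (use l rs(1) in auto)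
  show "\<exists>C. \<forall>w X. executes w C X (\<lambda>Y. Y k = (if map X rs ! 0 = 0 then 1 else 0)) (agree k X)" by (intro exI allI) (rule exe1)
qed

lemma frag_decidable_oracle: "frag_decidable 1 (\<lambda>w xs. xs ! 0 \<in> w)"
  unfolding frag_decidable_def
proof (intro allI impI)
  fix rs :: "nat list" and k :: nat assume rs: "length rs = 1" "\<forall>i\<in>set rs. i < k"
  then have l: "rs ! 0 \<noteq> k" by (auto simp: all_set_conv_all_nth)
  have exe1: "executes w (frag_of (Zero k) ;; if_oracle (rs ! 0) (frag_of (Inc k)) (frag_of (Zero k))) X
      (\<lambda>Y. Y k = (if map X rs ! 0 \<in> w then 1 else 0)) (agree k X)" for w X
    by (intro executes_seq executes_Zero executes_Inc executes_if_oracle) (use l rs(1) in auto)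
  show "\<exists>C. \<forall>w X. executes w C X (\<lambda>Y. Y k = (if map X rs ! 0 \<in> w then 1 else 0)) (agree k X)" by (intro exI allI) (rule exe1)
qed

text \<open>An unbounded search that also reports failure: if no candidate passes, the loop runs
  through \<omega> rounds and the next round sees the limit flag at 0. This is what makes number
  quantifiers decidable. Register \<open>k\<close> holds the candidate, \<open>k+1\<close> the
  verdict, \<open>k+2\<close> keeps the loop running, \<open>k+3\<close> is the limit flag,
  \<open>k+4\<close> a constant 0, and \<open>k+5\<close> receives the outcome of the test.\<close>

lemma executes_search:
  assumes frag_decidable: "frag_decidable (Suc n) \<phi>" and rs: "length rs = n" "\<forall>i\<in>set rs. i < k"
  obtains C where "\<And>w X. executes w C X
    (\<lambda>Y. if \<exists>a. \<phi> w (map X rs @ [a]) then Y (Suc k) = 1 \<and> Y k = (LEAST a. \<phi> w (map X rs @ [a])) else Y (Suc k) = 0)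
    (agree k X)"
proof -
  have rk: "length (rs @ [k]) = Suc n" "\<forall>i\<in>set (rs @ [k]). i < k + 5" using rs by auto
  obtain C where C: "\<And>w X. executes w C X (\<lambda>Y. Y (k + 5) = (if \<phi> w (map X (rs @ [k])) then 1 else 0)) (agree (k + 5) X)"
    using frag_decidable_E[OF frag_decidable rk] by blast
  define A where "A = if_equal (k+3) (k+4) (frag_of (Zero (k+2)))
    (frag_of (Zero (k+3)) ;; C ;; frag_of (Zero (k+6)) ;; if_equal (k+5) (k+6) (frag_of (Inc k)) (frag_of (Inc (k+1)) ;; frag_of (Zero (k+2))))"
  define B where "B = A ;; frag_of (Inc (k+3))"
  define W where "W = frag_of (Zero k) ;; frag_of (Zero (k+1)) ;; frag_of (Zero (k+2)) ;; frag_of (Inc (k+2)) ;;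
    frag_of (Zero (k+3)) ;; frag_of (Inc (k+3)) ;; frag_of (Zero (k+4)) ;; loop_until (k+2) (k+4) B"
  have main: "executes w W X0 (\<lambda>Y. if \<exists>a. \<phi> w (map X0 rs @ [a]) then Y (Suc k) = 1 \<and> Y k = (LEAST a. \<phi> w (map X0 rs @ [a])) else Y (Suc k) = 0) (agree k X0)" for w X0
  proof -
    define ph where "ph a = \<phi> w (map X0 rs @ [a])" for a
    \<comment> \<open>\<open>T a\<close> is the state at the head of the round for candidate
      \<open>a\<close>; \<open>J\<close> retains what holds throughout a round and therefore
      survives the limit.\<close>
    define T where "T a Y \<longleftrightarrow> agree k X0 Y \<and> Y k = a \<and> Y (k+1) = 0 \<and> Y (k+2) = 1 \<and> Y (k+3) = 1 \<and> Y (k+4) = 0" for a Y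
    define J where "J a S \<longleftrightarrow> agree k X0 S \<and> S (k+1) = 0 \<and> S (k+2) = 1 \<and> S (k+4) = 0" for a :: nat and S :: regs
    define Q where "Q Y \<longleftrightarrow> (if \<exists>a. ph a then Y (Suc k) = 1 \<and> Y k = (LEAST a. ph a) else Y (Suc k) = 0)" for Y :: regs
    have Cex: "executes w C Z Q0 I0"
      if "\<And>S. agree (k+5) Z S \<Longrightarrow> I0 S"
        "\<And>Y. Y (k+5) = (if \<phi> w (map Z rs @ [Z k]) then 1 else 0) \<Longrightarrow> (\<And>j. j < k \<Longrightarrow> Y j = Z j) \<Longrightarrow> Y k = Z k \<Longrightarrow>
         Y (Suc k) = Z (Suc k) \<Longrightarrow> Y (k+2) = Z (k+2) \<Longrightarrow> Y (k+3) = Z (k+3) \<Longrightarrow> Y (k+4) = Z (k+4) \<Longrightarrow> Q0 Y" for Z Q0 I0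
      by (rule executes_conseq[OF C]) (use that in \<open>auto simp: agree_def\<close>)
    have m: "map Y rs = map X0 rs" if "agree k X0 Y" for Y using agree_map[OF that rs(2)] .
    have cont: "executes w A Y (\<lambda>Z. Z (k+3) = 0 \<and> T (Suc a) (Z(k+3 := 1)) \<and> J a (Z(k+3 := 1))) (J a)"
      if Y: "T a Y" "\<not> ph a" for a Y
      unfolding A_def
      by (intro executes_if executes_seq executes_Zero Cex executes_Inc) (use Y m[of "Y(k+3 := 0)"] in \<open>auto simp: T_def J_def ph_def agree_def simp del: map_eq_conv\<close>)
    have fin: "executes w A Y (\<lambda>Z. Z (k+3) = 0 \<and> (\<lambda>Z. agree k X0 Z \<and> Z (k+2) = 0 \<and> Z (k+4) = 0 \<and> Z (k+1) = 1 \<and> Z k = a) (Z(k+3 := 1)) \<and> agree k X0 (Z(k+3 := 1))) (agree k X0)"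
      if Y: "T a Y" "ph a" for a Y
      unfolding A_def
      by (intro executes_if executes_seq executes_Zero Cex executes_Inc) (use Y m[of "Y(k+3 := 0)"] in \<open>auto simp: T_def J_def ph_def agree_def simp del: map_eq_conv\<close>)
    \<comment> \<open>The round after the limit. Nothing is assumed of the candidate register, which
      has diverged.\<close>
    have over: "executes w A Y (\<lambda>Z. Z (k+3) = 0 \<and> (\<lambda>Z. agree k X0 Z \<and> Z (k+2) = 0 \<and> Z (k+4) = 0 \<and> Z (k+1) = 0) (Z(k+3 := 1)) \<and> agree k X0 (Z(k+3 := 1))) (agree k X0)"
      if Y: "J a Y" "Y (k+3) = 0" for a Y
      unfolding A_def
      by (intro executes_if executes_Zero) (use Y in \<open>auto simp: J_def\<close>)
    have loop_path: "executes w (loop_until (k+2) (k+4) B) X Q (agree k X0)" if X: "T 0 X" for X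
    proof (rule executes_loop_until[where F="k+3"])
      fix P p assume at: "code_at P p (loop_until (k+2) (k+4) B p)"
      let ?L = "loop_path P w p (length (loop_until (k+2) (k+4) B p)) (k+3)"
      note at' = at[unfolded B_def]
      have Jag: "J a S \<Longrightarrow> agree k X0 S" for a S by (simp add: J_def)
      have step: "\<exists>Z. T (Suc a) Z \<and> ?L Y Z (J a)" if "T a Y" "\<not> ph a" for a Y
      proof -
        have "Y (k+2) \<noteq> Y (k+4)" "J a Y" using that by (auto simp: T_def J_def)
        from loop_path_step[OF at' this cont[OF that]] show ?thesis unfolding B_def .
      qed
      show "\<exists>Y. (Y = X \<or> ?L X Y (agree k X0)) \<and> Y (k+2) = Y (k+4) \<and> Q Y \<and> agree k X0 Y"
      proof (cases "\<exists>a. ph a")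
        case True
        define a where "a = (LEAST a. ph a)"
        have a: "ph a" "\<And>b. b < a \<Longrightarrow> \<not> ph b" unfolding a_def using True by (auto intro: LeastI dest: not_less_Least)
        have "b \<le> a \<Longrightarrow> \<exists>Y. T b Y \<and> (Y = X \<or> ?L X Y (agree k X0))" for b
        proof (induction b)
          case (Suc b)
          then obtain Y where Y: "T b Y" "Y = X \<or> ?L X Y (agree k X0)" by auto
          obtain Z where Z: "T (Suc b) Z" "?L Y Z (J b)" using step[OF Y(1)] a(2) Suc by auto
          have "?L Y Z (agree k X0)" using loop_path_mono[OF Z(2)] Jag by blast
          then show ?case using Y(2) Z(1) loop_path_trans by blast
        qed (use X in auto)
        then obtain Y where Y: "T a Y" "Y = X \<or> ?L X Y (agree k X0)" by blast
        have "Y (k+2) \<noteq> Y (k+4)" "agree k X0 Y" using Y(1) by (auto simp: T_def)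
        from loop_path_step[OF at' this fin[OF Y(1) a(1)]]
        obtain Z where Z: "agree k X0 Z" "Z (k+2) = 0" "Z (k+4) = 0" "Z (k+1) = 1" "Z k = a" "?L Y Z (agree k X0)"
          unfolding B_def by blast
        have "?L X Z (agree k X0)" using Y(2) Z(6) loop_path_trans by blast
        moreover have "Q Z" using Z True unfolding Q_def a_def[symmetric] by simp
        ultimately show ?thesis using Z by auto
      next
        case False
        have st: "\<forall>n Y. T n Y \<longrightarrow> (\<exists>Z. T (Suc n) Z \<and> ?L Y Z (J n))" using step False by blast
        from loop_path_lim[OF X st]
        obtain f Y where f: "\<forall>n. T n (f n)" and L: "?L X Y (\<lambda>S. \<exists>n. J n S)" and F: "Y (k+3) = 0"
          and c: "\<forall>r m. (\<forall>n S. J n S \<longrightarrow> m \<le> S r) \<longrightarrow> (\<exists>\<^sub>\<infinity>n. f n r = m) \<longrightarrow> Y r = m"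
          by (elim exE conjE) (rule that)
        have c': "Y r = m" if "\<And>S n. J n S \<Longrightarrow> S r = m" for r m
        proof (rule c[rule_format])
          have "J n (f n)" for n using f by (simp add: T_def J_def)
          then show "\<exists>\<^sub>\<infinity>n. f n r = m" using that by (auto simp: INFM_nat_le)
        qed (use that in auto)
        have JY: "J 0 Y" unfolding J_def agree_def
          by (intro conjI allI impI c') (auto simp: J_def agree_def)
        have "Y (k+2) \<noteq> Y (k+4)" "agree k X0 Y" using JY by (auto simp: J_def)
        from loop_path_step[OF at' this over[OF JY F]]
        obtain Z where Z: "agree k X0 Z" "Z (k+2) = 0" "Z (k+4) = 0" "Z (k+1) = 0" "?L Y Z (agree k X0)"
          unfolding B_def by blast
        have "?L X Y (agree k X0)" using loop_path_mono[OF L] Jag by blast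
        then have "?L X Z (agree k X0)" using Z(5) loop_path_trans by blast
        moreover have "Q Z" using Z False unfolding Q_def by simp
        ultimately show ?thesis using Z by auto
      qed
    qed
    have "executes w W X0 Q (agree k X0)"
      unfolding W_def
      by (intro executes_seq executes_Zero executes_Inc loop_path) (auto simp: T_def)
    then show ?thesis unfolding Q_def ph_def .
  qed
  show ?thesis by (rule that) (rule main)
qed

lemma frag_decidable_ex: assumes "frag_decidable (Suc n) \<phi>" shows "frag_decidable n (\<lambda>w xs. \<exists>a. \<phi> w (xs @ [a]))"
  unfolding frag_decidable_def
proof (intro allI impI)
  fix rs :: "nat list" and k :: nat assume rs: "length rs = n" "\<forall>i\<in>set rs. i < k"
  obtain C where C: "\<And>w X. executes w C X
    (\<lambda>Y. if \<exists>a. \<phi> w (map X rs @ [a]) then Y (Suc k) = 1 \<and> Y k = (LEAST a. \<phi> w (map X rs @ [a])) else Y (Suc k) = 0)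
    (agree k X)" using executes_search[OF assms rs] by blast
  have exe1: "executes w (C ;; frag_of (Copy (Suc k) k)) X (\<lambda>Y. Y k = (if \<exists>a. \<phi> w (map X rs @ [a]) then 1 else 0)) (agree k X)" for w X
    by (intro executes_seq executes_conseq[OF C] executes_Copy) (auto split: if_splits)
  show "\<exists>C. \<forall>w X. executes w C X (\<lambda>Y. Y k = (if \<exists>a. \<phi> w (map X rs @ [a]) then 1 else 0)) (agree k X)" by (intro exI allI) (rule exe1)
qed

text \<open>A value is computed by searching for it in the decidable graph; the least solution is
  the only one. Leaving \<open>Q\<close> and \<open>I\<close> arbitrary makes the fact usable as a
  rule in longer fragments.\<close>

lemma executes_fun:
  assumes frag_decidable: "frag_decidable (Suc n) \<phi>" and rs: "length rs = n" "\<forall>i\<in>set rs. i < k"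
    and f: "\<forall>w xs y. length xs = n \<longrightarrow> \<phi> w (xs @ [y]) \<longleftrightarrow> y = f xs"
  shows "\<exists>C. \<forall>w X Q I. (\<forall>S. agree k X S \<longrightarrow> I S) \<longrightarrow>
    (\<forall>Y. agree k X Y \<longrightarrow> Y k = f (map X rs) \<longrightarrow> Q Y) \<longrightarrow> executes w C X Q I"
proof -
  obtain C where C: "\<And>w X. executes w C X
    (\<lambda>Y. if \<exists>a. \<phi> w (map X rs @ [a]) then Y (Suc k) = 1 \<and> Y k = (LEAST a. \<phi> w (map X rs @ [a])) else Y (Suc k) = 0)
    (agree k X)" using executes_search[OF frag_decidable rs] by blast
  have main: "executes w C X Q I" if "\<And>S. agree k X S \<Longrightarrow> I S"
    "\<And>Y. agree k X Y \<Longrightarrow> Y k = f (map X rs) \<Longrightarrow> Q Y" for w X Q I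
    by (rule executes_conseq[OF C]) (use that f[rule_format, of "map X rs"] rs(1) in \<open>auto simp: Least_equality\<close>)
  show ?thesis by (intro exI allI impI) (rule main; simp)
qed

lemma executes_decidable:
  assumes frag_decidable: "frag_decidable n \<phi>" and rs: "length rs = n" "\<forall>i\<in>set rs. i < k"
  shows "\<exists>C. \<forall>w X Q I. (\<forall>S. agree k X S \<longrightarrow> I S) \<longrightarrow>
    (\<forall>Y. agree k X Y \<longrightarrow> Y k = (if \<phi> w (map X rs) then 1 else 0) \<longrightarrow> Q Y) \<longrightarrow> executes w C X Q I"
proof -
  obtain C where C: "\<And>w X. executes w C X (\<lambda>Y. Y k = (if \<phi> w (map X rs) then 1 else 0)) (agree k X)"
    using frag_decidable_E[OF frag_decidable rs] by blast
  have main: "executes w C X Q I" if "\<And>S. agree k X S \<Longrightarrow> I S"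
    "\<And>Y. agree k X Y \<Longrightarrow> Y k = (if \<phi> w (map X rs) then 1 else 0) \<Longrightarrow> Q Y" for w X Q I
    by (rule executes_conseq[OF C]) (use that in auto)
  show ?thesis by (intro exI allI impI) (rule main; simp)
qed

text \<open>A counter loop avoids coding the sequence of iterates; it stops after finitely many
  rounds, so no limit occurs. The fixed parameter \<open>xs ! 0\<close> is there so that addition
  can be iterated to multiplication.\<close>

lemma frag_decidable_iter:
  assumes "frag_decidable 3 (\<lambda>w xs. xs ! 2 = f (xs ! 0) (xs ! 1))"
  shows "frag_decidable 4 (\<lambda>w xs. (f (xs ! 0) ^^ (xs ! 1)) (xs ! 2) = xs ! 3)"
  unfolding frag_decidable_def
proof (intro allI impI)
  fix rs :: "nat list" and k :: nat assume "length rs = 4" "\<forall>i\<in>set rs. i < k"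
  then obtain a n x y where rs: "rs = [a, n, x, y]" and lt: "a < k" "n < k" "x < k" "y < k"
    by (auto simp: numeral_eq_Suc length_Suc_conv)
  have frag_decidable: "frag_decidable (Suc 2) (\<lambda>w xs. xs ! 2 = f (xs ! 0) (xs ! 1))" using assms by simp
  have ks: "length [a, k+2] = 2" "\<forall>i\<in>set [a, k+2]. i < k + 4" using lt by auto
  have h: "\<forall>w::nat set. \<forall>xs z. length xs = 2 \<longrightarrow> (xs @ [z]) ! 2 = f ((xs @ [z]) ! 0) ((xs @ [z]) ! 1) \<longleftrightarrow> z = f (xs ! 0) (xs ! 1)"
    by (auto simp: numeral_eq_Suc length_Suc_conv)
  obtain C where C0: "\<forall>w X Q I. (\<forall>S. agree (k+4) X S \<longrightarrow> I S) \<longrightarrow>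
    (\<forall>Y. agree (k+4) X Y \<longrightarrow> Y (k+4) = f (map X [a, k+2] ! 0) (map X [a, k+2] ! 1) \<longrightarrow> Q Y) \<longrightarrow> executes w C X Q I"
    using executes_fun[OF frag_decidable ks h] by (elim exE) (rule that)
  note C = C0[simplified, rule_format]
  define A where "A = frag_of (Zero (k+3)) ;; C ;; frag_of (Copy (k+4) (k+2)) ;; frag_of (Inc (k+1))"
  define B where "B = A ;; frag_of (Inc (k+3))"
  define W where "W = frag_of (Zero (k+1)) ;; frag_of (Copy x (k+2)) ;; loop_until (k+1) n B ;; frag_of (Zero k) ;;
    if_equal (k+2) y (frag_of (Inc k)) (frag_of (Zero k))"
  have main: "executes w W X0 (\<lambda>Y. Y k = (if (f (map X0 rs ! 0) ^^ (map X0 rs ! 1)) (map X0 rs ! 2) = map X0 rs ! 3 then 1 else 0)) (agree k X0)" for w X0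
  proof -
    define T where "T j Y \<longleftrightarrow> agree k X0 Y \<and> Y (k+1) = j \<and> Y (k+2) = (f (X0 a) ^^ j) (X0 x)" for j Y
    have stp: "executes w A Y (\<lambda>Z. Z (k+3) = 0 \<and> T (Suc j) (Z(k+3 := 1)) \<and> agree k X0 (Z(k+3 := 1))) (agree k X0)"
      if Y: "T j Y" for j Y
      unfolding A_def
      by (intro executes_seq executes_Zero C executes_Copy executes_Inc) (use Y lt in \<open>auto simp: T_def agree_def\<close>)
    have loop_path: "executes w (loop_until (k+1) n B) X (T (X0 n)) (agree k X0)" if X: "T 0 X" for X
    proof (rule executes_loop_until[where F="k+3"])
      fix P p assume at: "code_at P p (loop_until (k+1) n B p)"
      let ?L = "loop_path P w p (length (loop_until (k+1) n B p)) (k+3)"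
      have "j \<le> X0 n \<Longrightarrow> \<exists>Y. T j Y \<and> (Y = X \<or> ?L X Y (agree k X0))" for j
      proof (induction j)
        case (Suc j)
        then obtain Y where Y: "T j Y" "Y = X \<or> ?L X Y (agree k X0)" by auto
        have "Y (k+1) \<noteq> Y n" "agree k X0 Y" using Y(1) Suc(2) lt by (auto simp: T_def agree_def)
        from loop_path_step[OF at[unfolded B_def] this stp[OF Y(1)]]
        obtain Z where "T (Suc j) Z" "?L Y Z (agree k X0)" unfolding B_def by blast
        then show ?case using Y(2) loop_path_trans by blast
      qed (use X in auto)
      then obtain Y where Y: "T (X0 n) Y" "Y = X \<or> ?L X Y (agree k X0)" by blast
      then show "\<exists>Y. (Y = X \<or> ?L X Y (agree k X0)) \<and> Y (k+1) = Y n \<and> T (X0 n) Y \<and> agree k X0 Y"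
        using lt by (intro exI[of _ Y]) (auto simp: T_def agree_def)
    qed
    show ?thesis unfolding W_def
      by (intro executes_seq executes_Zero executes_Copy executes_conseq[OF loop_path] executes_if executes_Inc)
         (use lt in \<open>auto simp: T_def rs agree_def\<close>)
  qed
  show "\<exists>C. \<forall>w X. executes w C X (\<lambda>Y. Y k = (if (f (map X rs ! 0) ^^ (map X rs ! 1)) (map X rs ! 2) = map X rs ! 3 then 1 else 0)) (agree k X)"
    by (intro exI allI) (rule main)
qed

lemma length3: "length xs = 3 \<longleftrightarrow> (\<exists>a b c. xs = [a, b, c])"
  by (auto simp: numeral_eq_Suc length_Suc_conv)

lemma length2: "length xs = 2 \<longleftrightarrow> (\<exists>a b. xs = [a, b])"
  by (auto simp: numeral_eq_Suc length_Suc_conv)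

lemma length1: "length xs = Suc 0 \<longleftrightarrow> (\<exists>a. xs = [a])"
  by (auto simp: length_Suc_conv)

lemma frag_decidable_add: "frag_decidable 3 (\<lambda>w xs. xs ! 2 = xs ! 0 + xs ! 1)"
proof -
  have "frag_decidable 3 (\<lambda>w xs. xs ! 2 = Suc (xs ! 1))"
    using frag_decidable_subst[OF frag_decidable_Suc, of "[1, 2]" 3] by simp
  from frag_decidable_subst[OF frag_decidable_iter[where f="\<lambda>_. Suc", OF this], of "[0, 0, 1, 2]" 3]
  have "frag_decidable 3 (\<lambda>w xs. (Suc ^^ (xs ! 0)) (xs ! 1) = xs ! 2)" by simp
  then show ?thesis by (rule frag_decidable_cong) (auto simp: Suc_funpow)
qed

lemma frag_decidable_ex1:
  assumes "frag_decidable m \<phi>" "m = Suc n" "\<And>w xs. length xs = n \<Longrightarrow> (\<exists>a. \<phi> w (xs @ [a])) \<longleftrightarrow> \<psi> w xs"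
  shows "frag_decidable n \<psi>"
  by (rule frag_decidable_cong[OF frag_decidable_ex]) (use assms in auto)

lemma frag_decidable_ex2:
  assumes "frag_decidable m \<phi>" "m = Suc (Suc n)" "\<And>w xs. length xs = n \<Longrightarrow> (\<exists>a b. \<phi> w (xs @ [a, b])) \<longleftrightarrow> \<psi> w xs"
  shows "frag_decidable n \<psi>"
proof -
  have "frag_decidable (Suc (Suc n)) \<phi>" using assms(1,2) by simp
  from frag_decidable_ex[OF frag_decidable_ex[OF this]] show ?thesis by (rule frag_decidable_cong) (use assms(3) in auto)
qed

lemma funpow_add: "((+) a ^^ n) 0 = (a * n :: nat)"
  by (induction n) auto

lemma frag_decidable_mult: "frag_decidable 3 (\<lambda>w xs. xs ! 2 = xs ! 0 * xs ! 1)"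
proof -
  have "frag_decidable 4 (\<lambda>w xs. xs ! 3 = 0 \<and> ((+) (xs ! 0) ^^ (xs ! 1)) (xs ! 3) = xs ! 2)"
    using frag_decidable_and[OF frag_decidable_subst[OF frag_decidable_zero, of "[3]" 4] frag_decidable_subst[OF frag_decidable_iter[OF frag_decidable_add], of "[0, 1, 3, 2]" 4]] by simp
  then show ?thesis by (rule frag_decidable_ex1) (auto simp: length3 funpow_add)
qed

section \<open>Coding of pairs, and decidable predicates of a single number\<close>

definition npair :: "nat \<Rightarrow> nat \<Rightarrow> nat" where "npair a b = prod_encode (a, b)"
definition nfst :: "nat \<Rightarrow> nat" where "nfst x = fst (prod_decode x)"
definition nsnd :: "nat \<Rightarrow> nat" where "nsnd x = snd (prod_decode x)"

lemma npair_simps [simp]: "nfst (npair a b) = a" "nsnd (npair a b) = b" "npair (nfst x) (nsnd x) = x"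
  by (simp_all add: npair_def nfst_def nsnd_def)

lemma npair_inj [simp]: "npair a b = npair c d \<longleftrightarrow> a = c \<and> b = d"
  by (metis npair_simps(1,2))

lemma npair_le: "a \<le> npair a b" by (simp add: npair_def le_prod_encode_1)

lemma nfst_0 [simp]: "nfst 0 = 0" "nsnd 0 = 0"
  by (simp_all add: nfst_def nsnd_def prod_decode_def prod_decode_aux.simps)

text \<open>Doubling the triangular number removes the division from the pairing function and leaves
  sums and products, whose graphs are already decidable.\<close>

lemma npair_poly: "z = npair x y \<longleftrightarrow> z + z = (x + y) * Suc (x + y) + (x + x)"
proof -
  have "even ((x + y) * Suc (x + y))" by simp
  then have "2 * (triangle (x + y) + x) = (x + y) * Suc (x + y) + (x + x)"
    unfolding triangle_def by (simp del: mult_Suc_right)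
  then show ?thesis unfolding npair_def prod_encode_def by auto
qed

lemma frag_decidable_npair: "frag_decidable 3 (\<lambda>w xs. xs ! 2 = npair (xs ! 0) (xs ! 1))"
proof -
  have 1: "frag_decidable 8 (\<lambda>w xs. xs!3 = xs!0 + xs!1 \<and> xs!4 = Suc (xs!3) \<and> xs!5 = xs!3 * xs!4 \<and> xs!6 = xs!0 + xs!0 \<and>
      xs!7 = xs!5 + xs!6 \<and> xs!7 = xs!2 + xs!2)"
    using frag_decidable_and[OF frag_decidable_subst[OF frag_decidable_add, of "[0,1,3]" 8] frag_decidable_and[OF frag_decidable_subst[OF frag_decidable_Suc, of "[3,4]" 8]
      frag_decidable_and[OF frag_decidable_subst[OF frag_decidable_mult, of "[3,4,5]" 8] frag_decidable_and[OF frag_decidable_subst[OF frag_decidable_add, of "[0,0,6]" 8]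
      frag_decidable_and[OF frag_decidable_subst[OF frag_decidable_add, of "[5,6,7]" 8] frag_decidable_subst[OF frag_decidable_add, of "[2,2,7]" 8]]]]]]
    by simp
  have 2: "frag_decidable (Suc (Suc (Suc (Suc (Suc 3))))) (\<lambda>w xs. xs!3 = xs!0 + xs!1 \<and> xs!4 = Suc (xs!3) \<and> xs!5 = xs!3 * xs!4 \<and> xs!6 = xs!0 + xs!0 \<and>
      xs!7 = xs!5 + xs!6 \<and> xs!7 = xs!2 + xs!2)" using 1 by (simp add: eval_nat_numeral)
  show ?thesis
  proof (rule frag_decidable_cong[OF frag_decidable_ex[OF frag_decidable_ex[OF frag_decidable_ex[OF frag_decidable_ex[OF frag_decidable_ex[OF 2]]]]]], goal_cases)
    case (1 w xs)
    then obtain a b c where xs: "xs = [a, b, c]" by (auto simp: length3)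
    show ?case unfolding npair_poly xs
      by (auto simp: numeral_eq_Suc simp del: mult_Suc mult_Suc_right)
  qed
qed

definition decidable :: "(nat set \<Rightarrow> nat \<Rightarrow> bool) \<Rightarrow> bool" where
  "decidable R \<longleftrightarrow> frag_decidable 1 (\<lambda>w xs. R w (xs ! 0))"

text \<open>These functions do not see the oracle, so they can be substituted into predicates that
  are to be forced.\<close>

definition computable_fun :: "(nat \<Rightarrow> nat) \<Rightarrow> bool" where
  "computable_fun f \<longleftrightarrow> frag_decidable 2 (\<lambda>w xs. xs ! 1 = f (xs ! 0))"

lemma computable_fun_bin:
  assumes "frag_decidable 3 (\<lambda>w xs. xs ! 2 = h (xs ! 0) (xs ! 1))" "computable_fun f" "computable_fun g"
  shows "computable_fun (\<lambda>u. h (f u) (g u))"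
proof -
  have "frag_decidable 4 (\<lambda>w xs. xs ! 2 = f (xs ! 0) \<and> xs ! 3 = g (xs ! 0) \<and> xs ! 1 = h (xs ! 2) (xs ! 3))"
    using frag_decidable_and[OF frag_decidable_subst[OF assms(2)[unfolded computable_fun_def], of "[0,2]" 4]
      frag_decidable_and[OF frag_decidable_subst[OF assms(3)[unfolded computable_fun_def], of "[0,3]" 4] frag_decidable_subst[OF assms(1), of "[2,3,1]" 4]]]
    by simp
  then show ?thesis unfolding computable_fun_def by (rule frag_decidable_ex2) (auto simp: length2)
qed

lemma decidable_bin:
  assumes "frag_decidable 2 (\<lambda>w xs. R w (xs ! 0) (xs ! 1))" "computable_fun f" "computable_fun g"
  shows "decidable (\<lambda>w u. R w (f u) (g u))"
proof -
  have "frag_decidable 3 (\<lambda>w xs. xs ! 1 = f (xs ! 0) \<and> xs ! 2 = g (xs ! 0) \<and> R w (xs ! 1) (xs ! 2))"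
    using frag_decidable_and[OF frag_decidable_subst[OF assms(2)[unfolded computable_fun_def], of "[0,1]" 3]
      frag_decidable_and[OF frag_decidable_subst[OF assms(3)[unfolded computable_fun_def], of "[0,2]" 3] frag_decidable_subst[OF assms(1), of "[1,2]" 3]]]
    by simp
  then show ?thesis unfolding decidable_def by (rule frag_decidable_ex2) (auto simp: length1)
qed

lemma computable_fun_id: "computable_fun (\<lambda>u. u)"
  unfolding computable_fun_def by (rule frag_decidable_cong[OF frag_decidable_eq]) auto

lemma computable_fun_comp: assumes "computable_fun f" "computable_fun g" shows "computable_fun (\<lambda>u. f (g u))"
proof -
  have "frag_decidable 3 (\<lambda>w xs. xs ! 2 = f (xs ! 0))" using frag_decidable_subst[OF assms(1)[unfolded computable_fun_def], of "[0,2]" 3] by simp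
  from computable_fun_bin[OF this assms(2) assms(2)] show ?thesis .
qed

lemma computable_fun_Suc: assumes "computable_fun f" shows "computable_fun (\<lambda>u. Suc (f u))"
  by (rule computable_fun_comp[OF _ assms, of Suc]) (simp add: computable_fun_def, rule frag_decidable_cong[OF frag_decidable_Suc], simp)

lemma computable_fun_const: "computable_fun (\<lambda>u. c)"
proof (induction c)
  case 0
  have "frag_decidable 2 (\<lambda>w xs. xs ! 1 = 0)" using frag_decidable_subst[OF frag_decidable_zero, of "[1]" 2] by simp
  then show ?case by (simp add: computable_fun_def)
qed (rule computable_fun_Suc)

lemmas computable_fun_add = computable_fun_bin[OF frag_decidable_add] and computable_fun_mult = computable_fun_bin[OF frag_decidable_mult] and computable_fun_npair = computable_fun_bin[OF frag_decidable_npair]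

lemma computable_fun_nfst: assumes "computable_fun f" shows "computable_fun (\<lambda>u. nfst (f u))"
proof -
  have "frag_decidable 3 (\<lambda>w xs. xs ! 0 = npair (xs ! 1) (xs ! 2))" using frag_decidable_subst[OF frag_decidable_npair, of "[1,2,0]" 3] by simp
  then have "computable_fun nfst" unfolding computable_fun_def by (rule frag_decidable_ex1) (auto simp: length2, metis npair_simps(3))
  then show ?thesis using computable_fun_comp assms by blast
qed

lemma computable_fun_nsnd: assumes "computable_fun f" shows "computable_fun (\<lambda>u. nsnd (f u))"
proof -
  have "frag_decidable 3 (\<lambda>w xs. xs ! 0 = npair (xs ! 2) (xs ! 1))" using frag_decidable_subst[OF frag_decidable_npair, of "[2,1,0]" 3] by simp
  then have "computable_fun nsnd" unfolding computable_fun_def by (rule frag_decidable_ex1) (auto simp: length2, metis npair_simps(3))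
  then show ?thesis using computable_fun_comp assms by blast
qed

lemma decidable_subst: assumes "decidable R" "computable_fun f" shows "decidable (\<lambda>w u. R w (f u))"
proof -
  have "frag_decidable 2 (\<lambda>w xs. R w (xs ! 0))" using frag_decidable_subst[OF assms(1)[unfolded decidable_def], of "[0]" 2] by simp
  from decidable_bin[OF this assms(2,2)] show ?thesis .
qed

lemma decidable_cong: "decidable R \<Longrightarrow> (\<And>w u. R w u \<longleftrightarrow> R' w u) \<Longrightarrow> decidable R'"
  unfolding decidable_def by (rule frag_decidable_cong) auto

lemma decidable_eq: "computable_fun f \<Longrightarrow> computable_fun g \<Longrightarrow> decidable (\<lambda>w u. f u = g u)"
  by (rule decidable_bin[OF frag_decidable_eq])

lemma decidable_le: assumes "computable_fun f" "computable_fun g" shows "decidable (\<lambda>w u. f u \<le> g u)"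
proof -
  have "frag_decidable 3 (\<lambda>w xs. xs ! 1 = xs ! 0 + xs ! 2)" using frag_decidable_subst[OF frag_decidable_add, of "[0,2,1]" 3] by simp
  then have "frag_decidable 2 (\<lambda>w xs. xs ! 0 \<le> xs ! 1)" by (rule frag_decidable_ex1) (auto simp: length2 le_iff_add)
  from decidable_bin[OF this assms] show ?thesis .
qed

lemma decidable_oracle: "computable_fun f \<Longrightarrow> decidable (\<lambda>w u. f u \<in> w)"
  by (rule decidable_subst[of "\<lambda>w u. u \<in> w"]) (use frag_decidable_oracle in \<open>simp_all add: decidable_def\<close>)

lemma decidable_not: "decidable R \<Longrightarrow> decidable (\<lambda>w u. \<not> R w u)"
  unfolding decidable_def by (rule frag_decidable_not)

lemma decidable_and: "decidable R \<Longrightarrow> decidable R' \<Longrightarrow> decidable (\<lambda>w u. R w u \<and> R' w u)"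
  unfolding decidable_def by (rule frag_decidable_and)

lemma decidable_or: "decidable R \<Longrightarrow> decidable R' \<Longrightarrow> decidable (\<lambda>w u. R w u \<or> R' w u)"
  using decidable_not[OF decidable_and[OF decidable_not decidable_not], of R R'] by simp

lemma decidable_imp: "decidable R \<Longrightarrow> decidable R' \<Longrightarrow> decidable (\<lambda>w u. R w u \<longrightarrow> R' w u)"
  using decidable_or[OF decidable_not, of R R'] by simp

lemma decidable_iff: "decidable R \<Longrightarrow> decidable R' \<Longrightarrow> decidable (\<lambda>w u. R w u \<longleftrightarrow> R' w u)"
  using decidable_and[OF decidable_imp decidable_imp, of R R' R' R] by (simp add: iff_conv_conj_imp)

text \<open>Bound variables are paired onto the argument: in the hypothesis \<open>nfst u\<close> is
  the new variable and \<open>nsnd u\<close> the old argument, so nested quantifiers behave like de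
  Bruijn indices.\<close>

lemma decidable_ex:
  assumes "decidable (\<lambda>w u. R w (nfst u) (nsnd u))"
  shows "decidable (\<lambda>w u. \<exists>x. R w x u)"
proof -
  have "frag_decidable 3 (\<lambda>w xs. xs ! 2 = npair (xs ! 1) (xs ! 0) \<and> R w (nfst (xs ! 2)) (nsnd (xs ! 2)))"
    using frag_decidable_and[OF frag_decidable_subst[OF frag_decidable_npair, of "[1,0,2]" 3] frag_decidable_subst[OF assms[unfolded decidable_def], of "[2]" 3]]
    by simp
  then show ?thesis unfolding decidable_def by (rule frag_decidable_ex2) (auto simp: length1)
qed

lemma decidable_all:
  assumes "decidable (\<lambda>w u. R w (nfst u) (nsnd u))"
  shows "decidable (\<lambda>w u. \<forall>x. R w x u)"
  using decidable_not[OF decidable_ex[OF decidable_not[OF assms]]] by simp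

lemma decidable_const: "decidable (\<lambda>w u. b)"
proof (cases b)
  case True then show ?thesis using decidable_eq[OF computable_fun_id computable_fun_id] by simp
next
  case False then show ?thesis using decidable_not[OF decidable_eq[OF computable_fun_id computable_fun_id]] by simp
qed

lemma tmI: "decidable (\<lambda>w u. nsnd u = f (nfst u)) \<Longrightarrow> computable_fun f"
proof -
  assume a: "decidable (\<lambda>w u. nsnd u = f (nfst u))"
  have "frag_decidable 3 (\<lambda>w xs. xs ! 2 = npair (xs ! 0) (xs ! 1) \<and> nsnd (xs ! 2) = f (nfst (xs ! 2)))"
    using frag_decidable_and[OF frag_decidable_npair frag_decidable_subst[OF a[unfolded decidable_def], of "[2]" 3]]
    by simp
  then show "computable_fun f" unfolding computable_fun_def by (rule frag_decidable_ex1) (auto simp: length2)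
qed

lemma computable_fun_pred: assumes "computable_fun f" shows "computable_fun (\<lambda>u. f u - 1)"
proof -
  have "decidable (\<lambda>w u. (nfst u = 0 \<and> nsnd u = 0) \<or> nfst u = Suc (nsnd u))"
    by (intro decidable_or decidable_and decidable_eq computable_fun_nfst computable_fun_nsnd computable_fun_id computable_fun_const computable_fun_Suc)
  then have "decidable (\<lambda>w u. nsnd u = nfst u - 1)" by (rule decidable_cong) auto
  then have "computable_fun (\<lambda>u. u - 1)" by (rule tmI)
  then show ?thesis using computable_fun_comp assms by blast
qed

lemma computable_fun_iter:
  assumes "computable_fun f" "computable_fun n" "computable_fun x" shows "computable_fun (\<lambda>u. (f ^^ (n u)) (x u))"
proof -
  have "frag_decidable 3 (\<lambda>w xs. xs ! 2 = f (xs ! 1))"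
    using frag_decidable_subst[OF assms(1)[unfolded computable_fun_def], of "[1,2]" 3] by simp
  from frag_decidable_subst[OF frag_decidable_iter[where f="\<lambda>_. f", OF this], of "[0, 0, 1, 2]" 3]
  have "frag_decidable 3 (\<lambda>w xs. (f ^^ (xs ! 0)) (xs ! 1) = xs ! 2)" by simp
  then have "frag_decidable 3 (\<lambda>w xs. xs ! 2 = (f ^^ (xs ! 0)) (xs ! 1))" by (rule frag_decidable_cong) auto
  from computable_fun_bin[OF this assms(2,3)] show ?thesis .
qed

text \<open>The final copy puts the verdict into register 0, where outputs are read. The line after
  the fragment is no line of the program, so the machine halts there.\<close>

lemma decidable_halts:
  assumes "decidable R" shows "\<exists>P. \<forall>w i. halts_with P w i (if R w i then 1 else 0)"
proof -
  have "length [0::nat] = 1" "\<forall>i\<in>set [0::nat]. i < 1" by auto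
  from frag_decidable_E[OF assms[unfolded decidable_def] this]
  obtain C where C: "\<And>w X. executes w C X (\<lambda>Y. Y 1 = (if R w (map X [0] ! 0) then 1 else 0)) (agree 1 X)" by blast
  define P where "P = (C ;; frag_of (Copy 1 0)) 0"
  have main: "halts_with P w i (if R w i then 1 else 0)" for w i
  proof -
    let ?X = "\<lambda>k. if k = 0 then i else 0 :: nat"
    have e: "executes w (C ;; frag_of (Copy 1 0)) ?X (\<lambda>Y. Y 0 = (if R w i then 1 else 0)) (\<lambda>_. True)"
      by (intro executes_seq executes_conseq[OF C] executes_Copy) auto
    have "code_at P 0 ((C ;; frag_of (Copy 1 0)) 0)" unfolding P_def by (simp add: code_at_def)
    then obtain Y V where "config_path P w (0, ?X) V (length P, Y)" "Y 0 = (if R w i then 1 else 0)"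
      using e unfolding executes_def P_def by fastforce
    then show ?thesis by (intro config_path_halts) (auto simp: halted_def)
  qed
  show ?thesis by (intro exI allI) (rule main)
qed

section \<open>Depth-first search on stacks\<close>

text \<open>A push always increases the code, so along an infinite branch the stack register tends
  to infinity and is reset to 0. The successor and the code 1 for the empty stack keep 0 free as the
  sign of this event.\<close>

definition push :: "nat \<Rightarrow> nat \<Rightarrow> nat" where "push s t = Suc (npair s t)"

lemma push_gt: "s < push s t"
  by (simp add: push_def npair_le le_imp_less_Suc)

primrec stack_code :: "(nat \<Rightarrow> nat) \<Rightarrow> nat \<Rightarrow> nat" where
  "stack_code h 0 = 1"
| "stack_code h (Suc n) = push (stack_code h n) (h n)"

text \<open>Well-foundedness of the tree above \<open>s\<close>, given as an accessible part: the
  exhaustive search can follow this induction, and where it fails a good extension that is again not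
  dead can be chosen forever.\<close>

inductive dead :: "(nat \<Rightarrow> nat \<Rightarrow> bool) \<Rightarrow> nat \<Rightarrow> bool" for good where
  "(\<And>t. good s t \<Longrightarrow> dead good (push s t)) \<Longrightarrow> dead good s"

lemma dead_iff: "dead good 1 \<longleftrightarrow> \<not> (\<exists>h. \<forall>n. good (stack_code h n) (h n))"
proof
  have "dead good s \<Longrightarrow> s = stack_code h n \<Longrightarrow> \<not> (\<forall>n. good (stack_code h n) (h n))" for s h n
  proof (induction arbitrary: n rule: dead.induct)
    case (1 s)
    then show ?case using "1.IH"[of "h n" "Suc n"] by auto
  qed
  from this[of 1 _ 0] show "dead good 1 \<Longrightarrow> \<not> (\<exists>h. \<forall>n. good (stack_code h n) (h n))" by auto
next
  assume no: "\<not> (\<exists>h. \<forall>n. good (stack_code h n) (h n))"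
  show "dead good 1"
  proof (rule ccontr)
    assume nd: "\<not> dead good 1"
    define nx where "nx s = (SOME t. good s t \<and> \<not> dead good (push s t))" for s
    have nx: "good s (nx s) \<and> \<not> dead good (push s (nx s))" if "\<not> dead good s" for s
      unfolding nx_def by (rule someI_ex) (use that dead.intros[of good s] in blast)
    define S where "S n = ((\<lambda>s. push s (nx s)) ^^ n) 1" for n
    define h where "h n = nx (S n)" for n
    have S: "\<not> dead good (S n)" for n
      by (induction n) (use nd nx in \<open>auto simp: S_def\<close>)
    have "stack_code h n = S n" for n by (induction n) (auto simp: S_def h_def)
    then have "good (stack_code h n) (h n)" for n using nx[OF S[of n]] by (simp add: h_def)
    then show False using no by blast
  qed
qed

text \<open>Register \<open>k\<close> holds the result, \<open>k+1\<close> keeps the loop running,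
  \<open>k+2\<close> is the limit flag, \<open>k+3\<close> a constant 0, \<open>k+4\<close> the
  stack, \<open>k+5\<close> the next candidate. With the flag at 1 a round tests the candidate and
  either pushes it or passes to its successor. With the flag at 0 a limit has been reached: stack 0
  means an infinite branch, stack 1 an exhausted root, and any other stack has run out of
  candidates, so its top entry is popped and the successor of that entry is tried.\<close>

lemma frag_decidable_path_search:
  assumes good: "frag_decidable 3 (\<lambda>w xs. good w (xs ! 0) (xs ! 1) (xs ! 2))"
  shows "frag_decidable 1 (\<lambda>w xs. \<exists>h. \<forall>n. good w (xs ! 0) (stack_code h n) (h n))"
  unfolding frag_decidable_def
proof (intro allI impI)
  fix rs :: "nat list" and k :: nat assume "length rs = 1" "\<forall>i\<in>set rs. i < k"
  then obtain i where rs: "rs = [i]" and lt: "i < k"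
    by (auto simp: length_Suc_conv)
  have r3: "length [i, k+4, k+5] = 3" "\<forall>j\<in>set [i, k+4, k+5]. j < k + 6" using lt by auto
  obtain G where G0: "\<forall>w X Q I. (\<forall>S. agree (k+6) X S \<longrightarrow> I S) \<longrightarrow>
    (\<forall>Y. agree (k+6) X Y \<longrightarrow> Y (k+6) = (if good w (map X [i, k+4, k+5] ! 0) (map X [i, k+4, k+5] ! 1) (map X [i, k+4, k+5] ! 2) then 1 else 0) \<longrightarrow> Q Y) \<longrightarrow> executes w G X Q I"
    using executes_decidable[OF good r3] by (elim exE) (rule that)
  have r2: "length [k+4, k+5] = 2" "\<forall>j\<in>set [k+4, k+5]. j < k + 6" by auto
  have "frag_decidable 3 (\<lambda>w xs. xs ! 2 = push (xs ! 0) (xs ! 1))"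
  proof -
    have "frag_decidable 4 (\<lambda>w xs. xs ! 3 = npair (xs ! 0) (xs ! 1) \<and> xs ! 2 = Suc (xs ! 3))"
      using frag_decidable_and[OF frag_decidable_subst[OF frag_decidable_npair, of "[0,1,3]" 4] frag_decidable_subst[OF frag_decidable_Suc, of "[3,2]" 4]] by simp
    then show ?thesis by (rule frag_decidable_ex1) (auto simp: length3 push_def)
  qed
  then have Dp: "frag_decidable (Suc 2) (\<lambda>w xs. xs ! 2 = push (xs ! 0) (xs ! 1))" by simp
  have h2: "\<forall>w::nat set. \<forall>xs z. length xs = 2 \<longrightarrow> (xs @ [z]) ! 2 = push ((xs @ [z]) ! 0) ((xs @ [z]) ! 1) \<longleftrightarrow> z = push (xs ! 0) (xs ! 1)"
    by (auto simp: length2)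
  obtain U where U0: "\<forall>w X Q I. (\<forall>S. agree (k+6) X S \<longrightarrow> I S) \<longrightarrow>
    (\<forall>Y. agree (k+6) X Y \<longrightarrow> Y (k+6) = push (map X [k+4, k+5] ! 0) (map X [k+4, k+5] ! 1) \<longrightarrow> Q Y) \<longrightarrow> executes w U X Q I"
    using executes_fun[OF Dp r2 h2] by (elim exE) (rule that)
  have "computable_fun (\<lambda>u. nfst (u - 1))" "computable_fun (\<lambda>u. nsnd (u - 1))" by (intro computable_fun_nfst computable_fun_nsnd computable_fun_pred computable_fun_id)+
  then have Dpf: "frag_decidable (Suc 1) (\<lambda>w xs. xs ! 1 = nfst (xs ! 0 - 1))" and Dps: "frag_decidable (Suc 1) (\<lambda>w xs. xs ! 1 = nsnd (xs ! 0 - 1))"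
    by (simp_all add: computable_fun_def numeral_2_eq_2)
  have h1: "\<forall>w::nat set. \<forall>xs z. length xs = 1 \<longrightarrow> (xs @ [z]) ! 1 = f ((xs @ [z]) ! 0) \<longleftrightarrow> z = f (xs ! 0)" for f :: "nat \<Rightarrow> nat"
    by (auto simp: length_Suc_conv)
  have r1: "length [k+4] = 1" "\<forall>j\<in>set [k+4]. j < k + 6" "\<forall>j\<in>set [k+4]. j < k + 7" by auto
  obtain V1 where V10: "\<forall>w X Q I. (\<forall>S. agree (k+6) X S \<longrightarrow> I S) \<longrightarrow>
    (\<forall>Y. agree (k+6) X Y \<longrightarrow> Y (k+6) = nfst (map X [k+4] ! 0 - 1) \<longrightarrow> Q Y) \<longrightarrow> executes w V1 X Q I"
    using executes_fun[OF Dpf r1(1,2) h1[of "\<lambda>u. nfst (u - 1)"]] by (elim exE) (rule that)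
  obtain V2 where V20: "\<forall>w X Q I. (\<forall>S. agree (k+7) X S \<longrightarrow> I S) \<longrightarrow>
    (\<forall>Y. agree (k+7) X Y \<longrightarrow> Y (k+7) = nsnd (map X [k+4] ! 0 - 1) \<longrightarrow> Q Y) \<longrightarrow> executes w V2 X Q I"
    using executes_fun[OF Dps r1(1,3) h1[of "\<lambda>u. nsnd (u - 1)"]] by (elim exE) (rule that)
  note G = G0[simplified, rule_format] and U = U0[simplified, rule_format]
    and V1 = V10[simplified, rule_format] and V2 = V20[simplified, rule_format]
  define POP where "POP = V1 ;; V2 ;; frag_of (Copy (k+6) (k+4)) ;; frag_of (Copy (k+7) (k+5)) ;; frag_of (Inc (k+5))"
  define LMT where "LMT = if_equal (k+4) (k+3) (frag_of (Inc k) ;; frag_of (Zero (k+1)))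
    (frag_of (Zero (k+6)) ;; frag_of (Inc (k+6)) ;; if_equal (k+4) (k+6) (frag_of (Zero (k+1))) POP)"
  define STEP where "STEP = frag_of (Zero (k+2)) ;; G ;; frag_of (Zero (k+7)) ;;
    if_equal (k+6) (k+7) (frag_of (Inc (k+5))) (U ;; frag_of (Copy (k+6) (k+4)) ;; frag_of (Zero (k+5)))"
  define A where "A = if_equal (k+2) (k+3) LMT STEP"
  define B where "B = A ;; frag_of (Inc (k+2))"
  define W where "W = frag_of (Zero k) ;; frag_of (Zero (k+1)) ;; frag_of (Inc (k+1)) ;; frag_of (Zero (k+2)) ;; frag_of (Inc (k+2)) ;;
    frag_of (Zero (k+3)) ;; frag_of (Zero (k+4)) ;; frag_of (Inc (k+4)) ;; frag_of (Zero (k+5)) ;; loop_until (k+1) (k+3) B"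
  have main: "executes w W X0 (\<lambda>Y. Y k = (if \<exists>h. \<forall>n. good w (map X0 rs ! 0) (stack_code h n) (h n) then 1 else 0)) (agree k X0)" for w X0
  proof -
    define gd where "gd = good w (X0 i)"
    define st where "st s t fl Y \<longleftrightarrow> agree k X0 Y \<and> Y k = 0 \<and> Y (k+1) = 1 \<and> Y (k+2) = fl \<and> Y (k+3) = 0 \<and> Y (k+4) = s \<and> Y (k+5) = t"
      for s t fl :: nat and Y
    define J where "J m S \<longleftrightarrow> agree k X0 S \<and> S k = 0 \<and> S (k+1) = 1 \<and> S (k+3) = 0 \<and> m \<le> S (k+4)" for m and S :: regs
    define fin where "fin b Y \<longleftrightarrow> agree k X0 Y \<and> Y (k+1) = 0 \<and> Y (k+3) = 0 \<and> Y k = b" for b and Y :: regs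
    have Jag: "J m S \<Longrightarrow> agree k X0 S" for m S by (simp add: J_def)
    have Jmono: "J m S \<Longrightarrow> m' \<le> m \<Longrightarrow> J m' S" for m m' S by (simp add: J_def)
    have e1: "executes w A Y (\<lambda>Z. Z (k+2) = 0 \<and> st s (Suc t) 1 (Z(k+2 := 1)) \<and> J s (Z(k+2 := 1))) (J s)"
      if Y: "st s t 1 Y" "\<not> gd s t" for s t Y
      unfolding A_def STEP_def
      by (intro executes_if executes_seq executes_Zero G executes_Inc) (use Y lt in \<open>auto simp: st_def J_def gd_def agree_def\<close>)
    have e2: "executes w A Y (\<lambda>Z. Z (k+2) = 0 \<and> st (push s t) 0 1 (Z(k+2 := 1)) \<and> J s (Z(k+2 := 1))) (J s)"
      if Y: "st s t 1 Y" "gd s t" for s t Y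
      unfolding A_def STEP_def
      by (intro executes_if executes_seq executes_Zero G U executes_Inc executes_Copy)
         (use Y lt push_gt[of s t] in \<open>auto simp: st_def J_def gd_def agree_def\<close>)
    have e3: "executes w A Y (\<lambda>Z. Z (k+2) = 0 \<and> st s (Suc t) 1 (Z(k+2 := 1)) \<and> J s (Z(k+2 := 1))) (J s)"
      if Y: "st (push s t) t' 0 Y" "s \<ge> 1" for s t t' Y
      unfolding A_def LMT_def POP_def
      by (intro executes_if executes_seq executes_Zero V1 V2 executes_Inc executes_Copy)
         (use Y lt push_gt[of s t] in \<open>auto simp: st_def J_def gd_def agree_def push_def\<close>)
    have e4: "executes w A Y (\<lambda>Z. Z (k+2) = 0 \<and> fin 1 (Z(k+2 := 1)) \<and> agree k X0 (Z(k+2 := 1))) (agree k X0)"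
      if Y: "st 0 t' 0 Y" for t' Y
      unfolding A_def LMT_def
      by (intro executes_if executes_seq executes_Zero executes_Inc) (use Y in \<open>auto simp: st_def fin_def agree_def\<close>)
    have e5: "executes w A Y (\<lambda>Z. Z (k+2) = 0 \<and> fin 0 (Z(k+2 := 1)) \<and> agree k X0 (Z(k+2 := 1))) (agree k X0)"
      if Y: "st 1 t' 0 Y" for t' Y
      unfolding A_def LMT_def
      by (intro executes_if executes_seq executes_Zero executes_Inc) (use Y in \<open>auto simp: st_def fin_def agree_def\<close>)
    have loop_path: "executes w (loop_until (k+1) (k+3) B) X (fin (if dead gd 1 then 0 else 1)) (agree k X0)" if X: "st 1 0 1 X" for X
    proof (rule executes_loop_until[where F="k+2"])
      fix P p assume at: "code_at P p (loop_until (k+1) (k+3) B p)"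
      let ?L = "loop_path P w p (length (loop_until (k+1) (k+3) B p)) (k+2)"
      note at' = at[unfolded B_def]
      have stne: "st s t fl Y \<Longrightarrow> Y (k+1) \<noteq> Y (k+3)" for s t fl Y by (simp add: st_def)
      have stJ: "st s t fl Y \<Longrightarrow> m \<le> s \<Longrightarrow> J m Y" for s t fl m Y by (simp add: st_def J_def)
      have stag: "st s t fl Y \<Longrightarrow> agree k X0 Y" for s t fl Y by (simp add: st_def)
      have m1: "\<exists>Z. st s (Suc t) 1 Z \<and> ?L Y Z (J s)" if "st s t 1 Y" "\<not> gd s t" for s t Y
        using loop_path_step[OF at' stne[OF that(1)] stJ[OF that(1) order_refl] e1[OF that]] unfolding B_def .
      have m2: "\<exists>Z. st (push s t) 0 1 Z \<and> ?L Y Z (J s)" if "st s t 1 Y" "gd s t" for s t Y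
        using loop_path_step[OF at' stne[OF that(1)] stJ[OF that(1) order_refl] e2[OF that]] unfolding B_def .
      have m3: "\<exists>Z. st s (Suc t) 1 Z \<and> ?L Y Z (J s)" if "st (push s t) t' 0 Y" "s \<ge> 1" for s t t' Y
        using loop_path_step[OF at' stne[OF that(1)] stJ[OF that(1) less_imp_le[OF push_gt]] e3[OF that]] unfolding B_def .
      have m4: "\<exists>Z. fin 1 Z \<and> ?L Y Z (agree k X0)" if "st 0 t' 0 Y" for t' Y
        using loop_path_step[OF at' stne[OF that] stag[OF that] e4[OF that]] unfolding B_def .
      have m5: "\<exists>Z. fin 0 Z \<and> ?L Y Z (agree k X0)" if "st 1 t' 0 Y" for t' Y
        using loop_path_step[OF at' stne[OF that] stag[OF that] e5[OF that]] unfolding B_def .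
      have constI: "Y r = c"
        if c: "\<forall>r m. (\<forall>(n::nat) S. I n S \<longrightarrow> m \<le> S r) \<longrightarrow> (\<exists>\<^sub>\<infinity>n. f n r = m) \<longrightarrow> Y r = m"
        and i: "\<forall>n. I n (f n)" and v: "\<And>n S. I n S \<Longrightarrow> S r = c" for Y :: regs and I :: "nat \<Rightarrow> regs \<Rightarrow> bool" and f :: "nat \<Rightarrow> regs" and r c :: nat
      proof (rule c[rule_format])
        show "\<exists>\<^sub>\<infinity>n. f n r = c" using i v by (simp add: INFM_nat_le) blast
      qed (use v in auto)
      \<comment> \<open>A dead stack is explored completely. The stack register never falls below
        \<open>s\<close> and returns to \<open>s\<close> for every candidate, so its liminf is
        exactly \<open>s\<close>, whatever limits were passed inside the subtrees.\<close>
      have A: "dead gd s \<Longrightarrow> s \<ge> 1 \<Longrightarrow> st s 0 1 Y \<Longrightarrow> \<exists>Z t'. st s t' 0 Z \<and> ?L Y Z (J s)" for s Y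
      proof (induction arbitrary: Y rule: dead.induct)
        case (1 s Y)
        have nx: "\<forall>n Y. st s n 1 Y \<longrightarrow> (\<exists>Z. st s (Suc n) 1 Z \<and> ?L Y Z (J s))"
        proof (intro allI impI)
          fix t Y assume Y: "st s t 1 Y"
          show "\<exists>Z. st s (Suc t) 1 Z \<and> ?L Y Z (J s)"
          proof (cases "gd s t")
            case True
            obtain Y1 where Y1: "st (push s t) 0 1 Y1" "?L Y Y1 (J s)" using m2[OF Y True] by blast
            have "push s t \<ge> 1" by (simp add: push_def)
            then obtain Y2 t' where Y2: "st (push s t) t' 0 Y2" "?L Y1 Y2 (J (push s t))"
              using "1.IH"[OF True _ Y1(1)] by blast
            obtain Y3 where Y3: "st s (Suc t) 1 Y3" "?L Y2 Y3 (J s)" using m3[OF Y2(1) "1.prems"(1)] by blast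
            have "?L Y1 Y2 (J s)" by (rule loop_path_mono[OF Y2(2)]) (use Jmono less_imp_le[OF push_gt] in blast)
            then have "?L Y Y3 (J s)" using Y1(2) Y3(2) loop_path_trans by blast
            then show ?thesis using Y3(1) by blast
          qed (use m1[OF Y] in blast)
        qed
        from loop_path_lim[of "\<lambda>n. st s n 1" Y P w p _ _ "\<lambda>_. J s", OF "1.prems"(2) nx]
        obtain f Z where f: "\<forall>n. st s n 1 (f n)" and i: "\<forall>n::nat. J s (f n)" and L: "?L Y Z (\<lambda>S. \<exists>n::nat. J s S)" and F: "Z (k+2) = 0"
          and c: "\<forall>r m. (\<forall>(n::nat) S. J s S \<longrightarrow> m \<le> S r) \<longrightarrow> (\<exists>\<^sub>\<infinity>n. f n r = m) \<longrightarrow> Z r = m"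
          by (elim exE conjE) (rule that)
        have "Z r = X0 r" if "r < k" for r
          by (rule constI[where I="\<lambda>_. J s", OF c i]) (use that in \<open>auto simp: J_def agree_def\<close>)
        moreover have "Z k = 0" by (rule constI[where I="\<lambda>_. J s", OF c i]) (auto simp: J_def)
        moreover have "Z (k+1) = 1" by (rule constI[where I="\<lambda>_. J s", OF c i]) (auto simp: J_def)
        moreover have "Z (k+3) = 0" by (rule constI[where I="\<lambda>_. J s", OF c i]) (auto simp: J_def)
        moreover have "Z (k+4) = s"
        proof (rule c[rule_format])
          show "\<exists>\<^sub>\<infinity>n. f n (k+4) = s" using f by (simp add: INFM_nat_le st_def)
        qed (auto simp: J_def)
        ultimately have "st s (Z (k+5)) 0 Z" using F by (simp add: st_def agree_def)
        moreover have "?L Y Z (J s)" using L by simp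
        ultimately show ?case by blast
      qed
      \<comment> \<open>Only finitely many candidates precede the least one whose push is not dead.
        Each of them either fails the test or leads to a dead stack that is exhausted and popped, so
        the search arrives at that push.\<close>
      have Bc: "\<exists>s' Z. \<not> dead gd s' \<and> s < s' \<and> st s' 0 1 Z \<and> ?L Y Z (J s)"
        if nd: "\<not> dead gd s" and Y: "st s 0 1 Y" and s1: "s \<ge> 1" for s Y
      proof -
        define t where "t = (LEAST t. gd s t \<and> \<not> dead gd (push s t))"
        have "\<exists>t. gd s t \<and> \<not> dead gd (push s t)" using nd dead.intros[of gd s] by blast
        from LeastI_ex[OF this] have t: "gd s t" "\<not> dead gd (push s t)" unfolding t_def by blast+
        have t': "gd s j \<Longrightarrow> dead gd (push s j)" if "j < t" for j
          using not_less_Least[of j "\<lambda>t. gd s t \<and> \<not> dead gd (push s t)"] that unfolding t_def by blast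
        have "j \<le> t \<Longrightarrow> \<exists>Z. st s j 1 Z \<and> (Z = Y \<or> ?L Y Z (J s))" for j
        proof (induction j)
          case (Suc j)
          then obtain Y0 where Y0: "st s j 1 Y0" "Y0 = Y \<or> ?L Y Y0 (J s)" by auto
          have "\<exists>Z. st s (Suc j) 1 Z \<and> ?L Y0 Z (J s)"
          proof (cases "gd s j")
            case True
            obtain Y1 where Y1: "st (push s j) 0 1 Y1" "?L Y0 Y1 (J s)" using m2[OF Y0(1) True] by blast
            have "push s j \<ge> 1" "dead gd (push s j)" using t'[OF _ True] Suc(2) by (simp_all add: push_def)
            then obtain Y2 u where Y2: "st (push s j) u 0 Y2" "?L Y1 Y2 (J (push s j))"
              using A[OF _ _ Y1(1)] by blast
            obtain Y3 where Y3: "st s (Suc j) 1 Y3" "?L Y2 Y3 (J s)" using m3[OF Y2(1) s1] by blast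
            have "?L Y1 Y2 (J s)" by (rule loop_path_mono[OF Y2(2)]) (use Jmono less_imp_le[OF push_gt] in blast)
            then have "?L Y0 Y3 (J s)" using Y1(2) Y3(2) loop_path_trans by blast
            then show ?thesis using Y3(1) by blast
          qed (use m1[OF Y0(1)] in blast)
          then show ?case using Y0(2) loop_path_trans by blast
        qed (use Y in auto)
        then obtain Y0 where Y0: "st s t 1 Y0" "Y0 = Y \<or> ?L Y Y0 (J s)" by blast
        obtain Z where Z: "st (push s t) 0 1 Z" "?L Y0 Z (J s)" using m2[OF Y0(1) t(1)] by blast
        then have "?L Y Z (J s)" using Y0(2) loop_path_trans by blast
        then show ?thesis using Z(1) t(2) push_gt by blast
      qed
      show "\<exists>Y. (Y = X \<or> ?L X Y (agree k X0)) \<and> Y (k+1) = Y (k+3) \<and> fin (if dead gd 1 then 0 else 1) Y \<and> agree k X0 Y"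
      proof (cases "dead gd 1")
        case True
        obtain Z u where Z: "st 1 u 0 Z" "?L X Z (J 1)" using A[OF True _ X] by auto
        obtain Z' where Z': "fin 0 Z'" "?L Z Z' (agree k X0)" using m5[OF Z(1)] by blast
        have "?L X Z (agree k X0)" by (rule loop_path_mono[OF Z(2)]) (rule Jag)
        then have "?L X Z' (agree k X0)" using Z'(2) loop_path_trans by blast
        then show ?thesis using Z'(1) True by (intro exI[of _ Z']) (auto simp: fin_def)
      next
        case False
        \<comment> \<open>Every descent raises the stack by at least one, so in round
          \<open>n\<close> the register is at least \<open>n\<close> at all times; it diverges and
          shows 0 at the limit.\<close>
        define T where "T n Y \<longleftrightarrow> (\<exists>s. \<not> dead gd s \<and> n \<le> s \<and> 1 \<le> s \<and> st s 0 1 Y)" for n :: nat and Y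
        have T0: "T 0 X" unfolding T_def using X False by (intro exI[of _ 1]) simp
        have TS: "\<forall>n Y. T n Y \<longrightarrow> (\<exists>Z. T (Suc n) Z \<and> ?L Y Z (J n))"
        proof (intro allI impI)
          fix n Y assume "T n Y"
          then obtain s where s: "\<not> dead gd s" "n \<le> s" "1 \<le> s" "st s 0 1 Y" unfolding T_def by blast
          then obtain s' Z where Z: "\<not> dead gd s'" "s < s'" "st s' 0 1 Z" "?L Y Z (J s)" using Bc by blast
          have "?L Y Z (J n)" by (rule loop_path_mono[OF Z(4)]) (use Jmono s(2) in blast)
          moreover have "T (Suc n) Z" unfolding T_def using Z s by (intro exI[of _ s']) auto
          ultimately show "\<exists>Z. T (Suc n) Z \<and> ?L Y Z (J n)" by blast
        qed
        from loop_path_lim[OF T0 TS]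
        obtain f Z where i: "\<forall>n. J n (f n)" and L: "?L X Z (\<lambda>S. \<exists>n. J n S)" and F: "Z (k+2) = 0"
          and c: "\<forall>r m. (\<forall>n S. J n S \<longrightarrow> m \<le> S r) \<longrightarrow> (\<exists>\<^sub>\<infinity>n. f n r = m) \<longrightarrow> Z r = m"
          and o: "\<forall>r. (\<forall>m. \<exists>n0. \<forall>n\<ge>n0. \<forall>S. J n S \<longrightarrow> m \<le> S r) \<longrightarrow> Z r = 0"
          by (elim exE conjE) (rule that)
        have "Z r = X0 r" if "r < k" for r
          by (rule constI[where I=J and f=f, OF c i]) (use that in \<open>auto simp: J_def agree_def\<close>)
        moreover have "Z k = 0" by (rule constI[where I=J and f=f, OF c i]) (auto simp: J_def)
        moreover have "Z (k+1) = 1" by (rule constI[where I=J and f=f, OF c i]) (auto simp: J_def)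
        moreover have "Z (k+3) = 0" by (rule constI[where I=J and f=f, OF c i]) (auto simp: J_def)
        moreover have "Z (k+4) = 0" 
        proof (rule o[rule_format])
          fix m show "\<exists>n0. \<forall>n\<ge>n0. \<forall>S. J n S \<longrightarrow> m \<le> S (k+4)"
            by (intro exI[of _ m]) (auto simp: J_def)
        qed
        ultimately have "st 0 (Z (k+5)) 0 Z" using F by (simp add: st_def agree_def)
        then obtain Z' where Z': "fin 1 Z'" "?L Z Z' (agree k X0)" using m4 by blast
        have "?L X Z (agree k X0)" by (rule loop_path_mono[OF L]) (use Jag in blast)
        then have "?L X Z' (agree k X0)" using Z'(2) loop_path_trans by blast
        then show ?thesis using Z'(1) False by (intro exI[of _ Z']) (auto simp: fin_def)
      qed
    qed
    show ?thesis unfolding W_def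
      by (intro executes_seq executes_Zero executes_Inc executes_conseq[OF loop_path])
         (use dead_iff[of gd] in \<open>auto simp: st_def agree_def fin_def rs gd_def\<close>)
  qed
  show "\<exists>C. \<forall>w X. executes w C X (\<lambda>Y. Y k = (if \<exists>h. \<forall>n. good w (map X rs ! 0) (stack_code h n) (h n) then 1 else 0)) (agree k X)"
    by (intro exI allI) (rule main)
qed

section \<open>Open games and forcing\<close>

lemma decidable_app1: "decidable R \<Longrightarrow> computable_fun f \<Longrightarrow> decidable (\<lambda>w u. R w (f u))"
  by (rule decidable_subst)

lemma decidable_app2:
  assumes "decidable (\<lambda>w z. A w (nfst z) (nsnd z))" "computable_fun f" "computable_fun g"
  shows "decidable (\<lambda>w u. A w (f u) (g u))"
  using decidable_subst[OF assms(1) computable_fun_npair[OF assms(2,3)]] by simp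

lemma decidable_app3:
  assumes "decidable (\<lambda>w z. B w (nfst z) (nfst (nsnd z)) (nsnd (nsnd z)))" "computable_fun f" "computable_fun g" "computable_fun h"
  shows "decidable (\<lambda>w u. B w (f u) (g u) (h u))"
  using decidable_subst[OF assms(1) computable_fun_npair[OF assms(2) computable_fun_npair[OF assms(3,4)]]] by simp

lemma frag_decidable3_of_decidable:
  assumes "decidable (\<lambda>w z. B w (nfst z) (nfst (nsnd z)) (nsnd (nsnd z)))"
  shows "frag_decidable 3 (\<lambda>w xs. B w (xs ! 0) (xs ! 1) (xs ! 2))"
proof -
  have "frag_decidable 5 (\<lambda>w xs. xs ! 3 = npair (xs ! 1) (xs ! 2) \<and> xs ! 4 = npair (xs ! 0) (xs ! 3) \<and>
      B w (nfst (xs ! 4)) (nfst (nsnd (xs ! 4))) (nsnd (nsnd (xs ! 4))))"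
    using frag_decidable_and[OF frag_decidable_subst[OF frag_decidable_npair, of "[1,2,3]" 5] frag_decidable_and[OF frag_decidable_subst[OF frag_decidable_npair, of "[0,3,4]" 5]
      frag_decidable_subst[OF assms[unfolded decidable_def], of "[4]" 5]]] by simp
  then show ?thesis by (rule frag_decidable_ex2) (auto simp: length3)
qed

text \<open>The positions won in an open game: \<open>g\<close> is a challenge by the opponent and
  \<open>v\<close> an answer, which is the next position. An opponent without a challenge has lost,
  so no separate base case is needed.\<close>

inductive game_win :: "(nat \<Rightarrow> nat \<Rightarrow> bool) \<Rightarrow> (nat \<Rightarrow> nat \<Rightarrow> nat \<Rightarrow> bool) \<Rightarrow> nat \<Rightarrow> bool" for A B where
  "(\<And>g. A u g \<Longrightarrow> \<exists>v. B u g v \<and> game_win A B v) \<Longrightarrow> game_win A B u"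

text \<open>One function codes a whole strategy of the opponent: \<open>x u = 0\<close> claims
  nothing, and \<open>x u = Suc g\<close> claims that \<open>u\<close> is lost to the challenge
  \<open>g\<close>. Each instance of the condition involves only two values of \<open>x\<close>, so
  it can be tested along a branch.\<close>

lemma not_game_win_iff:
  "\<not> game_win A B u0 \<longleftrightarrow> (\<exists>x :: nat \<Rightarrow> nat. x u0 \<noteq> 0 \<and>
     (\<forall>u. x u \<noteq> 0 \<longrightarrow> A u (x u - 1) \<and> (\<forall>v. B u (x u - 1) v \<longrightarrow> x v \<noteq> 0)))" (is "?L \<longleftrightarrow> ?R")
proof
  assume L: ?L
  define x where "x u = (if game_win A B u then 0 else Suc (SOME g. A u g \<and> (\<forall>v. B u g v \<longrightarrow> \<not> game_win A B v)))" for u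
  have "A u (x u - 1) \<and> (\<forall>v. B u (x u - 1) v \<longrightarrow> \<not> game_win A B v)" if "x u \<noteq> 0" for u
  proof -
    have nl: "\<not> game_win A B u" using that by (auto simp: x_def split: if_splits)
    then have "\<exists>g. A u g \<and> (\<forall>v. B u g v \<longrightarrow> \<not> game_win A B v)" using game_win.intros[of A u B] by blast
    from someI_ex[OF this] show ?thesis using nl by (simp add: x_def)
  qed
  moreover have "x v \<noteq> 0 \<longleftrightarrow> \<not> game_win A B v" for v by (simp add: x_def)
  ultimately show ?R using L by (intro exI[of _ x]) auto
next
  assume ?R
  then obtain x :: "nat \<Rightarrow> nat" where x: "x u0 \<noteq> 0"
    "\<And>u. x u \<noteq> 0 \<Longrightarrow> A u (x u - 1) \<and> (\<forall>v. B u (x u - 1) v \<longrightarrow> x v \<noteq> 0)" by blast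
  have "game_win A B u \<Longrightarrow> x u = 0" for u
  proof (induction rule: game_win.induct)
    case (1 u) then show ?case using x(2)[of u] by blast
  qed
  then show ?L using x(1) by auto
qed

definition pop :: "nat \<Rightarrow> nat" where "pop s = nfst (s - 1)"

text \<open>The clause \<open>1 \<le> s'\<close> matters because \<open>push 0 0 = 1\<close>:
  without it the empty stack would have an entry.\<close>

definition entry :: "nat \<Rightarrow> nat \<Rightarrow> bool" where
  "entry s e \<longleftrightarrow> (\<exists>m s'. 1 \<le> s' \<and> (pop ^^ m) s = push s' e)"

lemma stack_code_pos: "1 \<le> stack_code h n" by (induction n) (auto simp: push_def)

lemma push_inj: "push s e = push s' e' \<longleftrightarrow> s = s' \<and> e = e'" by (simp add: push_def)

lemma entry_push: assumes "1 \<le> s" shows "entry (push s t) e \<longleftrightarrow> e = t \<or> entry s e"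
proof -
  have p: "pop (push s t) = s" by (simp add: pop_def push_def)
  have p': "(pop ^^ Suc m) (push s t) = (pop ^^ m) s" for m
    by (simp only: funpow_Suc_right comp_apply p)
  show ?thesis
  proof
    assume "entry (push s t) e"
    then obtain m s' where m: "1 \<le> s'" "(pop ^^ m) (push s t) = push s' e" unfolding entry_def by blast
    show "e = t \<or> entry s e"
    proof (cases m)
      case 0 then show ?thesis using m by (simp add: push_inj)
    next
      case (Suc n) then show ?thesis using m p' unfolding entry_def by metis
    qed
  next
    assume "e = t \<or> entry s e"
    then show "entry (push s t) e"
    proof
      assume "e = t" then show ?thesis unfolding entry_def using assms by (intro exI[of _ 0] exI[of _ s]) simp
    next
      assume "entry s e"
      then obtain m s' where "1 \<le> s'" "(pop ^^ m) s = push s' e" unfolding entry_def by blast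
      then show ?thesis unfolding entry_def using p'[of m] by (intro exI[of _ "Suc m"] exI[of _ s']) simp
    qed
  qed
qed

lemma entry_1: "\<not> entry 1 e"
proof -
  have "(pop ^^ m) 1 \<le> 1" for m
  proof (induction m)
    case (Suc m)
    have "pop x = 0" if "x \<le> 1" for x using that by (cases x) (auto simp: pop_def)
    then show ?case using Suc by simp
  qed auto
  then have "(pop ^^ m) 1 \<noteq> push s' e" if "1 \<le> s'" for m s'
    using push_gt[of s' e] that by (metis dual_order.strict_trans2 not_less)
  then show ?thesis unfolding entry_def by blast
qed

lemma entry_stack_code: "entry (stack_code h n) e \<longleftrightarrow> (\<exists>m<n. e = h m)"
  by (induction n) (auto simp: entry_push[OF stack_code_pos] less_Suc_eq simp: entry_1[simplified])

text \<open>A branch lists the graph of a function in order, its entry number \<open>n\<close> being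
  \<open>npair n (x n)\<close>; \<open>idx s\<close> is the argument whose value is due
  next.\<close>

definition idx :: "nat \<Rightarrow> nat" where "idx s = (if s = 1 then 0 else Suc (nfst (nsnd (s - 1))))"

lemma idx_stack_code: "idx (stack_code h n) = (if n = 0 then 0 else Suc (nfst (h (n - 1))))"
proof (cases n)
  case (Suc m)
  have "push (stack_code h m) (h m) \<noteq> 1" using push_gt[of "stack_code h m" "h m"] stack_code_pos[of h m] by linarith
  then show ?thesis using Suc by (simp add: idx_def) (simp add: push_def)
qed (simp add: idx_def)

text \<open>Infinite branches are the strategies of the opponent. The condition on a pair of entries
  is tested when the later of the two is pushed, so along an infinite branch all instances
  hold.\<close>

lemma decidable_game_win:
  assumes A: "decidable (\<lambda>w z. A w (nfst z) (nsnd z))" and B: "decidable (\<lambda>w z. B w (nfst z) (nfst (nsnd z)) (nsnd (nsnd z)))"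
  shows "decidable (\<lambda>w u. game_win (A w) (B w) u)"
proof -
  define M where "M w u e e' \<longleftrightarrow> (nfst e = u \<longrightarrow> nsnd e \<noteq> 0) \<and>
    (nsnd e \<noteq> 0 \<longrightarrow> A w (nfst e) (nsnd e - 1) \<and> (B w (nfst e) (nsnd e - 1) (nfst e') \<longrightarrow> nsnd e' \<noteq> 0))" for w u e e'
  define good where "good w u s t \<longleftrightarrow> nfst t = idx s \<and>
     (\<forall>e e'. (e = t \<or> entry s e) \<and> (e' = t \<or> entry s e') \<longrightarrow> M w u e e')" for w u s t
  have path: "(\<exists>h. \<forall>n. good w u (stack_code h n) (h n)) \<longleftrightarrow> \<not> game_win (A w) (B w) u" for w u
    unfolding not_game_win_iff
  proof
    assume "\<exists>h. \<forall>n. good w u (stack_code h n) (h n)"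
    then obtain h where h: "\<And>n. good w u (stack_code h n) (h n)" by blast
    have pfh: "nfst (h n) = n" for n
    proof (induction n)
      case 0 then show ?case using h[of 0] by (simp add: good_def idx_def)
    next
      case (Suc n) then show ?case using h[of "Suc n"] idx_stack_code[of h "Suc n"] unfolding good_def by simp
    qed
    have M: "M w u (h a) (h b)" for a b
    proof -
      have "h a = h (max a b) \<or> entry (stack_code h (max a b)) (h a)" "h b = h (max a b) \<or> entry (stack_code h (max a b)) (h b)"
        unfolding entry_stack_code by (metis max.cobounded1 max.cobounded2 nat_less_le)+
      then show ?thesis using h[of "max a b"] unfolding good_def by blast
    qed
    show "\<exists>x. x u \<noteq> 0 \<and> (\<forall>a. x a \<noteq> 0 \<longrightarrow> A w a (x a - 1) \<and> (\<forall>v. B w a (x a - 1) v \<longrightarrow> x v \<noteq> 0))"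
      using M by (intro exI[of _ "\<lambda>a. nsnd (h a)"]) (auto simp: M_def pfh)
  next
    assume "\<exists>x. x u \<noteq> 0 \<and> (\<forall>a. x a \<noteq> 0 \<longrightarrow> A w a (x a - 1) \<and> (\<forall>v. B w a (x a - 1) v \<longrightarrow> x v \<noteq> 0))"
    then obtain x where x: "x u \<noteq> 0" "\<And>a. x a \<noteq> 0 \<Longrightarrow> A w a (x a - 1) \<and> (\<forall>v. B w a (x a - 1) v \<longrightarrow> x v \<noteq> 0)" by blast
    define h where "h n = npair n (x n)" for n
    have "M w u (h a) (h b)" for a b using x by (auto simp: M_def h_def)
    then have "good w u (stack_code h n) (h n)" for n
      unfolding good_def entry_stack_code idx_stack_code by (auto simp: h_def)
    then show "\<exists>h. \<forall>n. good w u (stack_code h n) (h n)" by blast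
  qed
  note tms = computable_fun_id computable_fun_const computable_fun_Suc computable_fun_nfst computable_fun_nsnd computable_fun_pred computable_fun_npair
  have "computable_fun pop" unfolding pop_def by (intro tms)
  have entry: "decidable (\<lambda>w z. entry (f z) (g z))" if "computable_fun f" "computable_fun g" for f g
    unfolding entry_def push_def
    by (intro decidable_ex decidable_and decidable_le decidable_eq tms computable_fun_iter \<open>computable_fun pop\<close> computable_fun_comp[OF that(1)] computable_fun_comp[OF that(2)])
  have idx: "decidable (\<lambda>w z. f z = idx (g z))" if "computable_fun f" "computable_fun g" for f g
  proof -
    have "decidable (\<lambda>w z. (g z = 1 \<and> f z = 0) \<or> (g z \<noteq> 1 \<and> f z = Suc (nfst (nsnd (g z - 1)))))"
      by (intro decidable_or decidable_and decidable_not decidable_eq tms that)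
    then show ?thesis by (rule decidable_cong) (auto simp: idx_def)
  qed
  have "decidable (\<lambda>w z. good w (nfst z) (nfst (nsnd z)) (nsnd (nsnd z)))"
    unfolding good_def M_def
    by (intro decidable_all decidable_and decidable_imp decidable_or decidable_not decidable_eq entry idx tms decidable_app2[OF A] decidable_app3[OF B])
  from frag_decidable_path_search[OF frag_decidable3_of_decidable[OF this]]
  have "decidable (\<lambda>w u. \<exists>h. \<forall>n. good w u (stack_code h n) (h n))" unfolding decidable_def .
  from decidable_not[OF this] show ?thesis by (rule decidable_cong) (use path in blast)
qed

text \<open>The stages of the least fixed point, indexed by a well-order of \<open>nat set\<close>.
  This type suffices because it does not inject into the positions, so the stages must become
  stationary.\<close>

inductive stage :: "nat set rel \<Rightarrow> (nat \<Rightarrow> nat \<Rightarrow> bool) \<Rightarrow> (nat \<Rightarrow> nat \<Rightarrow> nat \<Rightarrow> bool) \<Rightarrow> nat set \<Rightarrow> nat \<Rightarrow> bool"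
  for R A B where
  "(\<And>g. A u g \<Longrightarrow> \<exists>v b. B u g v \<and> (b, a) \<in> R \<and> stage R A B b v) \<Longrightarrow> stage R A B a u"

text \<open>In the soundness half of the truth lemma the winning answer is chosen by genericity among the
  members of a decidable set, so its descent in rank has to be expressed by a decidable relation.\<close>

lemma stage_order:
  assumes A: "decidable (\<lambda>w z. A (nfst z) (nsnd z))" and B: "decidable (\<lambda>w z. B (nfst z) (nfst (nsnd z)) (nsnd (nsnd z)))"
  shows "\<exists>L. decidable (\<lambda>w z. L (nfst z) (nsnd z)) \<and>
    (\<forall>z g. game_win A B z \<longrightarrow> A z g \<longrightarrow> (\<exists>v. B z g v \<and> L v z)) \<and>
    (\<forall>P. (\<forall>z. game_win A B z \<longrightarrow> (\<forall>v. L v z \<longrightarrow> game_win A B v \<and> P v) \<longrightarrow> P z) \<longrightarrow> (\<forall>z. game_win A B z \<longrightarrow> P z))"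
proof -
  obtain r :: "nat set rel" where r: "Well_order r" "Field r = UNIV"
    using well_ordering by (elim exE conjE) (rule that)
  define R where "R = r - Id"
  have wf: "wf R" using r unfolding R_def well_order_on_def by blast
  have tot: "a = b \<or> (a, b) \<in> R \<or> (b, a) \<in> R" for a b
    using r unfolding R_def well_order_on_def linear_order_on_def total_on_def by blast
  have trans: "(a, b) \<in> R \<Longrightarrow> (b, c) \<in> R \<Longrightarrow> (a, c) \<in> R" for a b c
    using r unfolding R_def well_order_on_def linear_order_on_def partial_order_on_def preorder_on_def
    by (auto dest: transD antisymD)
  let ?s = "stage R A B"
  have up: "?s a u \<Longrightarrow> (a, b) \<in> R \<Longrightarrow> ?s b u" for a b u
  proof (erule stage.cases, rule stage.intros)
    fix u' a' g assume "a = a'" "u = u'" "(a, b) \<in> R" "A u g"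
      and "\<And>g. A u' g \<Longrightarrow> \<exists>v b. B u' g v \<and> (b, a') \<in> R \<and> ?s b v"
    then show "\<exists>v c. B u g v \<and> (c, b) \<in> R \<and> ?s c v" using trans by metis
  qed
  have sD: "\<exists>v b. B u g v \<and> (b, a) \<in> R \<and> ?s b v" if "?s a u" "A u g" for a u g
    using that by (auto elim: stage.cases)
  have below: "(b, a) \<in> R" if "?s b v" "\<not> ?s b z" "?s a z" for a b v z
    using tot[of a b] up that by blast
  have s_game_win: "?s a u \<Longrightarrow> game_win A B u" for a u
    by (induction rule: stage.induct) (metis game_win.intros)
  have game_win_s: "\<exists>a. ?s a u" if "game_win A B u" for u
  proof -
    define S where "S a = {u. \<exists>b. (b, a) \<in> R \<and> ?s b u}" for a
    \<comment> \<open>If every stage won a new position, choosing one for each stage would inject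
      \<open>nat set\<close> into \<open>nat\<close>, against Cantor's diagonal argument.\<close>
    have "\<exists>a. \<forall>u. ?s a u \<longrightarrow> u \<in> S a"
    proof (rule ccontr)
      assume "\<not> ?thesis"
      then obtain f where f: "\<And>a. ?s a (f a) \<and> f a \<notin> S a" by metis
      have "inj f"
      proof (rule injI)
        fix a b assume "f a = f b"
        then show "a = b" using tot[of a b] f[of a] f[of b] unfolding S_def by auto
      qed
      then have "surj (inv f)" by (rule inj_imp_surj_inv)
      then obtain n where "inv f n = {n. n \<notin> inv f n}" by (metis surjD)
      then show False by blast
    qed
    then obtain a where a: "\<And>u. ?s a u \<Longrightarrow> u \<in> S a" by blast
    from that have "u \<in> S a"
    proof (induction rule: game_win.induct)
      case (1 u)
      have "?s a u"
      proof (rule stage.intros)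
        fix g assume "A u g"
        then show "\<exists>v b. B u g v \<and> (b, a) \<in> R \<and> ?s b v" using 1 unfolding S_def by blast
      qed
      then show ?case by (rule a)
    qed
    then show ?thesis unfolding S_def by blast
  qed
  have least: "\<exists>a. ?s a u \<and> (\<forall>b. (b, a) \<in> R \<longrightarrow> \<not> ?s b u)" if "game_win A B u" for u
    using wfE_min[OF wf, of _ "{a. ?s a u}"] game_win_s[OF that] by (metis mem_Collect_eq)
  \<comment> \<open>\<open>le v z\<close> means that \<open>v\<close> is won no later than
    \<open>z\<close>, and \<open>L v z\<close> that it is won strictly earlier. A lost
    \<open>z\<close> counts as later than every won position.\<close>
  define le where "le v z \<longleftrightarrow> game_win A B v \<and> (\<forall>a. ?s a z \<longrightarrow> ?s a v)" for v z
  define L where "L v z \<longleftrightarrow> (\<exists>a. ?s a v \<and> \<not> ?s a z)" for v z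
  \<comment> \<open>As \<open>z\<close> is not yet won at some stage where \<open>v\<close> is,
    there is a challenge to \<open>z\<close> all of whose answers come no earlier than
    \<open>v\<close>. This expresses \<open>L\<close> through \<open>le\<close>, and only
    \<open>le\<close> is left to be decided.\<close>
  have L_iff: "L v z \<longleftrightarrow> game_win A B v \<and> (\<exists>g. A z g \<and> (\<forall>v2. B z g v2 \<longrightarrow> le v v2))" for v z
  proof
    assume "L v z"
    then obtain a where a: "?s a v" "\<not> ?s a z" unfolding L_def by blast
    then obtain g where g: "A z g" "\<And>v b. B z g v \<Longrightarrow> (b, a) \<in> R \<Longrightarrow> \<not> ?s b v"
      using stage.intros[of A z B a R] by blast
    have "?s b v" if "B z g v2" "?s b v2" for v2 b
      using g(2)[OF that(1)] that(2) tot[of a b] up a(1) by blast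
    then show "game_win A B v \<and> (\<exists>g. A z g \<and> (\<forall>v2. B z g v2 \<longrightarrow> le v v2))"
      using g(1) s_game_win[OF a(1)] unfolding le_def by blast
  next
    assume *: "game_win A B v \<and> (\<exists>g. A z g \<and> (\<forall>v2. B z g v2 \<longrightarrow> le v v2))"
    then obtain g where g: "A z g" "\<And>v2. B z g v2 \<Longrightarrow> le v v2" by blast
    obtain a where a: "?s a v" "\<And>b. (b, a) \<in> R \<Longrightarrow> \<not> ?s b v" using * least by blast
    have "\<not> ?s a z"
    proof
      assume "?s a z"
      then obtain v2 b where "B z g v2" "(b, a) \<in> R" "?s b v2" using sD g(1) by blast
      then show False using g(2) a(2) unfolding le_def by blast
    qed
    then show "L v z" using a(1) unfolding L_def by blast
  qed
  text \<open>The stage comparison is itself a least fixed point: positions \<open>npair 0 (npair v z)\<close> stand for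
    \<open>le v z\<close>, positions \<open>npair 1 (npair v (npair z g))\<close> for ``\<open>le v v2\<close> for all answers \<open>v2\<close> to \<open>g\<close>''.\<close>
  define A2 where "A2 q m \<longleftrightarrow> (nfst q = 0 \<and> A (nfst (nsnd q)) m) \<or>
    (nfst q \<noteq> 0 \<and> B (nfst (nsnd (nsnd q))) (nsnd (nsnd (nsnd q))) m)" for q m
  define B2 where "B2 q m x \<longleftrightarrow>
    (nfst q = 0 \<and> nfst x = 1 \<and> B (nfst (nsnd q)) m (nfst (nsnd x)) \<and> nfst (nsnd (nsnd x)) = nsnd (nsnd q) \<and>
      A (nsnd (nsnd q)) (nsnd (nsnd (nsnd x))) \<and> game_win A B (nfst (nsnd x))) \<or>
    (nfst q \<noteq> 0 \<and> x = npair 0 (npair (nfst (nsnd q)) m))" for q m x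
  have le1: "game_win A2 B2 q \<Longrightarrow> (nfst q = 0 \<longrightarrow> le (nfst (nsnd q)) (nsnd (nsnd q))) \<and>
      (nfst q \<noteq> 0 \<longrightarrow> (\<forall>v2. B (nfst (nsnd (nsnd q))) (nsnd (nsnd (nsnd q))) v2 \<longrightarrow> le (nfst (nsnd q)) v2))" for q
  proof (induction rule: game_win.induct)
    case (1 q)
    show ?case
    proof (intro conjI impI allI)
      assume q: "nfst q = 0"
      have ex: "\<exists>v. B (nfst (nsnd q)) g v \<and> L v (nsnd (nsnd q))" if "A (nfst (nsnd q)) g" for g
      proof -
        have "A2 q g" using that q by (simp add: A2_def)
        from 1[OF this] obtain x where x: "B2 q g x" "nfst x \<noteq> 0 \<longrightarrow> (\<forall>v2. B (nfst (nsnd (nsnd x))) (nsnd (nsnd (nsnd x))) v2 \<longrightarrow> le (nfst (nsnd x)) v2)"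
          by blast
        then have "L (nfst (nsnd x)) (nsnd (nsnd q))" unfolding L_iff using q by (auto simp: B2_def)
        then show ?thesis using x q by (auto simp: B2_def)
      qed
      have "game_win A B (nfst (nsnd q))" using ex L_iff by (metis game_win.intros)
      moreover have "?s a (nfst (nsnd q))" if az: "?s a (nsnd (nsnd q))" for a
      proof (rule stage.intros)
        fix g assume "A (nfst (nsnd q)) g"
        then obtain v where v: "B (nfst (nsnd q)) g v" "L v (nsnd (nsnd q))" using ex by blast
        then obtain b where b: "?s b v" "\<not> ?s b (nsnd (nsnd q))" unfolding L_def by blast
        then have "(b, a) \<in> R" using below az by blast
        then show "\<exists>v b. B (nfst (nsnd q)) g v \<and> (b, a) \<in> R \<and> ?s b v" using v(1) b(1) by blast
      qed
      ultimately show "le (nfst (nsnd q)) (nsnd (nsnd q))" unfolding le_def by blast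
    next
      fix v2 assume "nfst q \<noteq> 0" "B (nfst (nsnd (nsnd q))) (nsnd (nsnd (nsnd q))) v2"
      then have "A2 q v2" by (simp add: A2_def)
      from 1[OF this] show "le (nfst (nsnd q)) v2" using \<open>nfst q \<noteq> 0\<close> unfolding B2_def by auto
    qed
  qed
  have le2: "\<forall>z1 z2. ?s a z1 \<longrightarrow> le z1 z2 \<longrightarrow> game_win A2 B2 (npair 0 (npair z1 z2))" for a
  proof (induction a rule: wf_induct_rule[OF wf])
    case (1 a)
    show ?case
    proof (intro allI impI)
      fix z1 z2 assume s: "?s a z1" and le: "le z1 z2"
      \<comment> \<open>If \<open>z1\<close> is already won at an earlier stage, the induction
        hypothesis applies to the same pair. Otherwise \<open>a\<close> is the first stage of
        \<open>z1\<close>, and then \<open>z2\<close> is not won before \<open>a\<close>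
        either.\<close>
      show "game_win A2 B2 (npair 0 (npair z1 z2))"
      proof (cases "\<exists>b. (b, a) \<in> R \<and> ?s b z1")
        case True then show ?thesis using 1 le by blast
      next
        case False
        show ?thesis
        proof (rule game_win.intros)
          fix g assume "A2 (npair 0 (npair z1 z2)) g"
          then have "A z1 g" by (simp add: A2_def)
          then obtain v1 b where v1: "B z1 g v1" "(b, a) \<in> R" "?s b v1" using sD s by blast
          have "\<not> ?s b z2" using le False v1(2) unfolding le_def by blast
          then have "L v1 z2" using v1(3) unfolding L_def by blast
          then obtain g2 where g2: "A z2 g2" "\<And>v2. B z2 g2 v2 \<Longrightarrow> le v1 v2" unfolding L_iff by blast
          have "game_win A2 B2 (npair 1 (npair v1 (npair z2 g2)))"
          proof (rule game_win.intros)
            fix m assume "A2 (npair 1 (npair v1 (npair z2 g2))) m"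
            then have "B z2 g2 m" by (simp add: A2_def)
            then have "game_win A2 B2 (npair 0 (npair v1 m))" using g2(2) 1 v1 by blast
            then show "\<exists>v. B2 (npair 1 (npair v1 (npair z2 g2))) m v \<and> game_win A2 B2 v" by (auto simp: B2_def)
          qed
          moreover have "B2 (npair 0 (npair z1 z2)) g (npair 1 (npair v1 (npair z2 g2)))"
            using v1 g2(1) s_game_win by (simp add: B2_def)
          ultimately show "\<exists>v. B2 (npair 0 (npair z1 z2)) g v \<and> game_win A2 B2 v" by blast
        qed
      qed
    qed
  qed
  have le_iff: "le v z \<longleftrightarrow> game_win A2 B2 (npair 0 (npair v z))" for v z
  proof
    assume "le v z"
    moreover obtain a where "?s a v" using \<open>le v z\<close> game_win_s unfolding le_def by blast
    ultimately show "game_win A2 B2 (npair 0 (npair v z))" using le2 by blast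
  qed (use le1[of "npair 0 (npair v z)"] in simp)
  note tms = computable_fun_id computable_fun_const computable_fun_nfst computable_fun_nsnd computable_fun_npair
  have Y: "decidable (\<lambda>w. game_win A B)" using decidable_game_win[OF A B] .
  have "decidable (\<lambda>w z. A2 (nfst z) (nsnd z))" unfolding A2_def
    by (intro decidable_or decidable_and decidable_not decidable_eq decidable_app2[OF A] decidable_app3[OF B] tms)
  moreover have "decidable (\<lambda>w z. B2 (nfst z) (nfst (nsnd z)) (nsnd (nsnd z)))" unfolding B2_def
    by (intro decidable_or decidable_and decidable_not decidable_eq decidable_app2[OF A] decidable_app3[OF B] decidable_app1[OF Y] tms)
  ultimately have le2dec: "decidable (\<lambda>w. game_win A2 B2)" by (rule decidable_game_win)
  have "decidable (\<lambda>w z. L (nfst z) (nsnd z))" unfolding L_iff le_iff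
    by (intro decidable_and decidable_ex decidable_all decidable_imp decidable_app2[OF A] decidable_app3[OF B] decidable_app1[OF Y] decidable_app1[OF le2dec] tms)
  moreover have "\<exists>v. B z g v \<and> L v z" if zl: "game_win A B z" and zg: "A z g" for z g
  proof -
    obtain a where a: "?s a z" "\<And>b. (b, a) \<in> R \<Longrightarrow> \<not> ?s b z" using least[OF zl] by blast
    then show ?thesis using sD[OF a(1) zg] unfolding L_def by blast
  qed
  moreover have "P z" if P: "\<forall>z. game_win A B z \<longrightarrow> (\<forall>v. L v z \<longrightarrow> game_win A B v \<and> P v) \<longrightarrow> P z" and z: "game_win A B z" for P z
  proof -
    have "\<forall>z. ?s a z \<longrightarrow> P z" for a
    proof (induction a rule: wf_induct_rule[OF wf])
      case (1 a)
      show ?case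
      proof (intro allI impI)
        fix z assume z: "?s a z"
        have "game_win A B v \<and> P v" if "L v z" for v
          using that below[OF _ _ z] 1 s_game_win unfolding L_def by blast
        then show "P z" using P s_game_win[OF z] by blast
      qed
    qed
    then show ?thesis using game_win_s[OF z] by blast
  qed
  ultimately show ?thesis by blast
qed

text \<open>The language that is forced. Forcing needs a recursion on the formation of predicates,
  which \<open>decidable\<close>, speaking of programs, does not offer. With \<open>neg\<close> and
  \<open>lfp\<close> together a fixed point may occur negatively inside another one.\<close>

inductive definable :: "(nat set \<Rightarrow> nat \<Rightarrow> bool) \<Rightarrow> bool" where
  base: "decidable (\<lambda>w. Q) \<Longrightarrow> definable (\<lambda>w. Q)"
| orac: "definable (\<lambda>w u. u \<in> w)"
| neg: "definable R \<Longrightarrow> definable (\<lambda>w u. \<not> R w u)"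
| conj: "definable R \<Longrightarrow> definable R' \<Longrightarrow> definable (\<lambda>w u. R w u \<and> R' w u)"
| ex: "definable R \<Longrightarrow> definable (\<lambda>w u. \<exists>x. R w (npair x u))"
| sub: "definable R \<Longrightarrow> computable_fun f \<Longrightarrow> definable (\<lambda>w u. R w (f u))"
| lfp: "definable A \<Longrightarrow> definable B \<Longrightarrow> definable (\<lambda>w. game_win (\<lambda>u g. A w (npair u g)) (\<lambda>u g v. B w (npair u (npair g v))))"

text \<open>The transformation \<open>h\<close> of the oracle is allowed because a definable
  predicate will have to be evaluated on one half of a join.\<close>

lemma definable_decidable: "definable R \<Longrightarrow> decidable (\<lambda>w u. u \<in> h w) \<Longrightarrow> decidable (\<lambda>w. R (h w))"
proof (induction rule: definable.induct)
  case (ex R)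
  have "decidable (\<lambda>w z. R (h w) (npair (nfst z) (nsnd z)))" using ex by simp
  from decidable_ex[OF this] show ?case .
next
  case (lfp A B)
  then show ?case by (intro decidable_game_win) simp_all
qed (auto intro: decidable_not decidable_and decidable_subst)

text \<open>Cohen conditions as numbers: \<open>npair l s\<close> prescribes membership of the
  numbers below \<open>l\<close> by the binary digits of \<open>s\<close>. Digits from
  \<open>l\<close> on carry no information.\<close>

definition prefix_of :: "nat \<Rightarrow> nat set \<Rightarrow> bool" where
  "prefix_of p w \<longleftrightarrow> (\<forall>i<nfst p. i \<in> w \<longleftrightarrow> i \<in> set_decode (nsnd p))"

definition extends :: "nat \<Rightarrow> nat \<Rightarrow> bool" where
  "extends q p \<longleftrightarrow> nfst p \<le> nfst q \<and> (\<forall>i<nfst p. i \<in> set_decode (nsnd q) \<longleftrightarrow> i \<in> set_decode (nsnd p))"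

lemma extends_refl [simp]: "extends p p" by (simp add: extends_def)

lemma extends_trans: "extends r q \<Longrightarrow> extends q p \<Longrightarrow> extends r p" by (auto simp: extends_def)

lemma common_extends:
  assumes "prefix_of p w" "prefix_of q w"
  obtains r where "prefix_of r w" "extends r p" "extends r q"
proof -
  define l where "l = max (nfst p) (nfst q)"
  have "set_decode (set_encode (w \<inter> {..<l})) = w \<inter> {..<l}" by (simp add: set_encode_inverse)
  then show ?thesis
    using assms by (intro that[of "npair l (set_encode (w \<inter> {..<l}))"]) (auto simp: prefix_of_def extends_def l_def)
qed

definition dense :: "(nat \<Rightarrow> bool) \<Rightarrow> bool" where
  "dense Dn \<longleftrightarrow> (\<forall>p. \<exists>q. extends q p \<and> Dn q)"

text \<open>Only dense sets decidable without an oracle are to be met. These suffice for the truth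
  lemma, whose dense sets are built from decidable forcing relations, and c-randomness can provide
  them.\<close>

definition generic :: "nat set \<Rightarrow> bool" where
  "generic w \<longleftrightarrow> (\<forall>Dn. decidable (\<lambda>_. Dn) \<and> dense Dn \<longrightarrow> (\<exists>p. prefix_of p w \<and> Dn p))"

lemma decidable_bit: assumes "computable_fun f" "computable_fun g" shows "decidable (\<lambda>w u. f u \<in> set_decode (g u))"
proof -
  have "decidable (\<lambda>w u. nfst u = nsnd u + nsnd u \<or> nfst u = Suc (nsnd u + nsnd u))"
    by (intro decidable_or decidable_eq computable_fun_nfst computable_fun_add computable_fun_nsnd computable_fun_Suc computable_fun_id)
  then have "decidable (\<lambda>w u. nsnd u = nfst u div 2)" by (rule decidable_cong) auto
  then have h: "computable_fun (\<lambda>u. u div 2)" by (rule tmI)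
  have it: "((\<lambda>u. u div 2) ^^ n) x = x div 2 ^ n" for n and x :: nat
    by (induction n) (auto simp: div_mult2_eq power_commutes[symmetric])
  have "decidable (\<lambda>w u. \<exists>y. ((\<lambda>u. u div 2) ^^ (f u)) (g u) = Suc (y + y))"
    by (intro decidable_ex decidable_eq computable_fun_iter h computable_fun_Suc computable_fun_add computable_fun_nfst computable_fun_nsnd computable_fun_id computable_fun_comp[OF assms(1)] computable_fun_comp[OF assms(2)])
  moreover have "odd m \<longleftrightarrow> (\<exists>y. m = Suc (y + y))" for m :: nat by presburger
  ultimately show ?thesis unfolding set_decode_def it by simp
qed

lemma decidable_extends: assumes "computable_fun f" "computable_fun g" shows "decidable (\<lambda>w u. extends (f u) (g u))"
  unfolding extends_def less_eq_Suc_le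
  by (intro decidable_and decidable_le decidable_all decidable_imp decidable_iff decidable_bit computable_fun_Suc computable_fun_nfst computable_fun_nsnd computable_fun_id assms computable_fun_comp[OF assms(1)] computable_fun_comp[OF assms(2)])

text \<open>A set that is dense below \<open>p\<close> becomes dense when the conditions
  incompatible with \<open>p\<close> are added, and two prefixes of the same real are never
  incompatible.\<close>

lemma generic_below:
  assumes "generic w" "decidable (\<lambda>_. E)" "prefix_of p w" "\<And>q. extends q p \<Longrightarrow> \<exists>r. extends r q \<and> E r"
  obtains r where "prefix_of r w" "extends r p" "E r"
proof -
  define Dn where "Dn r \<longleftrightarrow> (extends r p \<and> E r) \<or> \<not> (\<exists>q. extends q r \<and> extends q p)" for r
  have "decidable (\<lambda>_. Dn)" unfolding Dn_def
    by (intro decidable_or decidable_and decidable_not decidable_ex decidable_extends assms computable_fun_id computable_fun_const computable_fun_nfst computable_fun_nsnd)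
  moreover have "dense Dn" unfolding dense_def Dn_def by (meson assms(4) extends_refl extends_trans)
  ultimately obtain r where r: "prefix_of r w" "Dn r" using assms(1) unfolding generic_def by blast
  obtain q where "extends q r" "extends q p" using common_extends[OF r(1) assms(3)] by blast
  then show ?thesis using r that unfolding Dn_def by blast
qed

definition forces :: "(nat set \<Rightarrow> nat \<Rightarrow> bool) \<Rightarrow> (nat \<Rightarrow> nat \<Rightarrow> bool) \<Rightarrow> bool" where
  "forces R F \<longleftrightarrow> decidable (\<lambda>_ z. F (nfst z) (nsnd z)) \<and> (\<forall>p q u. F p u \<longrightarrow> extends q p \<longrightarrow> F q u) \<and>
     (\<forall>w u. generic w \<longrightarrow> (R w u \<longleftrightarrow> (\<exists>p. prefix_of p w \<and> F p u)))"

lemma forcesI: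
  assumes "decidable (\<lambda>_ z. F (nfst z) (nsnd z))" "\<And>p q u. F p u \<Longrightarrow> extends q p \<Longrightarrow> F q u"
    "\<And>w u. generic w \<Longrightarrow> R w u \<Longrightarrow> \<exists>p. prefix_of p w \<and> F p u" "\<And>w u p. generic w \<Longrightarrow> prefix_of p w \<Longrightarrow> F p u \<Longrightarrow> R w u"
  shows "forces R F"
  using assms unfolding forces_def by blast

lemma forcesD:
  assumes "forces R F"
  shows "decidable (\<lambda>_ z. F (nfst z) (nsnd z))" "F p u \<Longrightarrow> extends q p \<Longrightarrow> F q u"
    "generic w \<Longrightarrow> R w u \<Longrightarrow> \<exists>p. prefix_of p w \<and> F p u" "generic w \<Longrightarrow> prefix_of p w \<Longrightarrow> F p u \<Longrightarrow> R w u"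
  using assms unfolding forces_def by blast+

lemma prefix_of_0: "prefix_of 0 w" by (simp add: prefix_of_def)

text \<open>Induction on the formation of \<open>R\<close>. Decidability, monotonicity and the truth
  lemma travel together: genericity yields the truth lemma only for dense sets whose decidability
  comes from the forcing relations of the parts.\<close>

lemma definable_forces: "definable R \<Longrightarrow> \<exists>F. forces R F"
proof (induction rule: definable.induct)
  case (base Q)
  have "decidable (\<lambda>_ z. Q (nsnd z))" using decidable_subst[OF base computable_fun_nsnd[OF computable_fun_id]] .
  then have "forces (\<lambda>w. Q) (\<lambda>p. Q)" using prefix_of_0 by (intro forcesI) blast+
  then show ?case by blast
next
  case orac
  have "forces (\<lambda>w u. u \<in> w) (\<lambda>p u. u < nfst p \<and> u \<in> set_decode (nsnd p))"
  proof (rule forcesI)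
    show "decidable (\<lambda>_ z. nsnd z < nfst (nfst z) \<and> nsnd z \<in> set_decode (nsnd (nfst z)))"
      unfolding less_eq_Suc_le by (intro decidable_and decidable_le decidable_bit computable_fun_Suc computable_fun_nfst computable_fun_nsnd computable_fun_id)
    fix w :: "nat set" and u assume "u \<in> w"
    then have "prefix_of (npair (Suc u) (set_encode (w \<inter> {..u}))) w \<and> u \<in> set_decode (set_encode (w \<inter> {..u}))"
      by (auto simp: prefix_of_def set_encode_inverse)
    then show "\<exists>p. prefix_of p w \<and> u < nfst p \<and> u \<in> set_decode (nsnd p)"
      by (intro exI[of _ "npair (Suc u) (set_encode (w \<inter> {..u}))"]) simp
  qed (auto simp: extends_def prefix_of_def)
  then show ?case by blast
next
  case (neg R)
  then obtain F where F: "forces R F" by blast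
  note f = forcesD[OF F]
  define N where "N p u \<longleftrightarrow> (\<forall>q. extends q p \<longrightarrow> \<not> F q u)" for p u
  have Ndec: "decidable (\<lambda>_ z. N (nfst z) (nsnd z))" unfolding N_def
    by (intro decidable_all decidable_imp decidable_not decidable_extends decidable_app2[OF f(1)] computable_fun_nfst computable_fun_nsnd computable_fun_id)
  have "forces (\<lambda>w u. \<not> R w u) N"
  proof (rule forcesI)
    fix w u assume w: "generic w" "\<not> R w u"
    define Dn where "Dn p \<longleftrightarrow> F p u \<or> N p u" for p
    have "decidable (\<lambda>_. Dn)" unfolding Dn_def
      by (intro decidable_or decidable_app2[OF f(1)] decidable_app2[OF Ndec] computable_fun_id computable_fun_const)
    moreover have "dense Dn" unfolding dense_def Dn_def N_def using extends_refl by blast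
    ultimately obtain p where "prefix_of p w" "Dn p" using w(1) unfolding generic_def by blast
    then show "\<exists>p. prefix_of p w \<and> N p u" using f(4)[OF w(1)] w(2) unfolding Dn_def by blast
  next
    fix w u p assume w: "generic w" "prefix_of p w" "N p u"
    show "\<not> R w u"
    proof
      assume "R w u"
      then obtain q where q: "prefix_of q w" "F q u" using f(3) w(1) by blast
      obtain r where "extends r p" "extends r q" using common_extends[OF w(2) q(1)] by blast
      then show False using w(3) f(2)[OF q(2)] unfolding N_def by blast
    qed
  qed (use Ndec extends_trans in \<open>auto simp: N_def; blast\<close>)+
  then show ?case by blast
next
  case (conj R R')
  then obtain F F' where F: "forces R F" "forces R' F'" by blast
  note f = forcesD[OF F(1)] and f' = forcesD[OF F(2)]
  have "forces (\<lambda>w u. R w u \<and> R' w u) (\<lambda>p u. F p u \<and> F' p u)"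
  proof (rule forcesI)
    show "decidable (\<lambda>_ z. F (nfst z) (nsnd z) \<and> F' (nfst z) (nsnd z))" by (intro decidable_and f(1) f'(1))
    fix w u assume w: "generic w" "R w u \<and> R' w u"
    then obtain p q where p: "prefix_of p w" "F p u" and q: "prefix_of q w" "F' q u" using f(3) f'(3) by blast
    obtain r where "prefix_of r w" "extends r p" "extends r q" using common_extends[OF p(1) q(1)] by blast
    then show "\<exists>p. prefix_of p w \<and> F p u \<and> F' p u" using f(2)[OF p(2)] f'(2)[OF q(2)] by blast
  qed (use f(2,4) f'(2,4) in blast)+
  then show ?case by blast
next
  case (ex R)
  then obtain F where F: "forces R F" by blast
  note f = forcesD[OF F]
  have "forces (\<lambda>w u. \<exists>x. R w (npair x u)) (\<lambda>p u. \<exists>x. F p (npair x u))"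
  proof (rule forcesI)
    show "decidable (\<lambda>_ z. \<exists>x. F (nfst z) (npair x (nsnd z)))"
      by (intro decidable_ex decidable_app2[OF f(1)] computable_fun_npair computable_fun_nfst computable_fun_nsnd computable_fun_id)
  qed (use f(2,3,4) in blast)+
  then show ?case by blast
next
  case (sub R t)
  then obtain F where F: "forces R F" by blast
  note f = forcesD[OF F]
  have "forces (\<lambda>w u. R w (t u)) (\<lambda>p u. F p (t u))"
  proof (rule forcesI)
    show "decidable (\<lambda>_ z. F (nfst z) (t (nsnd z)))"
      by (intro decidable_app2[OF f(1)] computable_fun_nfst computable_fun_nsnd computable_fun_id computable_fun_comp[OF sub(2)])
  qed (use f(2,3,4) in blast)+
  then show ?case by blast
next
  case (lfp A B)
  then obtain FA FB where FA: "forces A FA" and FB: "forces B FB" by blast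
  note a = forcesD[OF FA] and b = forcesD[OF FB]
  text \<open>A position is a condition paired with a position of the original game; each player may
    strengthen the condition along with the move.\<close>
  define A' where "A' z g \<longleftrightarrow> extends (nfst g) (nfst z) \<and> FA (nfst g) (npair (nsnd z) (nsnd g))" for z g
  define B' where "B' z g v \<longleftrightarrow> extends (nfst v) (nfst g) \<and> FB (nfst v) (npair (nsnd z) (npair (nsnd g) (nsnd v)))" for z g v
  define Y where "Y p u \<longleftrightarrow> game_win A' B' (npair p u)" for p u
  have A'dec: "decidable (\<lambda>_ z. A' (nfst z) (nsnd z))" unfolding A'_def
    by (intro decidable_and decidable_extends decidable_app2[OF a(1)] computable_fun_npair computable_fun_nfst computable_fun_nsnd computable_fun_id)
  have B'dec: "decidable (\<lambda>_ z. B' (nfst z) (nfst (nsnd z)) (nsnd (nsnd z)))" unfolding B'_def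
    by (intro decidable_and decidable_extends decidable_app2[OF b(1)] computable_fun_npair computable_fun_nfst computable_fun_nsnd computable_fun_id)
  have "decidable (\<lambda>_ u. game_win A' B' u)" using decidable_game_win[OF A'dec B'dec] .
  then have Ydec: "decidable (\<lambda>_ z. Y (nfst z) (nsnd z))" unfolding Y_def by simp
  have Yiff: "Y p u \<longleftrightarrow> (\<forall>q g. extends q p \<and> FA q (npair u g) \<longrightarrow>
     (\<exists>q' v. extends q' q \<and> FB q' (npair u (npair g v)) \<and> Y q' v))" for p u
  proof
    assume "Y p u"
    then have "game_win A' B' (npair p u)" by (simp add: Y_def)
    then show "\<forall>q g. extends q p \<and> FA q (npair u g) \<longrightarrow> (\<exists>q' v. extends q' q \<and> FB q' (npair u (npair g v)) \<and> Y q' v)"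
    proof cases
      case 1
      show ?thesis
      proof (intro allI impI)
        fix q g assume "extends q p \<and> FA q (npair u g)"
        then have "A' (npair p u) (npair q g)" by (simp add: A'_def)
        from 1[OF this] obtain v where "B' (npair p u) (npair q g) v" "game_win A' B' v" by blast
        then show "\<exists>q' v. extends q' q \<and> FB q' (npair u (npair g v)) \<and> Y q' v"
          by (intro exI[of _ "nfst v"] exI[of _ "nsnd v"]) (auto simp: B'_def Y_def)
      qed
    qed
  next
    assume r: "\<forall>q g. extends q p \<and> FA q (npair u g) \<longrightarrow> (\<exists>q' v. extends q' q \<and> FB q' (npair u (npair g v)) \<and> Y q' v)"
    have "game_win A' B' (npair p u)"
    proof (rule game_win.intros)
      fix g assume "A' (npair p u) g"
      then obtain q' v where "extends q' (nfst g)" "FB q' (npair u (npair (nsnd g) v))" "Y q' v"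
        using r unfolding A'_def by force
      then show "\<exists>v. B' (npair p u) g v \<and> game_win A' B' v"
        by (intro exI[of _ "npair q' v"]) (auto simp: B'_def Y_def)
    qed
    then show "Y p u" by (simp add: Y_def)
  qed
  have Ymono: "Y p u \<Longrightarrow> extends q p \<Longrightarrow> Y q u" for p q u
    unfolding Yiff[of p] Yiff[of q] using extends_trans by blast
  have "forces (\<lambda>w. game_win (\<lambda>u g. A w (npair u g)) (\<lambda>u g v. B w (npair u (npair g v)))) Y"
  proof (rule forcesI[OF Ydec Ymono])
    fix w u assume w: "generic w" and l: "game_win (\<lambda>u g. A w (npair u g)) (\<lambda>u g v. B w (npair u (npair g v))) u"
    from l show "\<exists>p. prefix_of p w \<and> Y p u"
    proof (induction rule: game_win.induct)
      case (1 u)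
      show ?case
      proof (rule ccontr)
        assume no: "\<not> (\<exists>p. prefix_of p w \<and> Y p u)"
        define N where "N p \<longleftrightarrow> (\<forall>q. extends q p \<longrightarrow> \<not> Y q u)" for p
        define Dn where "Dn p \<longleftrightarrow> Y p u \<or> N p" for p
        have "decidable (\<lambda>_. Dn)" unfolding Dn_def N_def
          by (intro decidable_or decidable_all decidable_imp decidable_not decidable_extends decidable_app2[OF Ydec] computable_fun_id computable_fun_const computable_fun_nfst computable_fun_nsnd)
        moreover have "dense Dn" unfolding dense_def Dn_def N_def using extends_refl by blast
        ultimately obtain p where p: "prefix_of p w" "N p" using w no unfolding generic_def Dn_def by blast
        \<comment> \<open>Below a condition with no winning extension every condition can be
          strengthened to one that forces some challenge \<open>g\<close> and admits no winning
          answer. Genericity finds such a prefix of \<open>w\<close>; the answer that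
          \<open>g\<close> has in \<open>w\<close>, won by induction hypothesis, then gives a
          contradiction.\<close>
        define E where "E q \<longleftrightarrow> (\<exists>g. FA q (npair u g) \<and>
          (\<forall>q' v. extends q' q \<longrightarrow> FB q' (npair u (npair g v)) \<longrightarrow> \<not> Y q' v))" for q
        have "decidable (\<lambda>_. E)" unfolding E_def
          by (intro decidable_ex decidable_and decidable_all decidable_imp decidable_not decidable_extends decidable_app2[OF Ydec] decidable_app2[OF a(1)]
              decidable_app2[OF b(1)] computable_fun_id computable_fun_const computable_fun_nfst computable_fun_nsnd computable_fun_npair)
        moreover have "\<exists>r. extends r q \<and> E r" if "extends q p" for q
        proof -
          have "\<not> Y q u" using p(2) that unfolding N_def by blast
          then show ?thesis unfolding Yiff[of q u] E_def by blast
        qed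
        ultimately obtain q where q: "prefix_of q w" "extends q p" "E q" using generic_below[OF w _ p(1)] by blast
        then obtain g where g: "FA q (npair u g)" "\<And>q' v. extends q' q \<Longrightarrow> FB q' (npair u (npair g v)) \<Longrightarrow> \<not> Y q' v"
          unfolding E_def by blast
        have "A w (npair u g)" using a(4)[OF w q(1) g(1)] .
        then obtain v p1 where v: "B w (npair u (npair g v))" "prefix_of p1 w" "Y p1 v" using "1.IH" by blast
        obtain q1 where q1: "prefix_of q1 w" "FB q1 (npair u (npair g v))" using b(3)[OF w v(1)] by blast
        obtain r1 where r1: "prefix_of r1 w" "extends r1 q" "extends r1 p1" using common_extends[OF q(1) v(2)] by blast
        obtain r where r: "extends r r1" "extends r q1" using common_extends[OF r1(1) q1(1)] by blast
        have "Y r v" using Ymono[OF v(3)] extends_trans r r1 by blast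
        then show False using g(2)[of r v] b(2)[OF q1(2) r(2)] extends_trans r r1 by blast
      qed
    qed
  next
    fix w u p assume w: "generic w" and p: "prefix_of p w" "Y p u"
    obtain L where Ldec: "decidable (\<lambda>_ z. L (nfst z) (nsnd z))"
      and L: "\<And>z g. game_win A' B' z \<Longrightarrow> A' z g \<Longrightarrow> \<exists>v. B' z g v \<and> L v z"
      and ind: "\<And>P. \<forall>z. game_win A' B' z \<longrightarrow> (\<forall>v. L v z \<longrightarrow> game_win A' B' v \<and> P v) \<longrightarrow> P z \<Longrightarrow> \<forall>z. game_win A' B' z \<longrightarrow> P z"
      using stage_order[OF A'dec B'dec] by blast
    let ?l = "game_win (\<lambda>u g. A w (npair u g)) (\<lambda>u g v. B w (npair u (npair g v)))"
    have "\<forall>z. game_win A' B' z \<longrightarrow> prefix_of (nfst z) w \<longrightarrow> ?l (nsnd z)"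
    proof (rule ind, intro allI impI)
      fix z assume z: "game_win A' B' z" "\<forall>v. L v z \<longrightarrow> game_win A' B' v \<and> (prefix_of (nfst v) w \<longrightarrow> ?l (nsnd v))" "prefix_of (nfst z) w"
      show "?l (nsnd z)"
      proof (rule game_win.intros)
        fix g assume "A w (npair (nsnd z) g)"
        then obtain q0 where q0: "prefix_of q0 w" "FA q0 (npair (nsnd z) g)" using a(3)[OF w] by blast
        obtain q where q: "prefix_of q w" "extends q (nfst z)" "extends q q0" using common_extends[OF z(3) q0(1)] by blast
        \<comment> \<open>Conditions that force an answer of lower rank. The winning strategy makes
          \<open>E\<close> dense below \<open>q\<close>, and decidability of \<open>L\<close> makes
          it a set that \<open>w\<close> must meet. The answer found is won because it lies below a
          won position in \<open>L\<close>.\<close>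
        define E where "E r \<longleftrightarrow> (\<exists>v. FB r (npair (nsnd z) (npair g v)) \<and> L (npair r v) z)" for r
        have "decidable (\<lambda>_. E)" unfolding E_def
          by (intro decidable_ex decidable_and decidable_app2[OF Ldec] decidable_app2[OF b(1)] computable_fun_id computable_fun_const computable_fun_nfst computable_fun_nsnd computable_fun_npair)
        moreover have "\<exists>r. extends r q1 \<and> E r" if "extends q1 q" for q1
        proof -
          have "A' z (npair q1 g)" using a(2)[OF q0(2)] extends_trans that q unfolding A'_def npair_simps by blast
          from L[OF z(1) this] obtain v where "B' z (npair q1 g) v" "L v z" by blast
          then show ?thesis unfolding E_def B'_def
            by (intro exI[of _ "nfst v"]) (auto intro!: exI[of _ "nsnd v"])
        qed
        ultimately obtain r where r: "prefix_of r w" "E r" using generic_below[OF w _ q(1)] by blast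
        then obtain v where "FB r (npair (nsnd z) (npair g v))" "L (npair r v) z" unfolding E_def by blast
        then show "\<exists>v. B w (npair (nsnd z) (npair g v)) \<and> ?l v"
          using b(4)[OF w r(1)] z(2) r(1) by (intro exI[of _ v]) (metis npair_simps(1,2))
      qed
    qed
    then show "game_win (\<lambda>u g. A w (npair u g)) (\<lambda>u g v. B w (npair u (npair g v))) u"
      using p unfolding Y_def by (metis npair_simps(1,2))
  qed
  then show ?case by blast
qed

section \<open>Runs as iterated inductive definitions\<close>

text \<open>Derivability from rules with possibly infinitely many premises: \<open>g\<close> names a
  rule with conclusion \<open>u\<close>, and \<open>B u g v\<close> makes \<open>v\<close> a premise
  of it. Compared with \<open>game_win\<close> the two quantifiers are exchanged.\<close>

inductive derivable :: "(nat \<Rightarrow> nat \<Rightarrow> bool) \<Rightarrow> (nat \<Rightarrow> nat \<Rightarrow> nat \<Rightarrow> bool) \<Rightarrow> nat \<Rightarrow> bool" for A B where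
  "A u g \<Longrightarrow> (\<And>v. B u g v \<Longrightarrow> derivable A B v) \<Longrightarrow> derivable A B u"

text \<open>Vectors are nested pairs. Codes are not unique, as only finitely many coordinates will
  matter, and 0 codes the zero vector, which serves as the trivial lower bound.\<close>

definition coord :: "nat \<Rightarrow> nat \<Rightarrow> nat" where "coord t x = nfst ((nsnd ^^ t) x)"

lemma coord_0 [simp]: "coord t 0 = 0"
proof -
  have "(nsnd ^^ t) 0 = 0" by (induction t) auto
  then show ?thesis by (simp add: coord_def)
qed

lemma coord_npair: "coord 0 (npair a x) = a" "coord (Suc t) (npair a x) = coord t x"
  by (simp_all add: coord_def funpow_Suc_right del: funpow.simps)

lemma coord_surj: "\<exists>x. \<forall>t<n. coord t x = f t"
proof (induction n arbitrary: f)
  case (Suc n)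
  obtain x where x: "\<forall>t<n. coord t x = f (Suc t)" using Suc[of "\<lambda>t. f (Suc t)"] by blast
  have "coord t (npair (f 0) x) = f t" if "t < Suc n" for t
    using that x by (cases t) (auto simp: coord_npair)
  then show ?case by blast
qed simp

definition above :: "nat \<Rightarrow> nat \<Rightarrow> nat \<Rightarrow> bool" where
  "above n x b \<longleftrightarrow> (\<forall>t<n. coord t b \<le> coord t x)"

text \<open>The rules generating the facts reachable before the next wild limit of the next level:
  \<open>npair 0 (npair x (npair b y))\<close> is the fact ``\<open>x\<close> runs to \<open>y\<close> while staying above \<open>b\<close>'',
  \<open>npair (Suc j) (npair x (npair b 0))\<close> says that \<open>x\<close> has a chain of \<open>j\<close> further returns to the bound \<open>b\<close>,
  the return number \<open>j\<close> being a return of the component \<open>nfst j\<close>.\<close>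

definition rule_applies where
  "rule_applies n E u g \<longleftrightarrow> (let k = nfst u; x = nfst (nsnd u); b = nfst (nsnd (nsnd u)); y = nsnd (nsnd (nsnd u)); z = nsnd g in
     (k = 0 \<and> nfst g = 0 \<and> E x b y) \<or> (k = 0 \<and> nfst g = 1) \<or> (k = 0 \<and> nfst g = 2 \<and> above n y b) \<or>
     (k = 1 \<and> nfst g = 0) \<or> (2 \<le> k \<and> nfst g = 1 \<and> (\<forall>t<n. nfst (k - 2) = t \<longrightarrow> coord t z = coord t b)))"

definition rule_premise where
  "rule_premise u g v \<longleftrightarrow> (let k = nfst u; x = nfst (nsnd u); b = nfst (nsnd (nsnd u)); y = nsnd (nsnd (nsnd u)); z = nsnd g in
     (k = 0 \<and> nfst g = 1 \<and> (v = npair 0 (npair x (npair b z)) \<or> v = npair 0 (npair z (npair b y)))) \<or>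
     (k = 0 \<and> nfst g = 2 \<and> (\<exists>j. v = npair (Suc j) (npair x (npair y 0)))) \<or>
     (2 \<le> k \<and> nfst g = 1 \<and> (v = npair 0 (npair x (npair b z)) \<or> v = npair (k - 1) (npair z (npair b 0)))))"

definition Fact where "Fact n E x b y \<longleftrightarrow> derivable (rule_applies n E) rule_premise (npair 0 (npair x (npair b y)))"
definition Chain where "Chain n E x b j \<longleftrightarrow> derivable (rule_applies n E) rule_premise (npair (Suc j) (npair x (npair b 0)))"

lemma Fact_E: "E x b y \<Longrightarrow> Fact n E x b y"
  unfolding Fact_def by (rule derivable.intros[of _ _ "npair 0 0"]) (auto simp: rule_applies_def rule_premise_def)

lemma Fact_trans: "Fact n E x b z \<Longrightarrow> Fact n E z b y \<Longrightarrow> Fact n E x b y"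
  unfolding Fact_def by (rule derivable.intros[of _ _ "npair 1 z"]) (auto simp: rule_applies_def rule_premise_def)

lemma Fact_tame: "above n y b \<Longrightarrow> (\<And>j. Chain n E x y j) \<Longrightarrow> Fact n E x b y"
  unfolding Fact_def Chain_def by (rule derivable.intros[of _ _ "npair 2 0"]) (auto simp: rule_applies_def rule_premise_def)

lemma Chain_0: "Chain n E x b 0"
  unfolding Chain_def by (rule derivable.intros[of _ _ "npair 0 0"]) (auto simp: rule_applies_def rule_premise_def)

lemma Chain_Suc: "Fact n E x b z \<Longrightarrow> (nfst j < n \<Longrightarrow> coord (nfst j) z = coord (nfst j) b) \<Longrightarrow> Chain n E z b j \<Longrightarrow>
    Chain n E x b (Suc j)"
  unfolding Fact_def Chain_def by (rule derivable.intros[of _ _ "npair 1 z"]) (auto simp: rule_applies_def rule_premise_def)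

text \<open>Simultaneous induction on facts and chains with the coding of the rules removed;
  \<open>C\<close> is the companion statement about chains.\<close>

lemma Fact_induct:
  assumes F: "Fact n E x b y"
    and E: "\<And>x b y. E x b y \<Longrightarrow> P x b y"
    and trans: "\<And>x b y z. P x b z \<Longrightarrow> P z b y \<Longrightarrow> P x b y"
    and tame: "\<And>x b y. above n y b \<Longrightarrow> (\<And>j. C x y j) \<Longrightarrow> P x b y"
    and C0: "\<And>x b. C x b 0"
    and CS: "\<And>x b z j. P x b z \<Longrightarrow> (nfst j < n \<Longrightarrow> coord (nfst j) z = coord (nfst j) b) \<Longrightarrow> C z b j \<Longrightarrow> C x b (Suc j)"
  shows "P x b y"
proof -
  have "derivable (rule_applies n E) rule_premise u \<Longrightarrow> (nfst u = 0 \<longrightarrow> P (nfst (nsnd u)) (nfst (nsnd (nsnd u))) (nsnd (nsnd (nsnd u)))) \<and>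
    (nfst u \<noteq> 0 \<longrightarrow> C (nfst (nsnd u)) (nfst (nsnd (nsnd u))) (nfst u - 1))" for u
  proof (induction rule: derivable.induct)
    case (1 u g)
    let ?k = "nfst u" and ?x = "nfst (nsnd u)" and ?b = "nfst (nsnd (nsnd u))" and ?y = "nsnd (nsnd (nsnd u))" and ?z = "nsnd g"
    have IHP: "rule_premise u g (npair 0 (npair x' (npair b' y'))) \<Longrightarrow> P x' b' y'" for x' b' y' using 1(3)[of "npair 0 (npair x' (npair b' y'))"] by simp
    have IHC: "rule_premise u g (npair (Suc j) (npair x' (npair b' 0))) \<Longrightarrow> C x' b' j" for x' b' j using 1(3)[of "npair (Suc j) (npair x' (npair b' 0))"] by simp
    from 1(1) consider "?k = 0" "nfst g = 0" "E ?x ?b ?y" | "?k = 0" "nfst g = 1" | "?k = 0" "nfst g = 2" "above n ?y ?b"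
      | "?k = 1" | "2 \<le> ?k" "nfst g = 1" "\<forall>t<n. nfst (?k - 2) = t \<longrightarrow> coord t ?z = coord t ?b"
      unfolding rule_applies_def Let_def by (elim disjE conjE) simp_all
    then show ?case
    proof cases
      case 1 then show ?thesis using E by simp
    next
      case 2
      have "P ?x ?b ?z" by (rule IHP) (use 2 in \<open>simp add: rule_premise_def\<close>)
      moreover have "P ?z ?b ?y" by (rule IHP) (use 2 in \<open>simp add: rule_premise_def\<close>)
      ultimately show ?thesis using 2 trans by simp
    next
      case 3
      have "C ?x ?y j" for j by (rule IHC) (use 3 in \<open>auto simp: rule_premise_def\<close>)
      then show ?thesis using 3 tame by simp
    next
      case 4 then show ?thesis using C0 by simp
    next
      case 5
      define j where "j = ?k - 2"
      have k: "?k = Suc (Suc j)" using 5(1) by (simp add: j_def)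
      have "P ?x ?b ?z" by (rule IHP) (use 5 in \<open>simp add: rule_premise_def\<close>)
      moreover have "C ?z ?b j" by (rule IHC) (use 5 k in \<open>simp add: rule_premise_def\<close>)
      ultimately show ?thesis using 5(3) CS[of ?x ?b ?z j] k by (simp add: j_def[symmetric])
    qed
  qed
  from this[of "npair 0 (npair x (npair b y))"] show ?thesis using F by (simp add: Fact_def)
qed

section \<open>Levels of facts, and the wild limits of a halting run\<close>

definition reach where "reach F x z \<longleftrightarrow> z = x \<or> F x 0 z"

definition liminf_le where
  "liminf_le F x t m \<longleftrightarrow> (\<forall>z. reach F x z \<longrightarrow> (\<exists>z'. reach F z z' \<and> coord t z' \<le> m))" for F :: "nat \<Rightarrow> nat \<Rightarrow> nat \<Rightarrow> bool"

text \<open>The configuration at the next wild limit, read off from everything reachable before it.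
  The clause \<open>coord 0 z < H\<close> says that no halting configuration is reachable, which
  guarantees that there is a further wild limit at all.\<close>

definition limit_jump where
  "limit_jump H n F x b y \<longleftrightarrow> (\<forall>z. reach F x z \<longrightarrow> coord 0 z < H \<and> above n z b) \<and> above n y b \<and>
     (\<forall>t<n. (liminf_le F x t (coord t y) \<and> (\<forall>m. liminf_le F x t m \<longrightarrow> coord t y \<le> m)) \<or>
            (coord t y = 0 \<and> (\<forall>m. \<not> liminf_le F x t m)))"

definition step_jump where
  "step_jump H n N x b y \<longleftrightarrow> coord 0 x < H \<and> above n x b \<and> above n y b \<and> (\<forall>t<n. coord t y = N (\<lambda>t. coord t x) t)"

text \<open>Level \<open>k\<close> describes segments that meet no wild limit of level
  \<open>k\<close>. Every time counts as being of level 0, so level 0 has no segments, and the jump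
  that leads to level 1 is the successor step.\<close>

primrec level_fact where
  "level_fact H n N 0 = (\<lambda>x b y. False)"
| "level_fact H n N (Suc k) = Fact n (\<lambda>x b y. level_fact H n N k x b y \<or>
     (if k = 0 then step_jump H n N else limit_jump H n (level_fact H n N k)) x b y)"

text \<open>A halting run seen through its first \<open>n\<close> components: component 0 is the
  line, \<open>H\<close> the number of lines, \<open>mu\<close> the halting time, \<open>N\<close>
  the successor step on vectors. The last assumption restates the liminf rule without
  \<open>LEAST\<close>.\<close>

locale halting_line =
  fixes lt :: "'a \<Rightarrow> 'a \<Rightarrow> bool" and T :: "'a set" and V :: "'a \<Rightarrow> nat \<Rightarrow> nat" and mu :: 'a
    and H n :: nat and N :: "(nat \<Rightarrow> nat) \<Rightarrow> nat \<Rightarrow> nat"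
  assumes ltT: "lt a b \<Longrightarrow> a \<in> T \<and> b \<in> T"
    and tr: "lt a b \<Longrightarrow> lt b d \<Longrightarrow> lt a d"
    and irr: "\<not> lt a a"
    and tot: "a \<in> T \<Longrightarrow> b \<in> T \<Longrightarrow> lt a b \<or> a = b \<or> lt b a"
    and wf: "wf {(a, b). lt a b}"
    and mu: "mu \<in> T" "\<not> lt mu a"
    and n: "n > 0"
    and halt: "a \<in> T \<Longrightarrow> V a 0 < H \<longleftrightarrow> a \<noteq> mu"
    and suc: "lt b a \<Longrightarrow> \<not> (\<exists>d. lt b d \<and> lt d a) \<Longrightarrow> t < n \<Longrightarrow> V a t = N (V b) t"
    and Ncong: "(\<And>t. t < n \<Longrightarrow> v t = v' t) \<Longrightarrow> v 0 < H \<Longrightarrow> t < n \<Longrightarrow> N v t = N v' t"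
    and limit: "lt b a \<Longrightarrow> (\<And>b. lt b a \<Longrightarrow> \<exists>d. lt b d \<and> lt d a) \<Longrightarrow> t < n \<Longrightarrow>
       (\<forall>m. (\<forall>b. lt b a \<longrightarrow> (\<exists>d. lt b d \<and> lt d a \<and> V d t \<le> m)) \<longrightarrow>
          (\<forall>b. lt b a \<longrightarrow> (\<exists>d. lt b d \<and> lt d a \<and> V d t \<le> V a t)) \<and> V a t \<le> m) \<and>
       ((\<forall>m. \<exists>b. lt b a \<and> (\<forall>d. lt b d \<longrightarrow> lt d a \<longrightarrow> m < V d t)) \<longrightarrow> V a t = 0)"
begin

definition lim :: "'a \<Rightarrow> bool" where
  "lim a \<longleftrightarrow> (\<exists>b. lt b a) \<and> (\<forall>b. lt b a \<longrightarrow> (\<exists>d. lt b d \<and> lt d a))"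

definition cofinal_le :: "'a \<Rightarrow> nat \<Rightarrow> nat \<Rightarrow> bool" where
  "cofinal_le a t m \<longleftrightarrow> (\<forall>b. lt b a \<longrightarrow> (\<exists>d. lt b d \<and> lt d a \<and> V d t \<le> m))"

definition wild_coords :: "'a \<Rightarrow> nat set" where "wild_coords a = {t. t < n \<and> (\<forall>m. \<not> cofinal_le a t m)}"

definition wild :: "'a \<Rightarrow> bool" where "wild a \<longleftrightarrow> lim a \<and> wild_coords a \<noteq> {}"

primrec wild_level :: "nat \<Rightarrow> 'a \<Rightarrow> bool" where
  "wild_level 0 a \<longleftrightarrow> a \<in> T"
| "wild_level (Suc k) a \<longleftrightarrow> wild a \<and> (\<forall>b. lt b a \<longrightarrow> (\<exists>d. lt b d \<and> lt d a \<and> wild_level k d))"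

lemma lim_cofinal_le: "lim a \<Longrightarrow> t < n \<Longrightarrow> cofinal_le a t m \<Longrightarrow> cofinal_le a t (V a t) \<and> V a t \<le> m"
  using limit[of _ a t] unfolding lim_def cofinal_le_def by blast

lemma lim_wild: "lim a \<Longrightarrow> t \<in> wild_coords a \<Longrightarrow> V a t = 0"
  using limit[of _ a t] unfolding lim_def cofinal_le_def wild_coords_def by (auto simp: not_le) (metis not_le)

lemma wild_level_antimono: "wild_level (Suc k) a \<Longrightarrow> wild_level k a"
proof (induction k arbitrary: a)
  case 0 then show ?case unfolding wild_level.simps wild_def lim_def using ltT by blast
qed (meson wild_level.simps(2))

lemma wild_level_wild: "wild_level k a \<Longrightarrow> k > 0 \<Longrightarrow> wild a" by (cases k) auto

lemma least: "P a \<Longrightarrow> \<exists>a. P a \<and> (\<forall>b. lt b a \<longrightarrow> \<not> P b)"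
  using wfE_min[OF wf, of a "{a. P a}"] by auto

lemma eventually_max:
  assumes "lim a" "finite I" "\<And>i. i \<in> I \<Longrightarrow> \<exists>b. lt b a \<and> (\<forall>d. lt b d \<longrightarrow> lt d a \<longrightarrow> Q i d)"
  shows "\<exists>b. lt b a \<and> (\<forall>i\<in>I. \<forall>d. lt b d \<longrightarrow> lt d a \<longrightarrow> Q i d)"
  using assms(2,3)
proof (induction I rule: finite_induct)
  case empty then show ?case using assms(1) unfolding lim_def by auto
next
  case (insert i I)
  then obtain b where b: "lt b a" "\<forall>i\<in>I. \<forall>d. lt b d \<longrightarrow> lt d a \<longrightarrow> Q i d" by auto
  obtain b' where b': "lt b' a" "\<forall>d. lt b' d \<longrightarrow> lt d a \<longrightarrow> Q i d" using insert.prems[of i] by auto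
  show ?case using tot[of b b'] ltT b b' tr by (metis insert_iff)
qed

lemma wild_coords_disjoint:
  assumes "wild a"
  shows "\<exists>b. lt b a \<and> (\<forall>d. lt b d \<longrightarrow> lt d a \<longrightarrow> wild d \<longrightarrow> wild_coords d \<inter> wild_coords a = {})"
proof -
  have "\<exists>b. lt b a \<and> (\<forall>t\<in>wild_coords a. \<forall>d. lt b d \<longrightarrow> lt d a \<longrightarrow> 0 < V d t)"
  proof (rule eventually_max)
    show "lim a" "finite (wild_coords a)" using assms by (auto simp: wild_def wild_coords_def)
    fix t assume "t \<in> wild_coords a"
    then have "\<not> cofinal_le a t 0" by (simp add: wild_coords_def)
    then show "\<exists>b. lt b a \<and> (\<forall>d. lt b d \<longrightarrow> lt d a \<longrightarrow> 0 < V d t)" unfolding cofinal_le_def by auto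
  qed
  then show ?thesis using lim_wild unfolding wild_def by (metis disjoint_iff less_irrefl)
qed

text \<open>Descending through nested levels, \<open>U\<close> collects the diverging components of
  the limits passed so far. Each level adds a nonempty set disjoint from \<open>U\<close>, so
  \<open>k + card U\<close> is at most \<open>n\<close>; the time \<open>b\<close> records how close
  to the outer limits the inner ones must lie for this.\<close>

lemma wild_level_bound: "\<not> wild_level (Suc n) a"
proof -
  have "wild_level k a \<Longrightarrow> U \<subseteq> {..<n} \<Longrightarrow> lt b a \<or> k = 0 \<Longrightarrow> (\<And>d. lt b d \<Longrightarrow> lt d a \<or> d = a \<Longrightarrow> wild d \<Longrightarrow> wild_coords d \<inter> U = {}) \<Longrightarrow>
      k + card U \<le> n" for k U b
  proof (induction k arbitrary: a U b)
    case 0 then show ?case using card_mono[of "{..<n}" U] by simp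
  next
    case (Suc k)
    then have w: "wild a" and b: "lt b a" by auto
    obtain b1 where b1: "lt b1 a" "\<And>d. lt b1 d \<Longrightarrow> lt d a \<Longrightarrow> wild d \<Longrightarrow> wild_coords d \<inter> wild_coords a = {}"
      using wild_coords_disjoint[OF w] by blast
    obtain b2 where b2: "lt b2 a" "b2 = b \<or> lt b b2" "b2 = b1 \<or> lt b1 b2"
      using tot[of b b1] ltT b b1(1) by blast
    obtain d where d: "lt b2 d" "lt d a" "wild_level k d" using Suc.prems(1) b2(1) by auto
    have "k + card (U \<union> wild_coords a) \<le> n"
    proof (rule Suc.IH[OF d(3), of _ b2])
      show "U \<union> wild_coords a \<subseteq> {..<n}" using Suc.prems(2) by (auto simp: wild_coords_def)
      fix e assume e: "lt b2 e" "lt e d \<or> e = d" "wild e"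
      then have "lt b e" "lt b1 e" "lt e a" using b2 d tr by blast+
      then show "wild_coords e \<inter> (U \<union> wild_coords a) = {}" using Suc.prems(4)[of e] b1(2)[of e] e(3) by blast
    qed (use d in blast)
    moreover have "wild_coords a \<inter> U = {}" using Suc.prems(4)[of a] b w by blast
    moreover have "finite U" "finite (wild_coords a)" using Suc.prems(2) finite_subset by (auto simp: wild_coords_def)
    moreover have "card (wild_coords a) > 0" using w \<open>finite (wild_coords a)\<close> by (simp add: wild_def card_gt_0_iff)
    ultimately show ?case by (simp add: card_Un_disjoint Int_commute)
  qed
  from this[of "Suc n" "{}"] show ?thesis unfolding wild_level.simps wild_def lim_def
    by (metis (no_types, lifting) Int_empty_right card.empty empty_subsetI not_less_eq_eq add_0_right le_refl wild_level.simps(2) wild_def lim_def)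
qed

definition codes :: "nat \<Rightarrow> 'a \<Rightarrow> bool" where "codes x a \<longleftrightarrow> a \<in> T \<and> (\<forall>t<n. coord t x = V a t)"
definition bounded_by :: "'a \<Rightarrow> nat \<Rightarrow> bool" where "bounded_by a b \<longleftrightarrow> (\<forall>t<n. coord t b \<le> V a t)"

text \<open>The end \<open>a'\<close> is required not to be wild of level \<open>k\<close>, but the
  start \<open>a\<close> is not: so segments compose, and a segment may start at the very wild limit
  where a jump has ended.\<close>

definition tame_segment :: "nat \<Rightarrow> 'a \<Rightarrow> 'a \<Rightarrow> nat \<Rightarrow> bool" where
  "tame_segment k a a' b \<longleftrightarrow> lt a a' \<and> bounded_by a b \<and> bounded_by a' b \<and> (\<forall>d. lt a d \<longrightarrow> lt d a' \<longrightarrow> bounded_by d b) \<and>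
     (\<forall>d. lt a d \<longrightarrow> lt d a' \<or> d = a' \<longrightarrow> \<not> wild_level k d)"

definition next_wild :: "nat \<Rightarrow> 'a \<Rightarrow> 'a \<Rightarrow> nat \<Rightarrow> bool" where
  "next_wild k a a' b \<longleftrightarrow> lt a a' \<and> bounded_by a b \<and> bounded_by a' b \<and> (\<forall>d. lt a d \<longrightarrow> lt d a' \<longrightarrow> bounded_by d b \<and> \<not> wild_level k d) \<and> wild_level k a'"

lemma codes_ex: "a \<in> T \<Longrightarrow> \<exists>x. codes x a"
  using coord_surj[of n "V a"] by (auto simp: codes_def)

lemma codes_above: "codes x a \<Longrightarrow> above n x b \<longleftrightarrow> bounded_by a b"
  by (simp add: codes_def above_def bounded_by_def)

lemma bounded_by_0: "bounded_by a 0" by (simp add: bounded_by_def)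

text \<open>The same vector may occur at several times. Soundness is demanded from each of them,
  which is possible because the future of a run depends only on its present configuration.\<close>

definition exact_fact :: "nat \<Rightarrow> (nat \<Rightarrow> nat \<Rightarrow> nat \<Rightarrow> bool) \<Rightarrow> bool" where
  "exact_fact k F \<longleftrightarrow> (\<forall>x b y a. F x b y \<longrightarrow> codes x a \<longrightarrow> (\<exists>a'. codes y a' \<and> tame_segment k a a' b)) \<and>
     (\<forall>x b y a a'. codes x a \<longrightarrow> codes y a' \<longrightarrow> tame_segment k a a' b \<longrightarrow> F x b y)"

definition exact_jump :: "nat \<Rightarrow> (nat \<Rightarrow> nat \<Rightarrow> nat \<Rightarrow> bool) \<Rightarrow> bool" where
  "exact_jump k F \<longleftrightarrow> (\<forall>x b y a. F x b y \<longrightarrow> codes x a \<longrightarrow> (\<exists>a'. codes y a' \<and> next_wild k a a' b)) \<and>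
     (\<forall>x b y a a'. codes x a \<longrightarrow> codes y a' \<longrightarrow> next_wild k a a' b \<longrightarrow> F x b y)"


lemma exact_fact_D:
  assumes "exact_fact k F"
  shows "F x b y \<Longrightarrow> codes x a \<Longrightarrow> \<exists>a'. codes y a' \<and> tame_segment k a a' b"
    "codes x a \<Longrightarrow> codes y a' \<Longrightarrow> tame_segment k a a' b \<Longrightarrow> F x b y"
  using assms unfolding exact_fact_def by simp_all

lemma exact_jump_D:
  assumes "exact_jump k F"
  shows "F x b y \<Longrightarrow> codes x a \<Longrightarrow> \<exists>a'. codes y a' \<and> next_wild k a a' b"
    "codes x a \<Longrightarrow> codes y a' \<Longrightarrow> next_wild k a a' b \<Longrightarrow> F x b y"
  using assms unfolding exact_jump_def by simp_all

primrec chain :: "nat \<Rightarrow> nat \<Rightarrow> nat \<Rightarrow> 'a \<Rightarrow> bool" where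
  "chain k b 0 a \<longleftrightarrow> True"
| "chain k b (Suc j) a \<longleftrightarrow> (\<exists>a'. tame_segment k a a' b \<and> (nfst j < n \<longrightarrow> V a' (nfst j) = coord (nfst j) b) \<and> chain k b j a')"

lemma tame_segment_trans: "tame_segment k a e b \<Longrightarrow> tame_segment k e a' b \<Longrightarrow> tame_segment k a a' b"
proof -
  assume 1: "tame_segment k a e b" and 2: "tame_segment k e a' b"
  have d: "lt d e \<or> d = e \<or> lt e d" if "lt a d" for d
    using tot[of d e] ltT that 1 unfolding tame_segment_def by blast
  show ?thesis unfolding tame_segment_def
  proof (intro conjI allI impI)
    show "lt a a'" using 1 2 tr unfolding tame_segment_def by blast
    show "bounded_by d b" if "lt a d" "lt d a'" for d using d[OF that(1)] that 1 2 unfolding tame_segment_def by blast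
    show "\<not> wild_level k d" if "lt a d" "lt d a' \<or> d = a'" for d using d[OF that(1)] that 1 2 unfolding tame_segment_def by blast
  qed (use 1 2 in \<open>auto simp: tame_segment_def\<close>)
qed

lemma tame_segment_left: "tame_segment k a a' b \<Longrightarrow> lt a e \<Longrightarrow> lt e a' \<Longrightarrow> tame_segment k a e b"
  unfolding tame_segment_def using tr by blast

lemma tame_segment_right: "tame_segment k a a' b \<Longrightarrow> lt a e \<Longrightarrow> lt e a' \<Longrightarrow> tame_segment k e a' b"
  unfolding tame_segment_def using tr by blast

lemma chain_tame_segment: "tame_segment k e d b \<Longrightarrow> chain k b j d \<Longrightarrow> chain k b j e"
  by (cases j) (auto intro: tame_segment_trans)

lemma chain_le: "chain k b j d \<Longrightarrow> i \<le> j \<Longrightarrow> chain k b i d"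
proof (induction j)
  case (Suc j)
  have "chain k b j d" using Suc.prems(1) chain_tame_segment by auto
  then show ?case using Suc by (cases "i = Suc j") auto
qed simp

text \<open>Let \<open>D\<close> be the first time after \<open>a\<close> at which chains of some
  length are missing or which is wild of level \<open>k\<close>; it exists because nothing follows
  the halting time. Before \<open>D\<close> all chains exist, so each component returns to its bound
  cofinally below \<open>D\<close> and never falls under it. Hence the vector at \<open>D\<close> is
  \<open>y\<close>, and \<open>D\<close> is not wild.\<close>

lemma tame_limit:
  assumes full: "\<And>j. chain k y j a" and k: "k > 0"
  shows "\<exists>a'. codes y a' \<and> tame_segment k a a' y"
proof -
  have aT: "a \<in> T" using full[of 1] ltT unfolding tame_segment_def by (auto simp: tame_segment_def)
  have nomu: "\<not> chain k y 1 mu" using mu by (auto simp: tame_segment_def)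
  then have "a \<noteq> mu" using full by blast
  then have "lt a mu" using tot[OF aT mu(1)] mu(2) by blast
  then have "lt a mu \<and> ((\<exists>j. \<not> chain k y j mu) \<or> wild_level k mu)" using nomu by blast
  from least[where P="\<lambda>d. lt a d \<and> ((\<exists>j. \<not> chain k y j d) \<or> wild_level k d)", OF this]
  obtain D where D: "lt a D" "(\<exists>j. \<not> chain k y j D) \<or> wild_level k D"
    and lst: "\<And>e. lt e D \<Longrightarrow> lt a e \<Longrightarrow> (\<forall>j. chain k y j e) \<and> \<not> wild_level k e" by blast
  have hit: "\<exists>a'. lt e a' \<and> lt a' D \<and> (t < n \<longrightarrow> V a' t = coord t y) \<and> bounded_by e y"
    if e: "e = a \<or> lt a e" "lt e D" for e t
  proof -
    have fe: "chain k y j e" for j using e lst full by blast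
    from D(2) show ?thesis
    proof
      assume "\<exists>j. \<not> chain k y j D"
      then obtain j0 where j0: "\<not> chain k y j0 D" by blast
      \<comment> \<open>Return number \<open>npair t j0\<close> is a return of component
        \<open>t\<close>. After it a chain of length \<open>j\<close> remains, which is too long to
        exist from \<open>D\<close> on, so the return happens before \<open>D\<close>.\<close>
      define j where "j = npair t j0"
      have j: "nfst j = t" "j0 \<le> j" by (auto simp: j_def) (simp add: npair_def le_prod_encode_2)
      obtain a' where a': "tame_segment k e a' y" "t < n \<longrightarrow> V a' t = coord t y" "chain k y j a'"
        using fe[of "Suc j"] j(1) by auto
      have "\<not> chain k y j D" using chain_le j0 j(2) by blast
      then have "\<not> lt D a'" "a' \<noteq> D" using a' chain_tame_segment tame_segment_right[OF a'(1) e(2)] by blast+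
      then have "lt a' D" using tot[of a' D] ltT a'(1) D(1) unfolding tame_segment_def by blast
      then show ?thesis using a' unfolding tame_segment_def by blast
    next
      assume w: "wild_level k D"
      obtain a' where a': "tame_segment k e a' y" "t < n \<longrightarrow> V a' t = coord t y"
        using fe[of "Suc (npair t 0)"] by auto
      have "\<not> lt D a'" "a' \<noteq> D" using a'(1) w e(2) unfolding tame_segment_def by blast+
      then have "lt a' D" using tot[of a' D] ltT a'(1) D(1) unfolding tame_segment_def by blast
      then show ?thesis using a' unfolding tame_segment_def by blast
    qed
  qed
  have hit': "\<exists>a'. lt e a' \<and> lt a' D \<and> (t < n \<longrightarrow> V a' t = coord t y)" if e: "lt e D" for e t
  proof (cases "e = a \<or> lt a e")
    case True then show ?thesis using hit e by blast
  next
    case False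
    then have "lt e a" using tot[of e a] ltT e D(1) by blast
    then show ?thesis using hit[of a t] D(1) tr by blast
  qed
  have limD: "lim D" unfolding lim_def using D(1) hit' by blast
  have c: "cofinal_le D t (coord t y)" if "t < n" for t unfolding cofinal_le_def using hit' that by (metis order_refl)
  have geD: "bounded_by e y" if "e = a \<or> lt a e" "lt e D" for e using hit[OF that, of 0] by blast
  have VD: "V D t = coord t y" if t: "t < n" for t
  proof (rule antisym)
    have 1: "cofinal_le D t (V D t)" "V D t \<le> coord t y" using lim_cofinal_le[OF limD t c[OF t]] by auto
    then show "V D t \<le> coord t y" by blast
    obtain d where "lt a d" "lt d D" "V d t \<le> V D t" using 1(1) D(1) unfolding cofinal_le_def by blast
    then show "coord t y \<le> V D t" using geD[of d] t unfolding bounded_by_def by fastforce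
  qed
  have "codes y D" using VD ltT D(1) unfolding codes_def by auto
  moreover have "\<not> wild_level k D" using wild_level_wild[OF _ k] c unfolding wild_def wild_coords_def by blast
  moreover have "bounded_by D y" using VD by (simp add: bounded_by_def)
  ultimately show ?thesis unfolding tame_segment_def using D(1) lst geD by blast
qed

text \<open>Completeness goes by induction on the end \<open>a'\<close>. If the times of level
  \<open>k\<close> are bounded below \<open>a'\<close>, the remaining piece is a fact or a jump of
  level \<open>k\<close>. If they are cofinal, \<open>a'\<close> is a limit and, not being of level
  \<open>k + 1\<close>, tame; from some time on every component stays at or above its limit value
  and keeps returning to it, and the chains for the tame rule are built from shorter
  segments.\<close>

lemma exact_fact_Suc:
  assumes J: "exact_jump k J" and F: "exact_fact k F"
  shows "exact_fact (Suc k) (Fact n (\<lambda>x b y. F x b y \<or> J x b y))"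
proof -
  let ?E = "\<lambda>x b y. F x b y \<or> J x b y"
  have nw: "\<not> wild_level (Suc k) d" if "\<not> wild_level k d" for d using that wild_level_antimono by blast
  have sF: "tame_segment k a a' b \<Longrightarrow> tame_segment (Suc k) a a' b" for a a' b
    unfolding tame_segment_def using nw by blast
  have sJ: "tame_segment (Suc k) a a' b" if "next_wild k a a' b" for a a' b
  proof -
    have "\<not> wild_level (Suc k) a'" using that unfolding next_wild_def wild_level.simps by blast
    then show ?thesis using that nw unfolding next_wild_def tame_segment_def by blast
  qed
  have sound: "\<forall>a. codes x a \<longrightarrow> (\<exists>a'. codes y a' \<and> tame_segment (Suc k) a a' b)" if "Fact n ?E x b y" for x b y
  proof (rule Fact_induct[OF that, where C="\<lambda>x b j. \<forall>a. codes x a \<longrightarrow> chain (Suc k) b j a"])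
    fix x b y assume "?E x b y"
    then show "\<forall>a. codes x a \<longrightarrow> (\<exists>a'. codes y a' \<and> tame_segment (Suc k) a a' b)"
      using exact_jump_D(1)[OF J] exact_fact_D(1)[OF F] sF sJ by blast
  next
    fix x b y z assume "\<forall>a. codes x a \<longrightarrow> (\<exists>a'. codes z a' \<and> tame_segment (Suc k) a a' b)"
      "\<forall>a. codes z a \<longrightarrow> (\<exists>a'. codes y a' \<and> tame_segment (Suc k) a a' b)"
    then show "\<forall>a. codes x a \<longrightarrow> (\<exists>a'. codes y a' \<and> tame_segment (Suc k) a a' b)" using tame_segment_trans by blast
  next
    fix x b y assume g: "above n y b" and c: "\<And>j. \<forall>a. codes x a \<longrightarrow> chain (Suc k) y j a"
    show "\<forall>a. codes x a \<longrightarrow> (\<exists>a'. codes y a' \<and> tame_segment (Suc k) a a' b)"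
    proof (intro allI impI)
      fix a assume "codes x a"
      then obtain a' where a': "codes y a'" "tame_segment (Suc k) a a' y" using tame_limit[of "Suc k" y a] c by blast
      have "bounded_by d y \<Longrightarrow> bounded_by d b" for d using g unfolding bounded_by_def above_def by (meson le_trans)
      then have "tame_segment (Suc k) a a' b" using a'(2) unfolding tame_segment_def by blast
      then show "\<exists>a'. codes y a' \<and> tame_segment (Suc k) a a' b" using a'(1) by blast
    qed
  next
    fix x b z j assume 1: "\<forall>a. codes x a \<longrightarrow> (\<exists>a'. codes z a' \<and> tame_segment (Suc k) a a' b)"
      and 2: "nfst j < n \<Longrightarrow> coord (nfst j) z = coord (nfst j) b" and 3: "\<forall>a. codes z a \<longrightarrow> chain (Suc k) b j a"
    show "\<forall>a. codes x a \<longrightarrow> chain (Suc k) b (Suc j) a"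
    proof (intro allI impI)
      fix a assume "codes x a"
      then obtain a' where a': "codes z a'" "tame_segment (Suc k) a a' b" using 1 by blast
      then have "nfst j < n \<longrightarrow> V a' (nfst j) = coord (nfst j) b" using 2 unfolding codes_def by metis
      then show "chain (Suc k) b (Suc j) a" using a' 3 by auto
    qed
  qed simp
  have complete: "\<forall>a x b y. codes x a \<longrightarrow> codes y a' \<longrightarrow> tame_segment (Suc k) a a' b \<longrightarrow> Fact n ?E x b y" for a'
  proof (induction a' rule: wf_induct_rule[OF wf])
    case (1 a')
    have IH: "Fact n ?E x b y" if "lt d a'" "codes x a" "codes y d" "tame_segment (Suc k) a d b" for d a x b y
      using 1 that by blast
    show ?case
    proof (intro allI impI)
      fix a x b y assume x: "codes x a" and y: "codes y a'" and s: "tame_segment (Suc k) a a' b"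
      have aa': "lt a a'" using s by (simp add: tame_segment_def)
      \<comment> \<open>The derivation may start from any \<beta> between \<open>a\<close> and
        \<open>a'\<close>: the stretch from \<open>a\<close> to \<beta> is covered by the induction
        hypothesis.\<close>
      have jn: "Fact n ?E x b y"
        if \<beta>: "\<beta> = a \<or> lt a \<beta>" "lt \<beta> a'" "\<And>z. codes z \<beta> \<Longrightarrow> Fact n ?E z b y" for \<beta>
      proof (cases "\<beta> = a")
        case True then show ?thesis using \<beta>(3) x by blast
      next
        case False
        obtain z where z: "codes z \<beta>" using codes_ex ltT \<beta>(2) by blast
        have "tame_segment (Suc k) a \<beta> b" using False \<beta> tame_segment_left[OF s] by blast
        then show ?thesis using Fact_trans IH[OF \<beta>(2) x z] \<beta>(3)[OF z] by blast
      qed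
      show "Fact n ?E x b y"
      proof (cases "\<exists>\<beta>. (\<beta> = a \<or> lt a \<beta>) \<and> lt \<beta> a' \<and> (\<forall>d. lt \<beta> d \<longrightarrow> lt d a' \<longrightarrow> \<not> wild_level k d)")
        case True
        then obtain \<beta> where \<beta>: "\<beta> = a \<or> lt a \<beta>" "lt \<beta> a'" "\<And>d. lt \<beta> d \<Longrightarrow> lt d a' \<Longrightarrow> \<not> wild_level k d" by blast
        have s\<beta>: "tame_segment (Suc k) \<beta> a' b" using \<beta> s tame_segment_right[OF s] by blast
        show ?thesis
        proof (rule jn[OF \<beta>(1,2)])
          fix z assume z: "codes z \<beta>"
          have "?E z b y"
          proof (cases "wild_level k a'")
            case True
            then have "next_wild k \<beta> a' b" using s\<beta> \<beta>(3) unfolding next_wild_def tame_segment_def by blast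
            then show ?thesis using exact_jump_D(2)[OF J z y] by blast
          next
            case False
            then have "tame_segment k \<beta> a' b" using s\<beta> \<beta>(3) unfolding tame_segment_def by blast
            then show ?thesis using exact_fact_D(2)[OF F z y] by blast
          qed
          then show "Fact n ?E z b y" by (rule Fact_E)
        qed
      next
        case False
        have dn: "\<exists>d. lt e d \<and> lt d a' \<and> wild_level k d" if "lt e a'" for e
        proof (cases "e = a \<or> lt a e")
          case True then show ?thesis using False that by blast
        next
          case ea: False
          then have "lt e a" using tot[of e a] ltT that aa' by blast
          then show ?thesis using False aa' tr by blast
        qed
        have lima: "lim a'" unfolding lim_def using dn aa' by blast
        have "\<not> wild_level (Suc k) a'" using s aa' unfolding tame_segment_def by blast
        then have "\<not> wild a'" using dn by auto
        then have c: "cofinal_le a' t (V a' t)" "\<And>m. cofinal_le a' t m \<Longrightarrow> V a' t \<le> m" if "t < n" for t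
          using lim_cofinal_le[OF lima that] lima that unfolding wild_def wild_coords_def by blast+
        have yV: "coord t y = V a' t" if "t < n" for t using y that by (simp add: codes_def)
        have "\<exists>b0. lt b0 a' \<and> (\<forall>t\<in>{..<n}. \<forall>d. lt b0 d \<longrightarrow> lt d a' \<longrightarrow> coord t y \<le> V d t)"
        proof (rule eventually_max[OF lima])
          fix t assume t: "t \<in> {..<n}"
          show "\<exists>b. lt b a' \<and> (\<forall>d. lt b d \<longrightarrow> lt d a' \<longrightarrow> coord t y \<le> V d t)"
          proof (cases "V a' t")
            case 0 then show ?thesis using t yV aa' by (intro exI[of _ a]) auto
          next
            case (Suc m)
            then have "\<not> cofinal_le a' t m" using c(2)[of t m] t by auto
            then show ?thesis unfolding cofinal_le_def using Suc t yV by (auto simp: Suc_le_eq not_le)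
          qed
        qed simp
        then obtain b0 where b0: "lt b0 a'" "\<And>t d. t < n \<Longrightarrow> lt b0 d \<Longrightarrow> lt d a' \<Longrightarrow> coord t y \<le> V d t" by blast
        have "\<exists>\<beta>. lt a \<beta> \<and> lt b0 \<beta> \<and> lt \<beta> a'"
          using tot[of a b0] ltT b0(1) aa' dn tr by metis
        then obtain \<beta> where \<beta>: "lt a \<beta>" "lt b0 \<beta>" "lt \<beta> a'" by blast
        have ge: "bounded_by d y" if "d = \<beta> \<or> lt \<beta> d" "lt d a'" for d
          using b0(2) that \<beta> tr unfolding bounded_by_def by blast
        have ch: "\<forall>e z. (e = \<beta> \<or> lt \<beta> e) \<longrightarrow> lt e a' \<longrightarrow> codes z e \<longrightarrow> Chain n ?E z y j" for j
        proof (induction j)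
          case 0 then show ?case using Chain_0 by blast
        next
          case (Suc j)
          show ?case
          proof (intro allI impI)
            fix e z assume e: "e = \<beta> \<or> lt \<beta> e" "lt e a'" "codes z e"
            have "\<exists>d. lt e d \<and> lt d a' \<and> (nfst j < n \<longrightarrow> V d (nfst j) \<le> V a' (nfst j))"
              using c(1)[of "nfst j"] dn e(2) unfolding cofinal_le_def by blast
            then obtain d where d: "lt e d" "lt d a'" "nfst j < n \<longrightarrow> V d (nfst j) \<le> V a' (nfst j)" by blast
            have d\<beta>: "lt \<beta> d" using e(1) d(1) tr by blast
            obtain z' where z': "codes z' d" using codes_ex ltT d(1) by blast
            have "nfst j < n \<Longrightarrow> coord (nfst j) z' = coord (nfst j) y"
              using d(3) b0(2)[of "nfst j" d] \<beta> d(2) d\<beta> tr yV z' unfolding codes_def by (metis antisym)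
            moreover have "tame_segment (Suc k) e d y"
            proof -
              have "lt a e" using e(1) \<beta>(1) tr by blast
              then have "\<not> wild_level (Suc k) f" if "lt e f" "lt f d \<or> f = d" for f
                using s that d tr unfolding tame_segment_def by blast
              moreover have "bounded_by f y" if "lt e f" "lt f d" for f using ge[of f] e(1) that d(2) tr by blast
              moreover have "bounded_by e y" "bounded_by d y" using ge e d d\<beta> by blast+
              ultimately show ?thesis unfolding tame_segment_def using d(1) by blast
            qed
            then have "Fact n ?E z y z'" using IH[OF d(2) e(3) z'] by blast
            moreover have "Chain n ?E z' y j" using Suc d\<beta> d(2) z' by blast
            ultimately show "Chain n ?E z y (Suc j)" using Chain_Suc by blast
          qed
        qed
        have "above n y b" using codes_above[OF y] s by (simp add: tame_segment_def)
        then show ?thesis using ch \<beta> by (intro jn[of \<beta>] Fact_tame) blast+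
      qed
    qed
  qed
  show ?thesis unfolding exact_fact_def using sound complete by blast
qed

lemma exact_jump_0: "exact_jump 0 (step_jump H n N)"
  unfolding exact_jump_def
proof (intro conjI allI impI)
  fix x b y a assume J: "step_jump H n N x b y" and x: "codes x a"
  have V0: "V a 0 < H" using J x n by (simp add: step_jump_def codes_def)
  have aT: "a \<in> T" using x by (simp add: codes_def)
  have "lt a mu" using halt[OF aT] V0 tot[OF aT mu(1)] mu(2) by blast
  from least[where P="lt a", OF this] obtain a' where a': "lt a a'" "\<And>d. lt d a' \<Longrightarrow> \<not> lt a d" by blast
  have "coord t y = V a' t" if t: "t < n" for t
  proof -
    have "coord t y = N (\<lambda>t. coord t x) t" using J t by (simp add: step_jump_def)
    also have "\<dots> = N (V a) t" by (rule Ncong) (use x J n t in \<open>auto simp: codes_def step_jump_def\<close>)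
    also have "\<dots> = V a' t" using suc[OF a'(1) _ t] a'(2) by (metis (no_types))
    finally show ?thesis .
  qed
  then have y: "codes y a'" using ltT a'(1) by (auto simp: codes_def)
  have "bounded_by a b" "bounded_by a' b" using J codes_above[OF x] codes_above[OF y] by (auto simp: step_jump_def)
  then have "next_wild 0 a a' b" unfolding next_wild_def using a' ltT by auto
  then show "\<exists>a'. codes y a' \<and> next_wild 0 a a' b" using y by blast
next
  fix x b y a a' assume x: "codes x a" and y: "codes y a'" and w: "next_wild 0 a a' b"
  have la: "lt a a'" "\<not> (\<exists>d. lt a d \<and> lt d a')" using w ltT unfolding next_wild_def by auto
  have "a \<noteq> mu" using la(1) mu by blast
  then have V0: "V a 0 < H" using halt x by (simp add: codes_def)
  have "coord t y = N (\<lambda>t. coord t x) t" if t: "t < n" for t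
  proof -
    have "N (\<lambda>t. coord t x) t = N (V a) t" by (rule Ncong) (use x V0 n t in \<open>auto simp: codes_def\<close>)
    then show ?thesis using suc[OF la t] y t by (simp add: codes_def)
  qed
  moreover have "coord 0 x < H" using V0 x n by (simp add: codes_def)
  ultimately show "step_jump H n N x b y"
    unfolding step_jump_def using codes_above[OF x] codes_above[OF y] w by (simp add: next_wild_def)
qed

text \<open>Let \<open>D\<close> be the next wild limit of level \<open>k\<close>. Every time from
  \<open>a\<close> up to \<open>D\<close> has a reachable code, and every reachable code belongs to
  such a time. So statements about reachable codes are statements about the times cofinal below
  \<open>D\<close>.\<close>

lemma exact_jump_Suc:
  assumes F: "exact_fact k F" and k: "k > 0"
  shows "exact_jump k (limit_jump H n F)"
proof -
  have r1: "\<exists>z. codes z e \<and> reach F x z" if xa: "codes x a" "e = a \<or> lt a e" "\<forall>d. lt a d \<longrightarrow> lt d e \<or> d = e \<longrightarrow> \<not> wild_level k d" for x a e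
  proof (cases "e = a")
    case True then show ?thesis using xa by (auto simp: reach_def)
  next
    case False
    then have ae: "lt a e" using xa by blast
    obtain z where z: "codes z e" using codes_ex ltT ae by blast
    have "tame_segment k a e 0" unfolding tame_segment_def using ae xa bounded_by_0 by blast
    then show ?thesis using exact_fact_D(2)[OF F xa(1) z] z unfolding reach_def by blast
  qed
  have r2: "\<exists>e. (e = a \<or> lt a e) \<and> lt e D \<and> codes z e"
    if xa: "codes x a" and z: "reach F x z" and D: "lt a D" "wild_level k D" for x a z D
  proof (cases "z = x")
    case True then show ?thesis using xa D by blast
  next
    case False
    then obtain e where e: "codes z e" "tame_segment k a e 0" using exact_fact_D(1)[OF F _ xa] z unfolding reach_def by blast
    then have "\<not> lt D e" "D \<noteq> e" using D unfolding tame_segment_def by blast+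
    then have "lt e D" using tot[of e D] ltT e D unfolding tame_segment_def by blast
    then show ?thesis using e unfolding tame_segment_def by blast
  qed
  have liminf_le: "liminf_le F x t m \<longleftrightarrow> cofinal_le D t m"
    if x: "codes x a" and D: "lt a D" "wild_level k D" "\<And>d. lt a d \<Longrightarrow> lt d D \<Longrightarrow> \<not> wild_level k d" and t: "t < n" for x a D t m
  proof
    have limD: "lim D" using wild_level_wild[OF D(2) k] by (simp add: wild_def)
    assume l: "liminf_le F x t m"
    show "cofinal_le D t m" unfolding cofinal_le_def
    proof (intro allI impI)
      fix b assume b: "lt b D"
      have "\<exists>e. lt a e \<and> lt b e \<and> lt e D"
        using tot[of a b] ltT b D(1) limD tr unfolding lim_def by metis
      then obtain e where e: "lt a e" "lt b e" "lt e D" by blast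
      then obtain z where z: "codes z e" "reach F x z" using r1[OF x, of e] D(3) tr by blast
      then obtain z' where z': "reach F z z'" "coord t z' \<le> m" using l unfolding liminf_le_def by blast
      then obtain d where d: "d = e \<or> lt e d" "lt d D" "codes z' d" using r2[OF z(1) z'(1) e(3) D(2)] by blast
      then have "V d t \<le> m" using z'(2) t by (simp add: codes_def)
      then show "\<exists>d. lt b d \<and> lt d D \<and> V d t \<le> m" using d e tr by blast
    qed
  next
    assume c: "cofinal_le D t m"
    show "liminf_le F x t m" unfolding liminf_le_def
    proof (intro allI impI)
      fix z assume "reach F x z"
      then obtain e where e: "e = a \<or> lt a e" "lt e D" "codes z e" using r2[OF x _ D(1,2)] by blast
      then obtain d where d: "lt e d" "lt d D" "V d t \<le> m" using c unfolding cofinal_le_def by blast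
      have "\<forall>f. lt e f \<longrightarrow> lt f d \<or> f = d \<longrightarrow> \<not> wild_level k f" using D(3) e(1) d(2) tr by blast
      then obtain z' where "codes z' d" "reach F z z'" using r1[OF e(3), of d] d(1) by blast
      then show "\<exists>z'. reach F z z' \<and> coord t z' \<le> m" using d(3) t by (auto simp: codes_def)
    qed
  qed
  show ?thesis unfolding exact_jump_def
  proof (intro conjI allI impI)
    fix x b y a assume J: "limit_jump H n F x b y" and x: "codes x a"
    have aT: "a \<in> T" using x by (simp add: codes_def)
    \<comment> \<open>Without a further wild limit of level \<open>k\<close>, the halting
      configuration itself would be reachable, which the jump forbids.\<close>
    have "\<exists>D. lt a D \<and> wild_level k D"
    proof (rule ccontr)
      assume no: "\<not> ?thesis"
      have "mu = a \<or> lt a mu" using tot[OF aT mu(1)] mu(2) by blast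
      then obtain z where z: "codes z mu" "reach F x z" using r1[OF x, of mu] no by blast
      then have "V mu 0 < H" using J n by (auto simp: limit_jump_def codes_def)
      then show False using halt[OF mu(1)] by blast
    qed
    then obtain D where "lt a D \<and> wild_level k D" by blast
    from least[where P="\<lambda>D. lt a D \<and> wild_level k D", OF this]
    obtain D where D: "lt a D" "wild_level k D" "\<And>d. lt a d \<Longrightarrow> lt d D \<Longrightarrow> \<not> wild_level k d" by blast
    have lv: "liminf_le F x t m \<longleftrightarrow> cofinal_le D t m" if "t < n" for t m
      by (rule liminf_le[OF x D(1,2) _ that]) (rule D(3))
    have limD: "lim D" using wild_level_wild[OF D(2) k] by (simp add: wild_def)
    have "coord t y = V D t" if t: "t < n" for t
    proof -
      have "(liminf_le F x t (coord t y) \<and> (\<forall>m. liminf_le F x t m \<longrightarrow> coord t y \<le> m)) \<or> (coord t y = 0 \<and> (\<forall>m. \<not> liminf_le F x t m))"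
        using J t unfolding limit_jump_def by simp
      then have "(cofinal_le D t (coord t y) \<and> (\<forall>m. cofinal_le D t m \<longrightarrow> coord t y \<le> m)) \<or> (coord t y = 0 \<and> (\<forall>m. \<not> cofinal_le D t m))"
        unfolding lv[OF t] .
      then show ?thesis
      proof
        assume *: "cofinal_le D t (coord t y) \<and> (\<forall>m. cofinal_le D t m \<longrightarrow> coord t y \<le> m)"
        then show ?thesis using lim_cofinal_le[OF limD t] by (meson antisym)
      next
        assume "coord t y = 0 \<and> (\<forall>m. \<not> cofinal_le D t m)"
        then show ?thesis using lim_wild[OF limD, of t] t by (simp add: wild_coords_def)
      qed
    qed
    then have y: "codes y D" using ltT D(1) by (auto simp: codes_def)
    have ge: "bounded_by e b" if e: "e = a \<or> lt a e" "lt e D" for e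
    proof -
      obtain z where z: "codes z e" "reach F x z" using r1[OF x e(1)] D(3) e(2) tr by blast
      then show ?thesis using J codes_above[OF z(1)] unfolding limit_jump_def by blast
    qed
    have "bounded_by D b" using J codes_above[OF y] unfolding limit_jump_def by blast
    then have "next_wild k a D b" unfolding next_wild_def using D ge by blast
    then show "\<exists>a'. codes y a' \<and> next_wild k a a' b" using y by blast
  next
    fix x b y a D assume x: "codes x a" and y: "codes y D" and w: "next_wild k a D b"
    have D: "lt a D" "wild_level k D" "\<And>d. lt a d \<Longrightarrow> lt d D \<Longrightarrow> \<not> wild_level k d" using w unfolding next_wild_def by blast+
    have lv: "liminf_le F x t m \<longleftrightarrow> cofinal_le D t m" if "t < n" for t m
      by (rule liminf_le[OF x D(1,2) _ that]) (rule D(3))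
    have limD: "lim D" using wild_level_wild[OF D(2) k] by (simp add: wild_def)
    have "coord 0 z < H \<and> above n z b" if z: "reach F x z" for z
    proof -
      obtain e where e: "e = a \<or> lt a e" "lt e D" "codes z e" using r2[OF x z D(1,2)] by blast
      have "e \<noteq> mu" using e(2) mu(2) by blast
      then have "coord 0 z < H" using halt e(3) n by (simp add: codes_def)
      moreover have "bounded_by e b" using w e unfolding next_wild_def by blast
      ultimately show ?thesis using codes_above[OF e(3)] by blast
    qed
    moreover have "above n y b" using codes_above[OF y] w unfolding next_wild_def by blast
    moreover have "(cofinal_le D t (coord t y) \<and> (\<forall>m. cofinal_le D t m \<longrightarrow> coord t y \<le> m)) \<or> (coord t y = 0 \<and> (\<forall>m. \<not> cofinal_le D t m))"
      if t: "t < n" for t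
    proof (cases "\<exists>m. cofinal_le D t m")
      case True then show ?thesis using lim_cofinal_le[OF limD t] y t unfolding codes_def by metis
    next
      case False
      then have "V D t = 0" using lim_wild[OF limD, of t] t by (simp add: wild_coords_def)
      then show ?thesis using False y t by (simp add: codes_def)
    qed
    ultimately show "limit_jump H n F x b y" unfolding limit_jump_def by (simp add: lv)
  qed
qed

lemma exact_fact_level_fact: "exact_fact k (level_fact H n N k)"
proof (induction k)
  case 0
  show ?case unfolding exact_fact_def tame_segment_def using ltT by auto
next
  case (Suc k)
  have "exact_jump k (if k = 0 then step_jump H n N else limit_jump H n (level_fact H n N k))" using exact_jump_0 exact_jump_Suc[OF Suc] by simp
  from exact_fact_Suc[OF this Suc] show ?case unfolding level_fact.simps .
qed

text \<open>There is no wild limit of level \<open>n + 1\<close>, so at that level the whole run is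
  a single tame segment with the trivial bound 0.\<close>

theorem run_result:
  assumes x: "codes x a0" and a0: "\<And>d. d \<in> T \<Longrightarrow> d = a0 \<or> lt a0 d"
  shows "(\<exists>y. reach (level_fact H n N (Suc n)) x y \<and> \<not> coord 0 y < H \<and> Q y) \<Longrightarrow> (\<exists>y. codes y mu \<and> Q y)"
    and "\<exists>y. reach (level_fact H n N (Suc n)) x y \<and> codes y mu"
proof -
  note F = exact_fact_D[OF exact_fact_level_fact[of "Suc n"]]
  show "\<exists>y. reach (level_fact H n N (Suc n)) x y \<and> codes y mu"
  proof (cases "mu = a0")
    case True then show ?thesis using x by (auto simp: reach_def)
  next
    case False
    then have "lt a0 mu" using a0 mu(1) by blast
    then have "tame_segment (Suc n) a0 mu 0" unfolding tame_segment_def using wild_level_bound bounded_by_0 by blast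
    moreover obtain y where "codes y mu" using codes_ex mu(1) by blast
    ultimately show ?thesis using F(2)[OF x] unfolding reach_def by blast
  qed
  assume "\<exists>y. reach (level_fact H n N (Suc n)) x y \<and> \<not> coord 0 y < H \<and> Q y"
  then obtain y where y: "reach (level_fact H n N (Suc n)) x y" "\<not> coord 0 y < H" "Q y" by blast
  then obtain e where e: "codes y e" using F(1)[OF _ x] x unfolding reach_def by blast
  then have "\<not> V e 0 < H" "e \<in> T" using y(2) n by (auto simp: codes_def)
  then have "e = mu" using halt by blast
  then show "\<exists>y. codes y mu \<and> Q y" using e y(3) by blast
qed

end

section \<open>Definability of the facts about runs\<close>

lemma definable_cong: "definable R \<Longrightarrow> (\<And>w u. R w u \<longleftrightarrow> R' w u) \<Longrightarrow> definable R'"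
proof -
  assume "definable R" "\<And>w u. R w u \<longleftrightarrow> R' w u"
  then have "R = R'" by (intro ext) auto
  then show "definable R'" using \<open>definable R\<close> by simp
qed

lemma definable_eq: "computable_fun f \<Longrightarrow> computable_fun g \<Longrightarrow> definable (\<lambda>w u. f u = g u)"
  by (rule definable.base[OF decidable_eq])

lemma definable_le: "computable_fun f \<Longrightarrow> computable_fun g \<Longrightarrow> definable (\<lambda>w u. f u \<le> g u)"
  by (rule definable.base[OF decidable_le])

lemma definable_const: "definable (\<lambda>w u. b)"
  by (rule definable.base[OF decidable_const])

lemma definable_mem: "computable_fun f \<Longrightarrow> definable (\<lambda>w u. f u \<in> w)"
  by (rule definable.sub[OF definable.orac])

lemmas definable_not = definable.neg and definable_and = definable.conj

lemma definable_or: assumes "definable R" "definable R'" shows "definable (\<lambda>w u. R w u \<or> R' w u)"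
  by (rule definable_cong[OF definable_not[OF definable_and[OF definable_not[OF assms(1)] definable_not[OF assms(2)]]]]) blast

lemma definable_imp: assumes "definable R" "definable R'" shows "definable (\<lambda>w u. R w u \<longrightarrow> R' w u)"
  by (rule definable_cong[OF definable_or[OF definable_not[OF assms(1)] assms(2)]]) blast

lemma definable_ex:
  assumes "definable (\<lambda>w u. R w (nfst u) (nsnd u))"
  shows "definable (\<lambda>w u. \<exists>x. R w x u)"
  using definable.ex[OF assms] by simp

lemma definable_all:
  assumes "definable (\<lambda>w u. R w (nfst u) (nsnd u))"
  shows "definable (\<lambda>w u. \<forall>x. R w x u)"
proof -
  have "definable (\<lambda>w u. \<not> (\<exists>x. \<not> R w x u))" by (rule definable_not, rule definable_ex, rule definable_not, rule assms)
  then show ?thesis by (rule definable_cong) blast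
qed

text \<open>The bound is a fixed number, so this is a finite conjunction. Coordinates are handled
  for each fixed index separately; an index that is itself an argument is therefore compared with
  every \<open>t < n\<close>.\<close>

lemma definable_ball: "(\<And>t. t < (n :: nat) \<Longrightarrow> definable (R t)) \<Longrightarrow> definable (\<lambda>w u. \<forall>t<n. R t w u)"
proof (induction n)
  case 0 then show ?case using definable_const[of True] by simp
next
  case (Suc n)
  have "definable (\<lambda>w u. (\<forall>t<n. R t w u) \<and> R n w u)" using Suc by (intro definable_and) auto
  then show ?case by (rule definable_cong) (auto simp: less_Suc_eq)
qed

lemma definable_bex:
  assumes "\<And>t. t < (n :: nat) \<Longrightarrow> definable (R t)"
  shows "definable (\<lambda>w u. \<exists>t<n. R t w u)"
proof -
  have "definable (\<lambda>w u. \<forall>t<n. \<not> R t w u)" by (intro definable_ball definable_not assms)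
  from definable_not[OF this] show ?thesis by (rule definable_cong) auto
qed

lemma definable_app2:
  assumes "definable (\<lambda>w z. A w (nfst z) (nsnd z))" "computable_fun f" "computable_fun g"
  shows "definable (\<lambda>w u. A w (f u) (g u))"
  using definable.sub[OF assms(1) computable_fun_npair[OF assms(2,3)]] by simp

lemma definable_app3:
  assumes "definable (\<lambda>w z. B w (nfst z) (nfst (nsnd z)) (nsnd (nsnd z)))" "computable_fun f" "computable_fun g" "computable_fun h"
  shows "definable (\<lambda>w u. B w (f u) (g u) (h u))"
  using definable.sub[OF assms(1) computable_fun_npair[OF assms(2) computable_fun_npair[OF assms(3,4)]]] by simp

lemma definable_game_win:
  assumes "definable (\<lambda>w z. A w (nfst z) (nsnd z))" "definable (\<lambda>w z. B w (nfst z) (nfst (nsnd z)) (nsnd (nsnd z)))"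
  shows "definable (\<lambda>w u. game_win (A w) (B w) u)"
  using definable.lfp[OF assms] by simp

text \<open>A game round begins with a challenge, a derivation with the choice of a rule. So at
  \<open>npair 0 u\<close> the only challenge is the dummy 0 and the answer names a rule, while at
  \<open>npair 1 (npair u g)\<close> the challenge picks a premise and the answer merely moves to
  it.\<close>

lemma definable_derivable:
  assumes A: "definable (\<lambda>w z. A w (nfst z) (nsnd z))" and B: "definable (\<lambda>w z. B w (nfst z) (nfst (nsnd z)) (nsnd (nsnd z)))"
  shows "definable (\<lambda>w u. derivable (A w) (B w) u)"
proof -
  define A1 where "A1 w q g \<longleftrightarrow> (nfst q = 0 \<and> g = 0) \<or> (nfst q \<noteq> 0 \<and> B w (nfst (nsnd q)) (nsnd (nsnd q)) g)" for w q g
  define B1 where "B1 w q g v \<longleftrightarrow> (nfst q = 0 \<and> nfst v = 1 \<and> nfst (nsnd v) = nsnd q \<and> A w (nsnd q) (nsnd (nsnd v))) \<or>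
     (nfst q \<noteq> 0 \<and> v = npair 0 g)" for w q g v
  have 1: "derivable (A w) (B w) u \<Longrightarrow> game_win (A1 w) (B1 w) (npair 0 u)" for w u
  proof (induction rule: derivable.induct)
    case (1 u g)
    have m: "game_win (A1 w) (B1 w) (npair 1 (npair u g))"
    proof (rule game_win.intros)
      fix v assume "A1 w (npair 1 (npair u g)) v"
      then have "B w u g v" by (simp add: A1_def)
      then have "game_win (A1 w) (B1 w) (npair 0 v)" by (rule "1.IH")
      then show "\<exists>x. B1 w (npair 1 (npair u g)) v x \<and> game_win (A1 w) (B1 w) x" by (auto simp: B1_def)
    qed
    show ?case
    proof (rule game_win.intros)
      fix m0
      have "B1 w (npair 0 u) m0 (npair 1 (npair u g))" using 1(1) by (simp add: B1_def)
      then show "\<exists>x. B1 w (npair 0 u) m0 x \<and> game_win (A1 w) (B1 w) x" using m by blast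
    qed
  qed
  have 2: "game_win (A1 w) (B1 w) q \<Longrightarrow> (nfst q = 0 \<longrightarrow> derivable (A w) (B w) (nsnd q)) \<and>
     (nfst q \<noteq> 0 \<longrightarrow> (\<forall>v. B w (nfst (nsnd q)) (nsnd (nsnd q)) v \<longrightarrow> derivable (A w) (B w) v))" for w q
  proof (induction rule: game_win.induct)
    case (1 q)
    show ?case
    proof (intro conjI impI allI)
      assume q: "nfst q = 0"
      then have "A1 w q 0" by (simp add: A1_def)
      from 1[OF this] obtain x where x: "B1 w q 0 x"
        "nfst x \<noteq> 0 \<longrightarrow> (\<forall>v. B w (nfst (nsnd x)) (nsnd (nsnd x)) v \<longrightarrow> derivable (A w) (B w) v)" by blast
      then have x': "nfst x = 1" "nfst (nsnd x) = nsnd q" "A w (nsnd q) (nsnd (nsnd x))" using q by (auto simp: B1_def)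
      then have "derivable (A w) (B w) v" if "B w (nsnd q) (nsnd (nsnd x)) v" for v using x(2) that by simp
      with x'(3) show "derivable (A w) (B w) (nsnd q)" by (rule derivable.intros)
    next
      fix v assume q: "nfst q \<noteq> 0" "B w (nfst (nsnd q)) (nsnd (nsnd q)) v"
      then have "A1 w q v" by (simp add: A1_def)
      from 1[OF this] show "derivable (A w) (B w) v" using q(1) by (auto simp: B1_def)
    qed
  qed
  note tms = computable_fun_id computable_fun_const computable_fun_nfst computable_fun_nsnd computable_fun_npair
  have "definable (\<lambda>w z. A1 w (nfst z) (nsnd z))" unfolding A1_def
    by (intro definable_or definable_and definable_not definable_eq definable_app3[OF B] tms)
  moreover have "definable (\<lambda>w z. B1 w (nfst z) (nfst (nsnd z)) (nsnd (nsnd z)))" unfolding B1_def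
    by (intro definable_or definable_and definable_not definable_eq definable_app2[OF A] tms)
  ultimately have "definable (\<lambda>w. game_win (A1 w) (B1 w))" by (rule definable_game_win)
  from definable.sub[OF this computable_fun_npair[OF computable_fun_const computable_fun_id, of 0]]
  show ?thesis by (rule definable_cong) (use 1 2 in force)
qed

lemma computable_fun_coord: assumes "computable_fun f" shows "computable_fun (\<lambda>u. coord t (f u))"
proof -
  have "computable_fun (\<lambda>x. (nsnd ^^ t) x)" by (induction t) (simp_all add: computable_fun_id computable_fun_nsnd)
  then show ?thesis unfolding coord_def using computable_fun_nfst computable_fun_comp assms by blast
qed

lemma definable_above: "computable_fun f \<Longrightarrow> computable_fun g \<Longrightarrow> definable (\<lambda>w u. above n (f u) (g u))"
  unfolding above_def by (intro definable_ball definable_le computable_fun_coord)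

lemma computable_fun_minus2: "computable_fun f \<Longrightarrow> computable_fun (\<lambda>u. f u - 2)"
  using computable_fun_pred[OF computable_fun_pred[of f]] by (simp add: numeral_2_eq_2)

lemma definable_Fact:
  assumes E: "definable (\<lambda>w z. E w (nfst z) (nfst (nsnd z)) (nsnd (nsnd z)))"
  shows "definable (\<lambda>w z. Fact n (E w) (nfst z) (nfst (nsnd z)) (nsnd (nsnd z)))"
proof -
  note tms = computable_fun_id computable_fun_const computable_fun_nfst computable_fun_nsnd computable_fun_npair computable_fun_coord computable_fun_minus2 computable_fun_pred computable_fun_Suc
  have A: "definable (\<lambda>w z. rule_applies n (E w) (nfst z) (nsnd z))" unfolding rule_applies_def Let_def
    by (intro definable_or definable_and definable_imp definable_ball definable_eq definable_le definable_above definable_app3[OF E] tms)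
  have B: "definable (\<lambda>w z. rule_premise (nfst z) (nfst (nsnd z)) (nsnd (nsnd z)))" unfolding rule_premise_def Let_def
    by (intro definable_or definable_and definable_ex definable_eq definable_le tms)
  show ?thesis unfolding Fact_def by (rule definable.sub[OF definable_derivable[OF A B]]) (intro tms)
qed

lemma definable_reach:
  assumes F: "definable (\<lambda>w z. F w (nfst z) (nfst (nsnd z)) (nsnd (nsnd z)))" and "computable_fun f" "computable_fun g"
  shows "definable (\<lambda>w u. reach (F w) (f u) (g u))"
  unfolding reach_def by (intro definable_or definable_eq definable_app3[OF F] assms computable_fun_const)

lemma definable_level_fact:
  assumes N: "\<And>t. t < n \<Longrightarrow> definable (\<lambda>w z. coord t (nsnd z) = N w (\<lambda>t. coord t (nfst z)) t)"
  shows "definable (\<lambda>w z. level_fact H n (N w) k (nfst z) (nfst (nsnd z)) (nsnd (nsnd z)))"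
proof (induction k)
  case 0 then show ?case using definable_const[of False] by simp
next
  case (Suc k)
  note tms = computable_fun_id computable_fun_const computable_fun_nfst computable_fun_nsnd computable_fun_npair computable_fun_coord computable_fun_Suc
  have N': "definable (\<lambda>w u. coord t (f u) = N w (\<lambda>t. coord t (g u)) t)" if "t < n" "computable_fun f" "computable_fun g" for t f g
    using definable.sub[OF N[OF that(1)] computable_fun_npair[OF that(3,2)]] by simp
  have "definable (\<lambda>w z. coord 0 z < H)" unfolding less_eq_Suc_le by (intro definable_le tms)
  note lt = definable.sub[OF this]
  have S: "definable (\<lambda>w z. step_jump H n (N w) (nfst z) (nfst (nsnd z)) (nsnd (nsnd z)))" unfolding step_jump_def
    by (intro definable_and definable_above definable_ball N' lt tms)
  have L: "definable (\<lambda>w z. limit_jump H n (level_fact H n (N w) k) (nfst z) (nfst (nsnd z)) (nsnd (nsnd z)))"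
  proof -
    have liminf_le: "definable (\<lambda>w u. liminf_le (level_fact H n (N w) k) (f u) t (g u))" if "computable_fun f" "computable_fun g" for t f g
      unfolding liminf_le_def
      by (intro definable_all definable_ex definable_and definable_imp definable_le definable_reach[OF Suc] tms computable_fun_comp[OF that(1)] computable_fun_comp[OF that(2)])
    show ?thesis unfolding limit_jump_def
      by (intro definable_and definable_or definable_not definable_all definable_imp definable_ball definable_eq definable_le definable_above lt liminf_le definable_reach[OF Suc] tms)
  qed
  have "definable (\<lambda>w z. level_fact H n (N w) k (nfst z) (nfst (nsnd z)) (nsnd (nsnd z)) \<or>
     (if k = 0 then step_jump H n (N w) else limit_jump H n (level_fact H n (N w) k)) (nfst z) (nfst (nsnd z)) (nsnd (nsnd z)))"
    by (cases "k = 0") (use Suc S L definable_or in auto)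
  from definable_Fact[OF this] show ?case by simp
qed

section \<open>Programs as instances of abstract halting runs\<close>

fun next_value :: "instr \<Rightarrow> nat set \<Rightarrow> (nat \<Rightarrow> nat) \<Rightarrow> nat \<Rightarrow> nat" where
  "next_value (Zero m) w v t = (if t = 0 then Suc (v 0) else if t = Suc m then 0 else v t)"
| "next_value (Inc m) w v t = (if t = 0 then Suc (v 0) else if t = Suc m then Suc (v (Suc m)) else v t)"
| "next_value (Copy l m) w v t = (if t = 0 then Suc (v 0) else if t = Suc m then v (Suc l) else v t)"
| "next_value (JumpEq l m q) w v t = (if t = 0 then (if v (Suc l) = v (Suc m) then q else Suc (v 0)) else v t)"
| "next_value (OracleJump m q) w v t = (if t = 0 then (if v (Suc m) \<in> w then q else Suc (v 0)) else v t)"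

definition next_vec :: "program \<Rightarrow> nat set \<Rightarrow> (nat \<Rightarrow> nat) \<Rightarrow> nat \<Rightarrow> nat" where
  "next_vec P w v t = (if v 0 < length P then next_value (P ! v 0) w v t else 0)"

fun instr_bound :: "instr \<Rightarrow> nat" where
  "instr_bound (Zero m) = m"
| "instr_bound (Inc m) = m"
| "instr_bound (Copy l m) = max l m"
| "instr_bound (JumpEq l m q) = max l m"
| "instr_bound (OracleJump m q) = m"

text \<open>The line comes first, so register \<open>m\<close> is component \<open>Suc m\<close>;
  input and output, kept in register 0, are component 1.\<close>

definition config_vec :: "config \<Rightarrow> nat \<Rightarrow> nat" where
  "config_vec c t = (case t of 0 \<Rightarrow> fst c | Suc m \<Rightarrow> snd c m)"

lemma config_vec_exec: "config_vec (exec i w c) t = next_value i w (config_vec c) t"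
  by (cases c; cases i; cases t) (auto simp: config_vec_def)

lemma definable_next_value: "definable (\<lambda>w z. coord t (nsnd z) = next_value i w (\<lambda>t. coord t (nfst z)) t)"
proof -
  note tms = computable_fun_id computable_fun_const computable_fun_nfst computable_fun_nsnd computable_fun_coord computable_fun_Suc
  have c: "definable (\<lambda>w z. f z = (if C w z then g z else h z))" if "definable C" "computable_fun f" "computable_fun g" "computable_fun h" for C f g h
  proof -
    have "definable (\<lambda>w z. (C w z \<and> f z = g z) \<or> (\<not> C w z \<and> f z = h z))"
      by (intro definable_or definable_and definable_not definable_eq that)
    then show ?thesis by (rule definable_cong) auto
  qed
  have tif: "computable_fun (\<lambda>u. if b then f u else g u)" if "computable_fun f" "computable_fun g" for b f g using that by (cases b) simp_all
  show ?thesis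
  proof (cases i)
    case (JumpEq l m q)
    show ?thesis
    proof (cases t)
      case 0
      have "definable (\<lambda>w z. coord 0 (nsnd z) = (if coord (Suc l) (nfst z) = coord (Suc m) (nfst z) then q else Suc (coord 0 (nfst z))))"
        by (intro c definable_eq tms)
      then show ?thesis by (simp only: JumpEq 0 next_value.simps if_True simp_thms)
    qed (simp add: JumpEq, intro definable_eq tms)
  next
    case (OracleJump m q)
    show ?thesis
    proof (cases t)
      case 0
      have "definable (\<lambda>w z. coord 0 (nsnd z) = (if coord (Suc m) (nfst z) \<in> w then q else Suc (coord 0 (nfst z))))"
        by (intro c definable_mem tms)
      then show ?thesis by (simp only: OracleJump 0 next_value.simps if_True simp_thms)
    qed (simp add: OracleJump, intro definable_eq tms)
  qed (simp_all only: next_value.simps, (intro definable_eq tif tms)+)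
qed

lemma definable_next_vec: "definable (\<lambda>w z. coord t (nsnd z) = next_vec P w (\<lambda>t. coord t (nfst z)) t)"
proof -
  note tms = computable_fun_id computable_fun_const computable_fun_nfst computable_fun_nsnd computable_fun_coord computable_fun_Suc
  have "definable (\<lambda>w z. (\<exists>l<length P. coord 0 (nfst z) = l \<and> coord t (nsnd z) = next_value (P ! l) w (\<lambda>t. coord t (nfst z)) t) \<or>
     (length P \<le> coord 0 (nfst z) \<and> coord t (nsnd z) = 0))"
    by (intro definable_or definable_and definable_bex definable_eq definable_le definable_next_value tms)
  then show ?thesis by (rule definable_cong) (auto simp: next_vec_def not_less)
qed

lemma next_value_cong:
  assumes "\<And>t. t < n \<Longrightarrow> v t = v' t" "Suc (instr_bound i) < n" "t < n"
  shows "next_value i w v t = next_value i w v' t"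
  using assms by (cases i) auto

lemma halting_line_run:
  fixes r :: "nat set rel"
  assumes run: "halting_run P w init r c" and m: "is_max_of r m"
    and n: "n > 0" "\<And>i. i \<in> set P \<Longrightarrow> Suc (instr_bound i) < n"
  shows "halting_line (strict_below r) (Field r) (\<lambda>a. config_vec (c a)) m (length P) n (next_vec P w)"
proof -
  let ?lt = "strict_below r"
  have wo: "Well_order r"
    and succ: "\<And>a b. imm_pred r b a \<Longrightarrow> c a = step P w (c b)"
    and lims: "\<And>a. a \<in> Field r \<Longrightarrow> \<not> is_min_of r a \<Longrightarrow> \<not> (\<exists>b. imm_pred r b a) \<Longrightarrow>
         c a = (liminf_below r a (\<lambda>d. fst (c d)), \<lambda>k. liminf_below r a (\<lambda>d. snd (c d) k))"
    and hl: "\<And>a. a \<in> Field r \<Longrightarrow> halted P (c a) \<longleftrightarrow> is_max_of r a"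
    using run unfolding halting_run_def by blast+
  have lo: "Refl r" "trans r" "antisym r" "Total r" and wfr: "wf (r - Id)"
    using wo unfolding well_order_on_def linear_order_on_def partial_order_on_def preorder_on_def by blast+
  have total: "a \<in> Field r \<Longrightarrow> b \<in> Field r \<Longrightarrow> a \<noteq> b \<Longrightarrow> (a, b) \<in> r \<or> (b, a) \<in> r" for a b
    using lo(4) unfolding total_on_def by blast
  have trans: "(a, b) \<in> r \<Longrightarrow> (b, d) \<in> r \<Longrightarrow> (a, d) \<in> r" for a b d using lo(2) by (rule transD)
  have anti: "(a, b) \<in> r \<Longrightarrow> (b, a) \<in> r \<Longrightarrow> a = b" for a b using lo(3) by (rule antisymD)
  have fld: "(a, b) \<in> r \<Longrightarrow> a \<in> Field r \<and> b \<in> Field r" for a b by (auto simp: Field_def)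
  have mT: "m \<in> Field r" and mmax: "a \<in> Field r \<Longrightarrow> (a, m) \<in> r" for a using m unfolding is_max_of_def by auto
  have maxm: "is_max_of r a \<longleftrightarrow> a = m" for a
    using m anti unfolding is_max_of_def by blast
  have hl': "fst (c a) < length P \<longleftrightarrow> a \<noteq> m" if "a \<in> Field r" for a
  proof -
    have "halted P (c a) \<longleftrightarrow> a = m" using hl[OF that] maxm[of a] by (rule HOL.trans)
    then show ?thesis unfolding halted_def by (simp add: not_le[symmetric])
  qed
  have lt_le: "?lt a b \<Longrightarrow> (b, d) \<in> r \<Longrightarrow> ?lt a d" "(a, b) \<in> r \<Longrightarrow> ?lt b d \<Longrightarrow> ?lt a d" for a b d
    using trans anti unfolding strict_below_def by blast+
  show ?thesis
  proof
    show "?lt a b \<Longrightarrow> a \<in> Field r \<and> b \<in> Field r" for a b using fld unfolding strict_below_def by blast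
    show "?lt a b \<Longrightarrow> ?lt b d \<Longrightarrow> ?lt a d" for a b d using lt_le unfolding strict_below_def by blast
    show "\<not> ?lt a a" for a unfolding strict_below_def by blast
    show "a \<in> Field r \<Longrightarrow> b \<in> Field r \<Longrightarrow> ?lt a b \<or> a = b \<or> ?lt b a" for a b
      using total unfolding strict_below_def by blast
    have "{(a, b). ?lt a b} = r - Id" unfolding strict_below_def by auto
    then show "wf {(a, b). ?lt a b}" using wfr by simp
    show "m \<in> Field r" using mT .
    show "\<not> ?lt m a" for a using mmax anti fld unfolding strict_below_def by blast
    show "n > 0" using n(1) .
    show "config_vec (c a) 0 < length P \<longleftrightarrow> a \<noteq> m" if "a \<in> Field r" for a
      using hl'[OF that] by (simp add: config_vec_def)
  next
    fix a b t assume ba: "?lt b a" "\<not> (\<exists>d. ?lt b d \<and> ?lt d a)" "t < n"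
    then have "imm_pred r b a" unfolding imm_pred_def by blast
    then have ca: "c a = step P w (c b)" by (rule succ)
    have "b \<in> Field r" "b \<noteq> m" using ba(1) fld mmax anti unfolding strict_below_def by blast+
    then have "fst (c b) < length P" using hl'[of b] by blast
    then show "config_vec (c a) t = next_vec P w (config_vec (c b)) t"
      unfolding ca step_def config_vec_exec next_vec_def by (simp add: config_vec_def)
  next
    fix v v' :: "nat \<Rightarrow> nat" and t assume v: "\<And>t. t < n \<Longrightarrow> v t = v' t" "v 0 < length P" "t < n"
    have v0: "v 0 = v' 0" using v(1) n(1) by blast
    have "next_value (P ! v 0) w v t = next_value (P ! v 0) w v' t"
      by (rule next_value_cong[OF v(1) n(2) v(3)]) (use v(2) in auto)
    then show "next_vec P w v t = next_vec P w v' t" unfolding next_vec_def using v0 v(2) by simp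
  next
    fix a b0 t assume b0: "?lt b0 a" and dn: "\<And>b. ?lt b a \<Longrightarrow> \<exists>d. ?lt b d \<and> ?lt d a" and "t < n"
    have aT: "a \<in> Field r" using b0 fld unfolding strict_below_def by blast
    have "\<not> is_min_of r a" using b0 fld anti unfolding is_min_of_def strict_below_def by blast
    moreover have "\<not> (\<exists>b. imm_pred r b a)" using dn unfolding imm_pred_def by blast
    ultimately have "c a = (liminf_below r a (\<lambda>d. fst (c d)), \<lambda>k. liminf_below r a (\<lambda>d. snd (c d) k))"
      using lims aT by blast
    then have va: "config_vec (c a) t = liminf_below r a (\<lambda>d. config_vec (c d) t)"
      unfolding config_vec_def by (cases t) simp_all
    define cf where "cf k \<longleftrightarrow> (\<forall>b. ?lt b a \<longrightarrow> (\<exists>d. ?lt b d \<and> ?lt d a \<and> config_vec (c d) t \<le> k))" for k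
    \<comment> \<open>At a limit time the later time \<open>d\<close> can be taken strictly after
      \<open>b\<close>, which reconciles the reflexive order in \<open>liminf_below\<close> with the
      strict one of the locale.\<close>
    have cf: "(\<forall>b. ?lt b a \<longrightarrow> (\<exists>d. (b, d) \<in> r \<and> ?lt d a \<and> config_vec (c d) t \<le> k)) \<longleftrightarrow> cf k" for k
    proof
      assume *: "\<forall>b. ?lt b a \<longrightarrow> (\<exists>d. (b, d) \<in> r \<and> ?lt d a \<and> config_vec (c d) t \<le> k)"
      show "cf k" unfolding cf_def using * dn lt_le by meson
    qed (auto simp: cf_def strict_below_def)
    have v: "config_vec (c a) t = (if \<exists>k. cf k then LEAST k. cf k else 0)"
      unfolding va liminf_below_def cf ..
    show "(\<forall>k. (\<forall>b. ?lt b a \<longrightarrow> (\<exists>d. ?lt b d \<and> ?lt d a \<and> config_vec (c d) t \<le> k)) \<longrightarrow>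
          (\<forall>b. ?lt b a \<longrightarrow> (\<exists>d. ?lt b d \<and> ?lt d a \<and> config_vec (c d) t \<le> config_vec (c a) t)) \<and> config_vec (c a) t \<le> k) \<and>
       ((\<forall>k. \<exists>b. ?lt b a \<and> (\<forall>d. ?lt b d \<longrightarrow> ?lt d a \<longrightarrow> k < config_vec (c d) t)) \<longrightarrow> config_vec (c a) t = 0)"
      unfolding cf_def[symmetric]
    proof (intro conjI allI impI)
      fix k assume k: "cf k"
      then have "config_vec (c a) t = (LEAST k. cf k)" unfolding v by auto
      then show "cf (config_vec (c a) t)" "config_vec (c a) t \<le> k" using k by (auto intro: LeastI Least_le)
    next
      assume *: "\<forall>k. \<exists>b. ?lt b a \<and> (\<forall>d. ?lt b d \<longrightarrow> ?lt d a \<longrightarrow> k < config_vec (c d) t)"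
      have "\<not> cf k" for k using * unfolding cf_def by (meson not_less)
      then have "\<not> (\<exists>k. cf k)" by blast
      then show "config_vec (c a) t = 0" unfolding v by (simp only: if_False)
    qed
  qed
qed

text \<open>One definition for all oracles and inputs. It is tied to the output only where the
  program halts, as it does on every input for the oracle of a reduction.\<close>

theorem program_definable:
  "\<exists>R. definable R \<and> (\<forall>w i j. halts_with P w i j \<longrightarrow> (R w i \<longleftrightarrow> j = 1))"
proof -
  \<comment> \<open>The sum bounds every register index in the program; the three successors leave
    room for the shift by one and make component 1 exist even if no register is mentioned.\<close>
  define n where "n = Suc (Suc (Suc (sum_list (map instr_bound P))))"
  have "instr_bound i \<le> sum_list (map instr_bound P)" if "i \<in> set P" for i
    by (rule member_le_sum_list) (use that in simp_all)
  then have nb: "n > 1" "\<And>i. i \<in> set P \<Longrightarrow> Suc (instr_bound i) < n" by (auto simp: n_def le_imp_less_Suc le_SucI)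
  let ?F = "\<lambda>w. level_fact (length P) n (next_vec P w) (Suc n)"
  define R where "R w i \<longleftrightarrow> (\<exists>x y. (\<forall>t<n. coord t x = (if t = 1 then i else 0)) \<and> reach (?F w) x y \<and>
     \<not> coord 0 y < length P \<and> coord 1 y = 1)" for w i
  note tms = computable_fun_id computable_fun_const computable_fun_nfst computable_fun_nsnd computable_fun_coord computable_fun_Suc
  have F: "definable (\<lambda>w z. ?F w (nfst z) (nfst (nsnd z)) (nsnd (nsnd z)))" by (rule definable_level_fact) (rule definable_next_vec)
  have tif: "computable_fun (\<lambda>u. if b then f u else g u)" if "computable_fun f" "computable_fun g" for b f g using that by (cases b) simp_all
  have "definable R" unfolding R_def not_less
    by (intro definable_ex definable_and definable_ball definable_eq definable_le definable_reach[OF F] tif tms)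
  moreover have "R w i \<longleftrightarrow> j = 1" if "halts_with P w i j" for w i j
  proof -
    obtain r :: "nat set rel" and c m where run: "halting_run P w (\<lambda>k. if k = 0 then i else 0) r c"
      and m: "is_max_of r m" "snd (c m) 0 = j"
      using \<open>halts_with P w i j\<close> unfolding halts_with_def by blast
    interpret halting_line "strict_below r" "Field r" "\<lambda>a. config_vec (c a)" m "length P" n "next_vec P w"
      by (rule halting_line_run[OF run m(1)]) (use nb(1) in simp, rule nb(2))
    obtain a0 where a0: "a0 \<in> Field r" "\<And>b. strict_below r b a0 \<Longrightarrow> b \<notin> Field r"
      using least[of "\<lambda>a. a \<in> Field r" m] mu(1) by blast
    have a0': "d = a0 \<or> strict_below r a0 d" if "d \<in> Field r" for d
      using tot[OF a0(1) that] a0(2) that by blast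
    have rf: "(a0, a0) \<in> r" using run a0(1) unfolding halting_run_def well_order_on_def linear_order_on_def
        partial_order_on_def preorder_on_def refl_on_def by blast
    have "is_min_of r a0" unfolding is_min_of_def using a0(1) a0' rf by (auto simp: strict_below_def)
    then have c0: "c a0 = (0, \<lambda>k. if k = 0 then i else 0)" using run unfolding halting_run_def by blast
    have v0: "config_vec (c a0) t = (if t = 1 then i else 0)" for t
      unfolding c0 config_vec_def by (cases t) auto
    have reps: "codes x a0 \<longleftrightarrow> (\<forall>t<n. coord t x = (if t = 1 then i else 0))" for x
      unfolding codes_def v0 using a0(1) by simp
    have vm: "config_vec (c m) 1 = j" using m(2) by (simp add: config_vec_def)
    show ?thesis
    proof
      assume "R w i"
      then obtain x y where x: "codes x a0" and y: "reach (?F w) x y" "\<not> coord 0 y < length P" "coord 1 y = 1"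
        unfolding R_def reps[symmetric] by blast
      then obtain y' where "codes y' m" "coord 1 y' = 1"
        using run_result(1)[OF x a0', of "\<lambda>y. coord 1 y = 1"] by blast
      then show "j = 1" using vm nb(1) by (auto simp: codes_def)
    next
      assume j: "j = 1"
      obtain x where x: "codes x a0" using codes_ex a0(1) by blast
      obtain y where y: "reach (?F w) x y" "codes y m" using run_result(2)[OF x a0'] by blast
      have "coord 0 y = config_vec (c m) 0" "coord 1 y = config_vec (c m) 1" using y(2) nb(1) by (auto simp: codes_def)
      then have "\<not> coord 0 y < length P" "coord 1 y = 1" using halt[OF mu(1)] vm j by auto
      then show "R w i" unfolding R_def reps[symmetric] using x y(1) by blast
    qed
  qed
  ultimately show ?thesis by blast
qed

section \<open>The theorem\<close>

lemma open_cylinder: "open {g :: nat \<Rightarrow> bool. \<forall>i<n. g i = f i}"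
proof -
  have "{g :: nat \<Rightarrow> bool. \<forall>i<n. g i = f i} = (\<Inter>i\<in>{..<n}. (\<lambda>g. g i) -` {f i})" by auto
  moreover have "open ((\<lambda>g :: nat \<Rightarrow> bool. g i) -` {f i})" for i
    by (intro open_vimage open_discrete continuous_on_product_coordinates)
  ultimately show ?thesis by (simp add: open_INT)
qed

lemma open_contains_cylinder:
  fixes f :: "nat \<Rightarrow> bool"
  assumes "open U" "f \<in> U"
  obtains n where "{g. \<forall>i<n. g i = f i} \<subseteq> U"
proof -
  obtain W where W: "finite {i. W i \<noteq> (UNIV :: bool set)}" "f \<in> Pi\<^sub>E UNIV W" "Pi\<^sub>E UNIV W \<subseteq> U"
    using assms unfolding open_fun_def openin_product_topology_alt by fastforce
  obtain n where n: "\<And>i. W i \<noteq> UNIV \<Longrightarrow> i < n"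
    using finite_nat_set_iff_bounded[of "{i. W i \<noteq> UNIV}"] W(1) by blast
  have "g \<in> Pi\<^sub>E UNIV W" if "\<forall>i<n. g i = f i" for g
  proof -
    have "g i \<in> W i" for i
    proof (cases "i < n")
      case True then show ?thesis using that W(2) by (auto simp: PiE_def Pi_def)
    next
      case False then show ?thesis using n[of i] by auto
    qed
    then show ?thesis by (simp add: PiE_def)
  qed
  then show ?thesis using W(3) by (intro that[of n]) blast
qed

text \<open>Such a set is nowhere dense: a cylinder inside the closure gives a condition
  \<open>p\<close>, and the cylinder of its extension \<open>q\<close> would be an open set that
  meets the closure of the image of \<open>X\<close> but not the image itself.\<close>

lemma meager_realsI:
  assumes A: "\<And>p. \<exists>q. extends q p \<and> (\<forall>w. prefix_of q w \<longrightarrow> w \<notin> X)"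
  shows "meager_reals X"
proof -
  let ?A = "(\<lambda>w n. n \<in> w) ` X :: (nat \<Rightarrow> bool) set"
  have "interior (closure ?A) = {}"
  proof (rule ccontr)
    assume "interior (closure ?A) \<noteq> {}"
    then obtain f where f: "f \<in> interior (closure ?A)" by blast
    obtain n where n: "{g. \<forall>i<n. g i = f i} \<subseteq> interior (closure ?A)"
      using open_contains_cylinder[OF open_interior f] by blast
    define p where "p = npair n (set_encode ({i. f i} \<inter> {..<n}))"
    have p: "i \<in> set_decode (nsnd p) \<longleftrightarrow> f i" if "i < n" for i
      using that by (simp add: p_def set_encode_inverse)
    obtain q where q: "extends q p" "\<And>w. prefix_of q w \<Longrightarrow> w \<notin> X" using A by blast
    define g where "g i \<longleftrightarrow> i \<in> set_decode (nsnd q)" for i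
    have "g i = f i" if "i < n" for i
      using q(1) p[OF that] that unfolding extends_def g_def by (simp add: p_def)
    then have g: "g \<in> closure ?A" using n interior_subset by blast
    have "{h. \<forall>i<nfst q. h i = g i} \<inter> ?A \<noteq> {}"
      using open_Int_closure_eq_empty[OF open_cylinder[of "nfst q" g], of ?A] g by blast
    then obtain w where w: "w \<in> X" "\<forall>i<nfst q. (i \<in> w) = g i" by auto
    then have "prefix_of q w" by (simp add: prefix_of_def g_def)
    then show False using q(2) w(1) by blast
  qed
  then have "nowhere_dense ?A" by (simp add: nowhere_dense_def)
  then show ?thesis unfolding meager_reals_def meager_def by (intro exI[of _ "{?A}"]) simp
qed

section \<open>From randomness to genericity, and the computation of the common real\<close>

definition left :: "nat set \<Rightarrow> nat set" where "left v = {i. i + i \<in> v}"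
definition right :: "nat set \<Rightarrow> nat set" where "right v = {i. Suc (i + i) \<in> v}"

lemma join_left [simp]: "left (a \<oplus>\<^sub>r b) = a"
proof -
  have "i + i \<noteq> 2 * j + 1" "i + i = 2 * j \<longleftrightarrow> i = j" for i j :: nat by presburger+
  then show ?thesis by (auto simp: left_def join_def)
qed

lemma join_right [simp]: "right (a \<oplus>\<^sub>r b) = b"
proof -
  have "Suc (i + i) \<noteq> 2 * j" "Suc (i + i) = 2 * j + 1 \<longleftrightarrow> i = j" for i j :: nat by presburger+
  then show ?thesis by (auto simp: right_def join_def)
qed

lemma decidable_left: "computable_fun f \<Longrightarrow> decidable (\<lambda>v u. f u \<in> left v)"
  unfolding left_def mem_Collect_eq by (intro decidable_oracle computable_fun_add)

lemma decidable_right: "computable_fun f \<Longrightarrow> decidable (\<lambda>v u. f u \<in> right v)"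
  unfolding right_def mem_Collect_eq by (intro decidable_oracle computable_fun_add computable_fun_Suc)

lemma decidable_prefix_of_left: assumes "computable_fun f" shows "decidable (\<lambda>v u. prefix_of (f u) (left v))"
  unfolding prefix_of_def less_eq_Suc_le
  by (intro decidable_all decidable_imp decidable_iff decidable_le decidable_left decidable_bit computable_fun_Suc computable_fun_nfst computable_fun_nsnd computable_fun_id computable_fun_comp[OF assms])

text \<open>Randomness enters the argument only in this form, for decidable nowhere dense sets. The
  test \<open>R\<close> reads the join and so has access to both \<open>w\<close> and
  \<open>y\<close>.\<close>

lemma random_avoids:
  assumes "itrm_c_random_rel x y" "decidable (\<lambda>v u. R v)" "\<And>w. w \<in> X \<longleftrightarrow> R (w \<oplus>\<^sub>r y)"
    "\<And>p. \<exists>q. extends q p \<and> (\<forall>w. prefix_of q w \<longrightarrow> w \<notin> X)"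
  shows "x \<notin> X"
proof -
  obtain P where P: "\<And>w i. halts_with P w i (if R w then 1 else 0)" using decidable_halts[OF assms(2)] by blast
  have "itrm_decidable_in X y" unfolding itrm_decidable_in_def
  proof (intro exI[of _ P] allI conjI impI)
    fix w
    show "halts_with P (w \<oplus>\<^sub>r y) 0 1" if "w \<in> X"
      using P[of "w \<oplus>\<^sub>r y" 0] that assms(3) by simp
    show "halts_with P (w \<oplus>\<^sub>r y) 0 0" if "w \<notin> X"
      using P[of "w \<oplus>\<^sub>r y" 0] that assms(3) by simp
  qed
  moreover have "meager_reals X" using meager_realsI assms(4) by blast
  ultimately show ?thesis using assms(1) unfolding itrm_c_random_rel_def by blast
qed

text \<open>The reals with no prefix in a dense set of conditions are nowhere dense, since every
  condition extends into that set; membership is a number quantifier over prefixes of the left half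
  of the join.\<close>

lemma random_generic:
  assumes "itrm_c_random_rel x y" shows "generic x"
  unfolding generic_def
proof (intro allI impI)
  fix E assume E: "decidable (\<lambda>_. E) \<and> dense E"
  have "x \<notin> {w. \<not> (\<exists>p. prefix_of p w \<and> E p)}"
  proof (rule random_avoids[OF assms])
    have "decidable (\<lambda>_. E)" using E by blast
    note E' = decidable_subst[OF this]
    show "decidable (\<lambda>v u. \<not> (\<exists>p. prefix_of p (left v) \<and> E p))"
      by (intro decidable_not decidable_ex decidable_and decidable_prefix_of_left E' computable_fun_nfst computable_fun_id)
    show "\<exists>q. extends q p \<and> (\<forall>w. prefix_of q w \<longrightarrow> w \<notin> {w. \<not> (\<exists>p. prefix_of p w \<and> E p)})" for p
      using E unfolding dense_def by blast
  qed simp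
  then show "\<exists>p. prefix_of p x \<and> E p" by blast
qed

theorem mainTheorem4:
  fixes x y z :: "nat set"
  assumes "mutually_itrm_c_random x y"
    and "z \<le>\<^sub>I\<^sub>T\<^sub>R\<^sub>M x"
    and "z \<le>\<^sub>I\<^sub>T\<^sub>R\<^sub>M y"
  shows "itrm_computable z"
proof -
  have xy: "itrm_c_random_rel x y" using assms(1) by (simp add: mutually_itrm_c_random_def)
  have gx: "generic x" by (rule random_generic[OF xy])
  have def_of: "\<exists>R. definable R \<and> (\<forall>i. R v i \<longleftrightarrow> i \<in> z)" if "z \<le>\<^sub>I\<^sub>T\<^sub>R\<^sub>M v" for v
  proof -
    obtain P where P: "\<And>i. (i \<in> z \<longrightarrow> halts_with P v i 1) \<and> (i \<notin> z \<longrightarrow> halts_with P v i 0)"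
      using \<open>z \<le>\<^sub>I\<^sub>T\<^sub>R\<^sub>M v\<close> unfolding itrm_reducible_def by blast
    obtain R where R: "definable R" "\<And>w i j. halts_with P w i j \<Longrightarrow> R w i \<longleftrightarrow> j = 1"
      using program_definable[of P] by blast
    have "R v i \<longleftrightarrow> i \<in> z" for i
      using P[of i] R(2)[of v i 1] R(2)[of v i 0] by auto
    then show ?thesis using R(1) by blast
  qed
  obtain R where R: "definable R" "\<And>i. R x i \<longleftrightarrow> i \<in> z" using def_of assms(2) by blast
  obtain S where S: "definable S" "\<And>i. S y i \<longleftrightarrow> i \<in> z" using def_of assms(3) by blast
  obtain F where F: "forces R F" using definable_forces R(1) by blast
  note f = forcesD[OF F]
  \<comment> \<open>A condition is bad if it forces some number into the set computed from the first
    oracle although the computation from \<open>y\<close> rejects it. The second oracle is the right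
    half of the join, so badness is decidable there.\<close>
  define bad where "bad v p \<longleftrightarrow> (\<exists>i. F p i \<and> \<not> S (right v) i)" for v p
  have right: "decidable (\<lambda>v. S (right v))" by (rule definable_decidable[OF S(1)]) (intro decidable_right computable_fun_id)
  have bad_decidable: "decidable (\<lambda>v u. bad v u)" unfolding bad_def
    by (intro decidable_ex decidable_and decidable_not decidable_app2[OF f(1)] decidable_subst[OF right] computable_fun_nfst computable_fun_nsnd computable_fun_id)
  have bad: "bad (w \<oplus>\<^sub>r y) p \<longleftrightarrow> (\<exists>i. F p i \<and> i \<notin> z)" for w p
    by (simp add: bad_def S(2))
  \<comment> \<open>The boundary of the open set given by the bad conditions: reals outside it that
    it approaches. The boundary of an open set is nowhere dense whatever the set is, so nothing
    needs to be known about how many conditions are bad.\<close>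
  let ?X = "{w. (\<forall>p. prefix_of p w \<longrightarrow> \<not> bad (w \<oplus>\<^sub>r y) p) \<and> (\<forall>p. prefix_of p w \<longrightarrow> (\<exists>q. extends q p \<and> bad (w \<oplus>\<^sub>r y) q))}"
  have "x \<notin> ?X"
  proof (rule random_avoids[OF xy])
    show "decidable (\<lambda>v u. (\<forall>p. prefix_of p (left v) \<longrightarrow> \<not> bad v p) \<and> (\<forall>p. prefix_of p (left v) \<longrightarrow> (\<exists>q. extends q p \<and> bad v q)))"
      by (intro decidable_and decidable_all decidable_imp decidable_not decidable_ex decidable_prefix_of_left decidable_extends decidable_subst[OF bad_decidable] computable_fun_nfst computable_fun_nsnd computable_fun_id)
    show "\<exists>q. extends q p \<and> (\<forall>w. prefix_of q w \<longrightarrow> w \<notin> ?X)" for p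
    proof (cases "\<exists>q. extends q p \<and> bad (x \<oplus>\<^sub>r y) q")
      case True
      then show ?thesis unfolding bad by blast
    next
      case False
      then have "w \<notin> ?X" if "prefix_of p w" for w using that unfolding bad by blast
      then show ?thesis using extends_refl by blast
    qed
  qed simp
  \<comment> \<open>What a prefix of \<open>x\<close> forces is true of \<open>x\<close> by the
    truth lemma, so it is never wrong about \<open>z\<close>. Being outside the boundary,
    \<open>x\<close> then has a prefix without bad extensions.\<close>
  moreover have "\<not> bad (x \<oplus>\<^sub>r y) p" if "prefix_of p x" for p
    unfolding bad using f(4)[OF gx that] R(2) by blast
  ultimately obtain p0 where p0: "prefix_of p0 x" "\<And>q. extends q p0 \<Longrightarrow> \<not> (\<exists>i. F q i \<and> i \<notin> z)"
    unfolding bad by blast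
  \<comment> \<open>Extensions of \<open>p0\<close> force no wrong membership, and each right one is
    forced by a prefix of \<open>x\<close>, which has a common extension with \<open>p0\<close>. The
    right side mentions no oracle.\<close>
  have z: "i \<in> z \<longleftrightarrow> (\<exists>q. extends q p0 \<and> F q i)" for i
  proof
    assume "i \<in> z"
    then obtain p where p: "prefix_of p x" "F p i" using f(3)[OF gx] R(2) by blast
    obtain r where "extends r p0" "extends r p" using common_extends[OF p0(1) p(1)] by blast
    then show "\<exists>q. extends q p0 \<and> F q i" using f(2)[OF p(2)] by blast
  qed (use p0(2) in blast)
  have "decidable (\<lambda>_ i. \<exists>q. extends q p0 \<and> F q i)"
    by (intro decidable_ex decidable_and decidable_extends decidable_app2[OF f(1)] computable_fun_nfst computable_fun_nsnd computable_fun_id computable_fun_const)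
  from decidable_halts[OF this]
  obtain P where "\<And>w i. halts_with P w i (if \<exists>q. extends q p0 \<and> F q i then 1 else 0)" by blast
  then have P: "halts_with P w i (if i \<in> z then 1 else 0)" for w i unfolding z .
  show ?thesis unfolding itrm_computable_def itrm_reducible_def
  proof (intro exI[of _ P] allI conjI impI)
    fix i
    show "i \<in> z \<Longrightarrow> halts_with P {} i 1" "i \<notin> z \<Longrightarrow> halts_with P {} i 0" using P[of "{}" i] by auto
  qed
qed

end
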